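(* Let $p\ge2$ be an integer, $(\beta,h)\in(0,\infty)\times\mathbb R$, $(\bar\beta,\bar h)\in\mathbb R^2$, and let $A,B,R_1,R_2,R_3,\mu_n^r,\mu_n^s,M_n$ be as in the context. All limits are as $n\to\infty$. (i) If $(\beta,h)\in R_1$ with unique maximizer $a_*$, then under $\mu_n^r$: $M_n/n\to 2a_*-1$ in law; for every sufficiently small $\delta>0$ there is $c>0$ with $\mu_n^r(|M_n/n-(2a_*-1)|>\delta)\le e^{-cn}$ for all large $n$; and the central limit theorem holds with Wasserstein rate $n^{-1/2}$: $$d_{\mathrm W}\Big(\frac{M_n-n(2a_*-1)}{\sqrt n},\,N\Big(\frac{2B'(a_* )}{|A''(a_* )|},\frac{4}{|A''(a_* )|}\Big)\Big)=O(n^{-1/2}).$$ (ii) If $(\beta,h)\in R_2$ with maximizers $a_1<\dots<a_k$, then under $\mu_n^r$: for every sufficiently small $\delta>0$ there is $c>0$ with $\mu_n^r(|M_n/n-(2a_i-1)|>\delta\text{ for all }1\le i\le k)\le e^{-cn}$ for all large $n$; with $J_1=\{i:B(a_i)=\max_{l}B(a_l)\}$, $M_n/n$ converges in law to $\sum_{i\in J_1}p_i\delta_{2a_i-1}$, where $p_i=q_ie^{\nu_i}/\sum_{l\in J_1}q_le^{\nu_l}$, $q_i=\int_{\mathbb R}\exp(\tfrac12A''(a_i)x^2+B'(a_i)x)\,dx$, $e^{\nu_i}=(a_i(1-a_i))^{-1/2}$; and for every $i\in\{1,\dots,k\}$ and every sufficiently small $\delta>0$ the conditional central limit theorem holds: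 $$d_{\mathrm W}\Big(\mathcal L\Big(\frac{M_n-n(2a_i-1)}{\sqrt n}\,\Big|\,|M_n/n-(2a_i-1)|\le\delta\Big),\,N\Big(\frac{2B'(a_i)}{|A''(a_i)|},\frac{4}{|A''(a_i)|}\Big)\Big)=O(n^{-1/2}).$$ (iii) If $(\beta,h)\in R_3$ with unique maximizer $a_*$, then under $\mu_n^s$ $$d_{\mathrm W}(W_n,Y)=O(n^{-1/4}),\qquad W_n=\frac{M_n-n(2a_*-1)}{n^{3/4}},$$ where $Y$ has density proportional to $\exp\big(\frac{c_*x^4}{16}+\frac{b_*x}{2}\big)$, with $c_*=A^{(4)}(a_* )/24$ and $b_*=B'(a_* )$.
   Context: For $\omega\in\{1,-1\}^n$ let $\bar\omega_+=|\{i:\omega_i=1\}|/n$ and $M_n=\omega_1+\dots+\omega_n$. Let $I(a)=-a\log a-(1-a)\log(1-a)$ on $[0,1]$ ($0\log 0=0$), $f_{\beta,h}(a)=\beta(2a-1)^p+h(2a-1)$, $A=f_{\beta,h}+I$ and $B=f_{\bar\beta,\bar h}$ (same formula with $(\bar\beta,\bar h)$). The perturbed $p$-spin Curie–Weiss measures on $\{1,-1\}^n$ are $\mu_n^r(\omega)\propto\exp\big(nf_{\beta,h}(\bar\omega_+)+\sqrt n\,B(\bar\omega_+)\big)$ and $\mu_n^s(\omega)\propto\exp\big(nf_{\beta,h}(\bar\omega_+)+n^{1/4}B(\bar\omega_+)\big)$. A maximizer $a$ of $A$ is $2m$-regular if $A^{(k)}(a)=0$ for $1\le k\le2m-1$ and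 $A^{(2m)}(a)<0$. It is known (and used as part of the setting) that $(0,\infty)\times\mathbb R$ is partitioned into: $R_1$, where $A$ has a unique maximizer $a_*\in(0,1)$ and it is 2-regular; $R_2$, where $A$ has multiple maximizers $0<a_1<\dots<a_k<1$ (all 2-regular); $R_3$, where $A$ has a unique maximizer $a_*\in(0,1)$ and $A''(a_* )=0$ (then $a_*$ is 4-regular). $d_{\mathrm W}(X,Y)=\sup_{\|h'\|_\infty\le1}|\mathbb Eh(X)-\mathbb Eh(Y)|$; $N(\mu,\sigma^2)$ is the normal law with variance $\sigma^2$. Constants in $O(\cdot)$ do not depend on $n$. *)

theory Defs
  imports "HOL-Probability.Probability"
begin

section \<open>The variational problem\<close>

definition binary_entropy :: "real \<Rightarrow> real" where
  "binary_entropy a = - a * ln a - (1 - a) * ln (1 - a)"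

definition pspin :: "nat \<Rightarrow> real \<Rightarrow> real \<Rightarrow> real \<Rightarrow> real" where
  "pspin p \<beta> h a = \<beta> * (2 * a - 1) ^ p + h * (2 * a - 1)"

text \<open>\<open>free_energy p \<beta> h\<close> is the function \<open>A\<close>; the function \<open>B\<close> is \<open>pspin p \<beta>' h'\<close> with the
  perturbation parameters. Both are relevant on \<open>[0,1]\<close> only (note \<open>ln 0 = 0\<close>), and derivatives are
  only taken at interior points.\<close>

definition free_energy :: "nat \<Rightarrow> real \<Rightarrow> real \<Rightarrow> real \<Rightarrow> real" where
  "free_energy p \<beta> h a = pspin p \<beta> h a + binary_entropy a"

definition maximizers :: "nat \<Rightarrow> real \<Rightarrow> real \<Rightarrow> real set" where
  "maximizers p \<beta> h = {a. is_arg_max (free_energy p \<beta> h) (\<lambda>x. x \<in> {0..1}) a}"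

text \<open>\<open>regular_at m F a\<close>: the point \<open>a\<close> is \<open>2m\<close>-regular for \<open>F\<close>.\<close>

definition regular_at :: "nat \<Rightarrow> (real \<Rightarrow> real) \<Rightarrow> real \<Rightarrow> bool" where
  "regular_at m F a \<longleftrightarrow>
     (\<forall>k\<in>{1..2 * m - 1}. (deriv ^^ k) F a = 0) \<and> (deriv ^^ (2 * m)) F a < 0"

definition R1 :: "nat \<Rightarrow> (real \<times> real) set" where
  "R1 p = {(\<beta>, h). 0 < \<beta> \<and>
     (\<exists>a\<in>{0<..<1}. maximizers p \<beta> h = {a} \<and> regular_at 1 (free_energy p \<beta> h) a)}"

definition R2 :: "nat \<Rightarrow> (real \<times> real) set" where
  "R2 p = {(\<beta>, h). 0 < \<beta> \<and> finite (maximizers p \<beta> h) \<and> 2 \<le> card (maximizers p \<beta> h) \<and>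
     maximizers p \<beta> h \<subseteq> {0<..<1} \<and>
     (\<forall>a\<in>maximizers p \<beta> h. regular_at 1 (free_energy p \<beta> h) a)}"

definition R3 :: "nat \<Rightarrow> (real \<times> real) set" where
  "R3 p = {(\<beta>, h). 0 < \<beta> \<and>
     (\<exists>a\<in>{0<..<1}. maximizers p \<beta> h = {a} \<and> (deriv ^^ 2) (free_energy p \<beta> h) a = 0)}"

section \<open>The perturbed Curie--Weiss measures\<close>

definition configs :: "nat \<Rightarrow> (nat \<Rightarrow> real) set" where
  "configs n = {1..n} \<rightarrow>\<^sub>E {1, -1}"

definition frac_plus :: "nat \<Rightarrow> (nat \<Rightarrow> real) \<Rightarrow> real" where
  "frac_plus n \<omega> = real (card {i\<in>{1..n}. \<omega> i = 1}) / real n"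

definition magnetization :: "nat \<Rightarrow> (nat \<Rightarrow> real) \<Rightarrow> real" where
  "magnetization n \<omega> = (\<Sum>i=1..n. \<omega> i)"

definition gibbs :: "nat \<Rightarrow> (real \<Rightarrow> real) \<Rightarrow> (nat \<Rightarrow> real) measure" where
  "gibbs n H = point_measure (configs n)
     (\<lambda>\<omega>. ennreal (exp (H (frac_plus n \<omega>)) / (\<Sum>\<eta>\<in>configs n. exp (H (frac_plus n \<eta>)))))"

definition mu_r :: "nat \<Rightarrow> real \<Rightarrow> real \<Rightarrow> real \<Rightarrow> real \<Rightarrow> nat \<Rightarrow> (nat \<Rightarrow> real) measure" where
  "mu_r p \<beta> h \<beta>' h' n = gibbs n (\<lambda>a. real n * pspin p \<beta> h a + sqrt (real n) * pspin p \<beta>' h' a)"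

definition mu_s :: "nat \<Rightarrow> real \<Rightarrow> real \<Rightarrow> real \<Rightarrow> real \<Rightarrow> nat \<Rightarrow> (nat \<Rightarrow> real) measure" where
  "mu_s p \<beta> h \<beta>' h' n =
     gibbs n (\<lambda>a. real n * pspin p \<beta> h a + real n powr (1 / 4) * pspin p \<beta>' h' a)"

section \<open>Laws on the real line\<close>

text \<open>The test functions with \<open>\<parallel>g'\<parallel>\<^sub>\<infinity> \<le> 1\<close> (\<open>g\<close> absolutely continuous, essential supremum) are
  exactly the 1-Lipschitz functions. The definition is meant for laws with a finite first moment,
  for which all the integrals exist.\<close>

definition wasserstein :: "real measure \<Rightarrow> real measure \<Rightarrow> ennreal" where
  "wasserstein M N = (SUP g\<in>{g :: real \<Rightarrow> real. 1-lipschitz_on UNIV g}.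
     ennreal \<bar>integral\<^sup>L M g - integral\<^sup>L N g\<bar>)"

text \<open>The second parameter is the variance.\<close>

definition normal_law :: "real \<Rightarrow> real \<Rightarrow> real measure" where
  "normal_law m v = density lborel (\<lambda>x. ennreal (normal_density m (sqrt v) x))"

definition quartic_law :: "real \<Rightarrow> real \<Rightarrow> real measure" where
  "quartic_law c b = density lborel (\<lambda>x. ennreal
     (exp (c * x ^ 4 / 16 + b * x / 2) / (LBINT y. exp (c * y ^ 4 / 16 + b * y / 2))))"

text \<open>\<open>discrete_law J w x\<close> is the sum of the point masses \<open>w i\<close> at \<open>x i\<close> over \<open>i \<in> J\<close>.\<close>

definition discrete_law :: "nat set \<Rightarrow> (nat \<Rightarrow> real) \<Rightarrow> (nat \<Rightarrow> real) \<Rightarrow> real measure" where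
  "discrete_law J w x = distr (point_measure J (\<lambda>i. ennreal (w i))) borel x"

section \<open>The limiting weights\<close>

definition top_indices :: "(real \<Rightarrow> real) \<Rightarrow> nat \<Rightarrow> (nat \<Rightarrow> real) \<Rightarrow> nat set" where
  "top_indices B k a = {i\<in>{1..k}. B (a i) = Max ((\<lambda>l. B (a l)) ` {1..k})}"

text \<open>\<open>mode_weight A B a\<close> is \<open>q e\<^sup>\<nu>\<close> at the maximizer \<open>a\<close>.\<close>

definition mode_weight :: "(real \<Rightarrow> real) \<Rightarrow> (real \<Rightarrow> real) \<Rightarrow> real \<Rightarrow> real" where
  "mode_weight A B a =
     (LBINT x. exp (1 / 2 * (deriv ^^ 2) A a * x\<^sup>2 + deriv B a * x)) * (a * (1 - a)) powr (- 1 / 2)"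

definition mode_prob ::
  "(real \<Rightarrow> real) \<Rightarrow> (real \<Rightarrow> real) \<Rightarrow> nat \<Rightarrow> (nat \<Rightarrow> real) \<Rightarrow> nat \<Rightarrow> real" where
  "mode_prob A B k a i =
     mode_weight A B (a i) / (\<Sum>l\<in>top_indices B k a. mode_weight A B (a l))"

end

theory Submission
  imports Defs "HOL-Real_Asymp.Real_Asymp"
begin

text \<open>
  With \<open>k\<close> the number of plus spins, the Gibbs measure gives \<open>k\<close> a weight proportional to
  \<open>binomial(n,k) exp(n f(k/n) + t B(k/n))\<close>. Let \<open>a\<close> be a \<open>q\<close>-regular maximizer, \<open>q = 2\<close> or \<open>q = 4\<close>;
  in both regimes the perturbation has size \<open>t = n\<^sup>1\<^sup>/\<^sup>q\<close>. In the variable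
  \<open>x = t (k/n - a)\<close>, Stirling's formula and Taylor expansion turn the weight into
  \<open>exp(c x\<^sup>q + b x)\<close> up to a factor \<open>1 + O((1 + \<bar>x\<bar>)\<^sup>q\<^sup>+\<^sup>1 / t)\<close> near \<open>a\<close>, where \<open>c = A\<^sup>(\<^sup>q\<^sup>)(a)/q!\<close> and
  \<open>b = B'(a)\<close>. Integrating the corresponding step function against a 1-Lipschitz test function, the error is
  pointwise at most \<open>C/(t (1 + x\<^sup>2))\<close>, so every sum over a window around \<open>a\<close> is within \<open>O(1/t)\<close> of its
  integral; the ratio of two such sums gives the Wasserstein rate. The bound
  \<open>binomial(n,k) \<le> exp(n I(k/n))\<close> and compactness make the complement of the windows exponentially small,
  and comparing the normalizations at different maximizers gives the weights of the modes. In
  \<open>R\<^sub>3\<close>, maximality forces \<open>A\<^sup>(\<^sup>3\<^sup>)(a) = 0\<close>, and then the explicit derivatives force \<open>A\<^sup>(\<^sup>4\<^sup>)(a) < 0\<close>.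
\<close>

section \<open>Stirling estimates and elementary bounds\<close>

text \<open>The scale \<open>t\<close> is dictated by the leading term. With
  \<open>u = k/n - a\<close> and \<open>x = t u\<close>, the choice \<open>t^q = n\<close> gives
  \<open>n c u^q = c x^q\<close>, keeps the perturbation \<open>t b u = b x\<close> of order one,
  and turns the next Taylor terms \<open>n u^(q+1)\<close> and \<open>t u^2\<close> into
  \<open>x^(q+1)/t\<close> and \<open>x^2/t\<close>. Since \<open>q >= 2\<close>, the grid spacing
  \<open>t/n\<close> is at most \<open>1/t\<close>. One rate thus governs all errors, and both
  regimes are a single argument.

  The obstacle is the edge of a window: there \<open>x\<close> is of order \<open>t\<close> and the
  error in the exponent is not small. The windows are therefore so narrow that this error is at most
  half of the decay \<open>|c| x^q\<close>, up to terms linear in \<open>|x|\<close>; the other half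
  still beats every polynomial. Polynomial weights are needed because Lipschitz functions grow
  linearly: a factor \<open>(1 + |x|)^3\<close> pays for the test function and leaves an integrable
  majorant. No constant depends on the test function, so the supremum in the Wasserstein distance is
  free. Finally \<open>M_n = 2k - n\<close>, hence the limit law is that of
  \<open>2x\<close>.\<close>

lemma ln_one_plus_quadratic_lower:
  fixes x :: real assumes "0 \<le> x" shows "x - x\<^sup>2 / 2 \<le> ln (1 + x)"
proof -
  have "(\<lambda>x. ln (1 + x) - (x - x\<^sup>2 / 2)) 0 \<le> (\<lambda>x. ln (1 + x) - (x - x\<^sup>2 / 2)) x"
  proof (rule DERIV_nonneg_imp_nondecreasing[OF assms])
    fix y :: real assume y: "0 \<le> y" "y \<le> x"
    have "((\<lambda>x. ln (1 + x) - (x - x\<^sup>2 / 2)) has_real_derivative 1 / (1 + y) - (1 - y)) (at y)"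
      using y by (auto intro!: derivative_eq_intros)
    moreover have "1 / (1 + y) - (1 - y) = y\<^sup>2 / (1 + y)"
      using y by (simp add: field_simps power2_eq_square)
    ultimately show "\<exists>d. ((\<lambda>x. ln (1 + x) - (x - x\<^sup>2 / 2)) has_real_derivative d) (at y) \<and> 0 \<le> d"
      using y by auto
  qed
  then show ?thesis by simp
qed

lemma ln_one_plus_cubic_upper:
  fixes x :: real assumes "0 \<le> x" shows "ln (1 + x) \<le> x - x\<^sup>2 / 2 + x ^ 3 / 3"
proof -
  have "(\<lambda>x. x - x\<^sup>2 / 2 + x ^ 3 / 3 - ln (1 + x)) 0 \<le> (\<lambda>x. x - x\<^sup>2 / 2 + x ^ 3 / 3 - ln (1 + x)) x"
  proof (rule DERIV_nonneg_imp_nondecreasing[OF assms])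
    fix y :: real assume y: "0 \<le> y" "y \<le> x"
    have "((\<lambda>x. x - x\<^sup>2 / 2 + x ^ 3 / 3 - ln (1 + x)) has_real_derivative (1 - y + y\<^sup>2) - 1 / (1 + y)) (at y)"
      using y by (auto intro!: derivative_eq_intros)
    moreover have "(1 - y + y\<^sup>2) - 1 / (1 + y) = y ^ 3 / (1 + y)"
      using y by (simp add: field_simps power2_eq_square power3_eq_cube)
    ultimately show "\<exists>d. ((\<lambda>x. x - x\<^sup>2 / 2 + x ^ 3 / 3 - ln (1 + x)) has_real_derivative d) (at y) \<and> 0 \<le> d"
      using y by auto
  qed
  then show ?thesis by simp
qed

text \<open>The logarithm of \<open>n! / (n^(n+1/2) exp(-n))\<close>, which classically tends to the
  logarithm of the square root of \<open>2 pi\<close>.\<close>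

definition stirling_seq :: "nat \<Rightarrow> real" where
  "stirling_seq n = ln (fact n) - (real n + 1 / 2) * ln (real n) + real n"

text \<open>With \<open>x = 1/n\<close> the difference is \<open>(1/x + 1/2) ln(1 + x) - 1\<close>.
  The summand \<open>1/2\<close> makes the terms linear in \<open>x\<close> cancel, so the bounds on
  the logarithm trap the difference between \<open>-x^2/4\<close> and \<open>x^2/12 + x^3/6\<close>.
  The bound has the form of a telescoping difference, so that consecutive steps simply add
  up.\<close>

lemma stirling_seq_step:
  assumes "1 \<le> n"
  shows "\<bar>stirling_seq n - stirling_seq (Suc n)\<bar> \<le> 2 / real n - 2 / real (Suc n)"
proof -
  define x where "x = 1 / real n"
  have x: "0 < x" "x \<le> 1" using assms by (auto simp: x_def)
  have nx: "real n = 1 / x" by (simp add: x_def)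
  have "ln (1 + x) = ln (real (Suc n)) - ln (real n)"
  proof -
    have "1 + x = real (Suc n) / real n" using assms by (simp add: x_def add_divide_distrib)
    then show ?thesis using assms by (simp add: ln_div del: of_nat_Suc)
  qed
  then have eq: "stirling_seq n - stirling_seq (Suc n) = (1 / x + 1 / 2) * ln (1 + x) - 1"
  proof -
    assume l: "ln (1 + x) = ln (real (Suc n)) - ln (real n)"
    have f: "ln (fact (Suc n) :: real) = ln (real (Suc n)) + ln (fact n)"
      by (simp add: ln_mult del: of_nat_Suc)
    have "(1 / x + 1 / 2) * ln (1 + x) = (real n + 1 / 2) * (ln (real (Suc n)) - ln (real n))"
      unfolding l by (simp add: x_def)
    then show ?thesis unfolding stirling_seq_def f by (simp add: algebra_simps)
  qed
  have "(1 / x + 1 / 2) * ln (1 + x) \<le> (1 / x + 1 / 2) * (x - x\<^sup>2 / 2 + x ^ 3 / 3)"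
    using x by (intro mult_left_mono ln_one_plus_cubic_upper) auto
  also have "\<dots> = 1 + x\<^sup>2 / 12 + x ^ 3 / 6"
    using x by (simp add: field_simps power2_eq_square power3_eq_cube)
  finally have "(1 / x + 1 / 2) * ln (1 + x) \<le> 1 + x\<^sup>2 / 12 + x ^ 3 / 6" .
  moreover have "x ^ 3 \<le> x\<^sup>2" using x by (intro power_decreasing) auto
  ultimately have up: "(1 / x + 1 / 2) * ln (1 + x) - 1 \<le> x\<^sup>2"
    using zero_le_power2[of x] by linarith
  have "(1 / x + 1 / 2) * (x - x\<^sup>2 / 2) \<le> (1 / x + 1 / 2) * ln (1 + x)"
    using x by (intro mult_left_mono ln_one_plus_quadratic_lower) auto
  moreover have "(1 / x + 1 / 2) * (x - x\<^sup>2 / 2) = 1 - x\<^sup>2 / 4"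
    using x by (simp add: field_simps power2_eq_square)
  ultimately have "\<bar>stirling_seq n - stirling_seq (Suc n)\<bar> \<le> x\<^sup>2"
    using up eq zero_le_power2[of x] by linarith
  also have "x\<^sup>2 \<le> 2 / real n - 2 / real (Suc n)"
  proof -
    have "2 / real n - 2 / real (Suc n) = 2 / (real n * (real n + 1))"
      using assms by (simp add: divide_simps)
    moreover have "1 / (real n * real n) \<le> 2 / (real n * (real n + 1))"
    proof -
      have "2 / (2 * (real n * real n)) \<le> 2 / (real n * (real n + 1))"
        using assms by (intro divide_left_mono mult_pos_pos) (auto simp: algebra_simps)
      then show ?thesis by simp
    qed
    ultimately show ?thesis by (simp add: x_def power2_eq_square)
  qed
  finally show ?thesis .
qed

lemma stirling_seq_diff:
  assumes "1 \<le> n" "n \<le> m"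
  shows "\<bar>stirling_seq n - stirling_seq m\<bar> \<le> 2 / real n - 2 / real m"
  using assms(2)
proof (induction m rule: dec_induct)
  case (step m)
  then show ?case using stirling_seq_step[of m] assms(1) by linarith
qed simp

definition stirling_const :: real where "stirling_const = lim stirling_seq"

text \<open>The telescoped bound makes the sequence Cauchy, so that \<open>lim\<close> is a genuine
  limit; letting \<open>m\<close> tend to infinity in the same bound gives the rate.\<close>

lemma stirling_seq_bound:
  assumes "1 \<le> n" shows "\<bar>stirling_seq n - stirling_const\<bar> \<le> 2 / real n"
proof -
  have "Cauchy stirling_seq"
  proof (rule metric_CauchyI)
    fix e :: real assume e: "0 < e"
    obtain N :: nat where N: "4 / e < real N" using reals_Archimedean2[of "4 / e"] by (rule exE)
    have "0 < 4 / e" using e by simp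
    then have N0: "0 < real N" using N by linarith
    have "dist (stirling_seq m) (stirling_seq n) < e" if "m \<ge> N" "n \<ge> N" for m n
    proof -
      have "\<bar>stirling_seq N - stirling_seq k\<bar> \<le> 2 / real N" if "k \<ge> N" for k
      proof -
        have "\<bar>stirling_seq N - stirling_seq k\<bar> \<le> 2 / real N - 2 / real k"
          using that N0 by (intro stirling_seq_diff) auto
        moreover have "0 \<le> 2 / real k" by simp
        ultimately show ?thesis by linarith
      qed
      from this[OF that(1)] this[OF that(2)]
      have "dist (stirling_seq m) (stirling_seq n) \<le> 4 / real N" by (simp add: dist_real_def)
      also have "\<dots> < e" using N N0 e by (simp add: field_simps)
      finally show ?thesis .
    qed
    then show "\<exists>M. \<forall>m\<ge>M. \<forall>n\<ge>M. dist (stirling_seq m) (stirling_seq n) < e" by blast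
  qed
  then have lim: "stirling_seq \<longlonglongrightarrow> stirling_const"
    unfolding stirling_const_def by (simp add: Cauchy_convergent_iff convergent_LIMSEQ_iff)
  have "(\<lambda>m. \<bar>stirling_seq n - stirling_seq m\<bar>) \<longlonglongrightarrow> \<bar>stirling_seq n - stirling_const\<bar>"
    by (intro tendsto_intros lim)
  then show ?thesis
  proof (rule tendsto_upperbound)
    show "\<forall>\<^sub>F m in sequentially. \<bar>stirling_seq n - stirling_seq m\<bar> \<le> 2 / real n"
      using eventually_ge_at_top[of n]
    proof eventually_elim
      case (elim m)
      have "0 \<le> 2 / real m" by simp
      then show ?case using stirling_seq_diff[OF assms elim] by linarith
    qed
  qed simp
qed

text \<open>Keeping \<open>y\<close> away from \<open>0\<close> and \<open>1\<close> makes both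
  \<open>k\<close> and \<open>n - k\<close> at least \<open>\<epsilon> n\<close>, so all three
  factorials have Stirling errors of order \<open>1/n\<close>. The limit constant enters once with a
  plus sign and twice with a minus sign, which leaves the single
  \<open>stirling_const\<close>.\<close>

lemma ln_binomial_stirling:
  assumes k: "0 < k" "k < n" and y: "y = real k / real n" and e: "0 < \<epsilon>" "\<epsilon> \<le> y" "y \<le> 1 - \<epsilon>"
  shows "\<bar>ln (real (n choose k)) - real n * binary_entropy y + ln (real n * y * (1 - y)) / 2
           + stirling_const\<bar> \<le> (2 + 4 / \<epsilon>) / real n"
proof -
  define l where "l = n - k"
  have l: "0 < l" "real l = real n - real k" "k + l = n" using k by (auto simp: l_def)
  have n0: "0 < real n" using k by simp
  have yk: "real k = real n * y" and yl: "real l = real n * (1 - y)"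
    using l n0 by (auto simp: y field_simps)
  have y01: "0 < y" "0 < 1 - y" using e by auto
  have lnk: "ln (real k) = ln (real n) + ln y" and lnl: "ln (real l) = ln (real n) + ln (1 - y)"
    unfolding yk yl using n0 y01 by (simp_all add: ln_mult)
  have "ln (real (n choose k)) = ln (fact n) - ln (fact k) - ln (fact l)"
    using k by (subst binomial_fact) (auto simp: ln_div ln_mult l_def)
  also have "\<dots> = stirling_seq n - stirling_seq k - stirling_seq l
      + (real n + 1 / 2) * ln (real n) - (real k + 1 / 2) * ln (real k) - (real l + 1 / 2) * ln (real l)"
    unfolding stirling_seq_def using l by simp
  also have "\<dots> = stirling_seq n - stirling_seq k - stirling_seq l + real n * binary_entropy y
      - ln (real n * y * (1 - y)) / 2"
  proof -
    have "ln (real n * y * (1 - y)) = ln (real n) + ln y + ln (1 - y)"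
      using n0 y01 by (simp add: ln_mult)
    then show ?thesis
      unfolding lnk lnl binary_entropy_def unfolding yk yl by (simp add: algebra_simps)
  qed
  finally have "ln (real (n choose k)) - real n * binary_entropy y + ln (real n * y * (1 - y)) / 2
      + stirling_const = (stirling_seq n - stirling_const) - (stirling_seq k - stirling_const)
      - (stirling_seq l - stirling_const)" by simp
  moreover have "\<bar>stirling_seq n - stirling_const\<bar> \<le> 2 / real n" using k by (intro stirling_seq_bound) auto
  moreover have "\<bar>stirling_seq k - stirling_const\<bar> \<le> (2 / \<epsilon>) / real n"
  proof -
    have "\<bar>stirling_seq k - stirling_const\<bar> \<le> 2 / real k" using k by (intro stirling_seq_bound) auto
    also have "\<dots> \<le> 2 / (real n * \<epsilon>)" unfolding yk using e n0 y01 by (intro divide_left_mono mult_mono mult_pos_pos) auto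
    finally show ?thesis by (simp add: field_simps)
  qed
  moreover have "\<bar>stirling_seq l - stirling_const\<bar> \<le> (2 / \<epsilon>) / real n"
  proof -
    have "\<bar>stirling_seq l - stirling_const\<bar> \<le> 2 / real l" using l by (intro stirling_seq_bound) auto
    also have "\<dots> \<le> 2 / (real n * \<epsilon>)" unfolding yl using e n0 y01 by (intro divide_left_mono mult_mono mult_pos_pos) auto
    finally show ?thesis by (simp add: field_simps)
  qed
  moreover have "(2 + 4 / \<epsilon>) / real n = 2 / real n + (2 / \<epsilon>) / real n + (2 / \<epsilon>) / real n"
    by (simp add: add_divide_distrib)
  moreover have "\<bar>a - b - c\<bar> \<le> A + B + C" if "\<bar>a\<bar> \<le> A" "\<bar>b\<bar> \<le> B" "\<bar>c\<bar> \<le> C" for a b c A B C :: real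
    using that by linarith
  ultimately show ?thesis by presburger
qed

text \<open>One term of the binomial expansion of \<open>(y + (1 - y))^n = 1\<close> is at most 1.
  In contrast to the Stirling estimate this reaches the endpoints, where \<open>ln 0 = 0\<close>
  gives entropy zero, and it is what the global tail bound rests on.\<close>

lemma binomial_le_exp_entropy:
  assumes "k \<le> n" "0 < n"
  shows "real (n choose k) \<le> exp (real n * binary_entropy (real k / real n))"
proof (cases "k = 0 \<or> k = n")
  case True
  then show ?thesis using assms by (auto simp: binary_entropy_def)
next
  case False
  define y where "y = real k / real n"
  have y: "0 < y" "y < 1" using False assms by (auto simp: y_def)
  have nk: "real (n - k) = real n * (1 - y)" "real k = real n * y"
    using assms by (auto simp: y_def of_nat_diff field_simps)
  have "real (n choose k) * y ^ k * (1 - y) ^ (n - k) \<le> (\<Sum>j\<le>n. real (n choose j) * y ^ j * (1 - y) ^ (n - j))"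
    using assms y by (intro member_le_sum) auto
  also have "\<dots> = (y + (1 - y)) ^ n" by (subst binomial_ring) simp
  finally have le: "real (n choose k) * (y ^ k * (1 - y) ^ (n - k)) \<le> 1" by (simp add: mult.assoc)
  have "y ^ k * (1 - y) ^ (n - k) = exp (real k * ln y) * exp (real (n - k) * ln (1 - y))"
    using y by (simp add: exp_of_nat_mult)
  also have "\<dots> = exp (- (real n * binary_entropy y))"
    unfolding nk by (simp add: binary_entropy_def exp_add[symmetric] algebra_simps)
  finally have "real (n choose k) * exp (- (real n * binary_entropy y)) \<le> 1" using le by simp
  then have "real (n choose k) * exp (- (real n * binary_entropy y)) * exp (real n * binary_entropy y)
      \<le> 1 * exp (real n * binary_entropy y)" by (intro mult_right_mono) auto
  moreover have "exp (- (real n * binary_entropy y)) * exp (real n * binary_entropy y) = 1"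
    by (simp add: exp_add[symmetric])
  ultimately show ?thesis unfolding y_def[symmetric] by (simp add: mult.assoc)
qed

text \<open>The derivatives are passed as an explicit family, so no iterated \<open>deriv\<close>
  appears. The constant is the maximum of the last derivative on the compact interval, divided by
  \<open>fact N\<close>.\<close>

lemma taylor_remainder_bound:
  fixes D :: "nat \<Rightarrow> real \<Rightarrow> real"
  assumes "0 < N" "0 < \<delta>"
    and der: "\<And>m x. m < N \<Longrightarrow> \<bar>x - a\<bar> \<le> \<delta> \<Longrightarrow> (D m has_real_derivative D (Suc m) x) (at x)"
    and cont: "continuous_on {a - \<delta>..a + \<delta>} (D N)"
  shows "\<exists>K\<ge>0. \<forall>u. \<bar>u\<bar> \<le> \<delta> \<longrightarrow> \<bar>D 0 (a + u) - (\<Sum>m<N. D m a / fact m * u ^ m)\<bar> \<le> K * \<bar>u\<bar> ^ N"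
proof -
  have "bounded (D N ` {a - \<delta>..a + \<delta>})"
    by (intro compact_imp_bounded compact_continuous_image cont) auto
  then obtain C where C: "\<And>x. x \<in> {a - \<delta>..a + \<delta>} \<Longrightarrow> \<bar>D N x\<bar> \<le> C"
    unfolding bounded_iff real_norm_def by blast
  have C0: "0 \<le> C" using C[of a] assms(2) by auto
  show ?thesis
  proof (intro exI[of _ "C / fact N"] conjI allI impI)
    fix u :: real assume u: "\<bar>u\<bar> \<le> \<delta>"
    show "\<bar>D 0 (a + u) - (\<Sum>m<N. D m a / fact m * u ^ m)\<bar> \<le> C / fact N * \<bar>u\<bar> ^ N"
    \<comment> \<open>Taylor's theorem in the form used excludes the expansion point itself.\<close>
    proof (cases "u = 0")
      case True
      have "(\<Sum>m<N. D m a / fact m * 0 ^ m) = (\<Sum>m\<in>{0}. D m a / fact m * 0 ^ m)"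
        using assms(1) by (intro sum.mono_neutral_right) auto
      then show ?thesis using True C0 by simp
    next
      case False
      have "\<exists>t. (if a + u < a then a + u < t \<and> t < a else a < t \<and> t < a + u) \<and>
          D 0 (a + u) = (\<Sum>m<N. (D m a / fact m) * (a + u - a)^m) + (D N t / fact N) * (a + u - a)^N"
      proof (rule Taylor[of N D "D 0" "a - \<delta>" "a + \<delta>"])
        show "\<forall>m t. m < N \<and> a - \<delta> \<le> t \<and> t \<le> a + \<delta> \<longrightarrow> (D m has_real_derivative D (Suc m) t) (at t)"
          using der by (auto simp: abs_le_iff)
      qed (use assms u False in auto)
      then obtain t where t: "if u < 0 then a + u < t \<and> t < a else a < t \<and> t < a + u"
        and eq: "D 0 (a + u) = (\<Sum>m<N. (D m a / fact m) * u^m) + (D N t / fact N) * u^N" by auto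
      have "\<bar>D N t\<bar> \<le> C" using t u by (intro C) (auto split: if_splits)
      then have "\<bar>D N t\<bar> / fact N * \<bar>u\<bar> ^ N \<le> C / fact N * \<bar>u\<bar> ^ N"
        by (intro mult_right_mono divide_right_mono) auto
      then show ?thesis unfolding eq by (simp add: abs_mult power_abs)
    qed
  qed (use C0 in auto)
qed

section \<open>Exponentials against polynomial factors\<close>

lemma abs_exp_minus_one_le: "\<bar>exp e - 1\<bar> \<le> \<bar>e\<bar> * exp \<bar>e\<bar>" for e :: real
proof (cases "0 \<le> e")
  case True
  have "(1 - e) * exp e \<le> exp (- e) * exp e" using exp_ge_add_one_self[of "- e"] by (intro mult_right_mono) auto
  then have "exp e - 1 \<le> e * exp e" by (simp add: exp_minus algebra_simps)
  then show ?thesis using True by simp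
next
  case False
  then have "exp e \<le> 1" by simp
  then have "\<bar>exp e - 1\<bar> \<le> \<bar>e\<bar> * 1" using exp_ge_add_one_self[of e] False by linarith
  also have "\<dots> \<le> \<bar>e\<bar> * exp \<bar>e\<bar>" by (intro mult_left_mono) auto
  finally show ?thesis .
qed

text \<open>This trades an even power for a square, so that completing one square covers
  \<open>q = 2\<close> and \<open>q = 4\<close> alike; the \<open>-1\<close> accounts for
  \<open>|x| < 1\<close>.\<close>

lemma even_power_ge_square:
  fixes x :: real assumes "even q" "2 \<le> q" shows "x\<^sup>2 - 1 \<le> x ^ q"
proof -
  have q: "x ^ q = \<bar>x\<bar> ^ q" using assms by (simp add: power_even_abs)
  show ?thesis
  proof (cases "1 \<le> \<bar>x\<bar>")
    case True
    then have "\<bar>x\<bar> ^ 2 \<le> \<bar>x\<bar> ^ q" by (intro power_increasing assms)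
    then show ?thesis unfolding q by simp
  next
    case False
    then have "\<bar>x\<bar> ^ 2 \<le> 1" by (intro power_le_one) auto
    moreover have "0 \<le> x ^ q" using q by simp
    ultimately show ?thesis by simp
  qed
qed

text \<open>One term of the exponential series bounds \<open>(1 + |x|)^N\<close> by
  \<open>fact N * exp (1 + |x|)\<close>. The exponent is then at most a quadratic in
  \<open>|x|\<close> with negative leading coefficient \<open>c\<close>, hence bounded.\<close>

lemma poly_times_exp_bounded:
  fixes c b :: real
  assumes "c < 0" "even q" "2 \<le> q"
  shows "\<exists>C>0. \<forall>x. (1 + \<bar>x\<bar>) ^ N * exp (c * x ^ q + b * \<bar>x\<bar>) \<le> C"
proof -
  define s where "s = \<bar>b\<bar> + 1"
  \<comment> \<open>The \<open>1\<close> comes from \<open>exp (1 + |x|)\<close>, the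
    \<open>-c\<close> from replacing \<open>x^q\<close> by \<open>x^2 - 1\<close>, and the last
    summand is the maximum of \<open>s r + c r^2\<close> over \<open>r\<close>. The
    \<open>|x|\<close> from the polynomial is the reason for the \<open>+ 1\<close> in
    \<open>s\<close>.\<close>
  define C where "C = fact N * exp (1 - c + s\<^sup>2 / (- 4 * c))"
  show ?thesis
  proof (intro exI[of _ C] conjI allI)
    fix x :: real
    have "(1 + \<bar>x\<bar>) ^ N / fact N \<le> exp (1 + \<bar>x\<bar>)"
    proof -
      have "(1 + \<bar>x\<bar>) ^ N / fact N \<le> (\<Sum>n\<le>N. (1 + \<bar>x\<bar>) ^ n / fact n)"
        by (intro member_le_sum) auto
      also have "\<dots> \<le> (\<Sum>n. (1 + \<bar>x\<bar>) ^ n / fact n)"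
        using summable_exp[of "1 + \<bar>x\<bar>"] by (intro sum_le_suminf) (auto simp: field_simps)
      also have "\<dots> = exp (1 + \<bar>x\<bar>)" by (simp add: exp_def scaleR_conv_of_real field_simps)
      finally show ?thesis .
    qed
    then have "(1 + \<bar>x\<bar>) ^ N \<le> fact N * exp (1 + \<bar>x\<bar>)" by (simp add: field_simps)
    then have "(1 + \<bar>x\<bar>) ^ N * exp (c * x ^ q + b * \<bar>x\<bar>) \<le> (fact N * exp (1 + \<bar>x\<bar>)) * exp (c * x ^ q + b * \<bar>x\<bar>)"
      by (intro mult_right_mono) auto
    also have "\<dots> = fact N * exp (1 + \<bar>x\<bar> + c * x ^ q + b * \<bar>x\<bar>)"
      by (simp only: mult.assoc exp_add[symmetric] add.assoc)
    also have "\<dots> \<le> C"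
    proof -
      have "1 + \<bar>x\<bar> + c * x ^ q + b * \<bar>x\<bar> \<le> 1 - c + s\<^sup>2 / (- 4 * c)"
      proof -
        have "c * x ^ q \<le> c * (x\<^sup>2 - 1)" using even_power_ge_square[OF assms(2,3), of x] assms(1) by simp
        moreover have "b * \<bar>x\<bar> \<le> \<bar>b\<bar> * \<bar>x\<bar>" by (intro mult_right_mono) auto
        moreover have "s * \<bar>x\<bar> + c * x\<^sup>2 \<le> s\<^sup>2 / (- 4 * c)"
        proof -
          have "0 \<le> (s + 2 * c * \<bar>x\<bar>)\<^sup>2" by simp
          then have "(s * \<bar>x\<bar> + c * x\<^sup>2) * (- 4 * c) \<le> s\<^sup>2"
            by (simp add: power2_eq_square algebra_simps)
          then show ?thesis using assms(1) by (subst pos_le_divide_eq) auto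
        qed
        ultimately show ?thesis unfolding s_def by (simp add: algebra_simps)
      qed
      then show ?thesis unfolding C_def by (intro mult_left_mono) auto
    qed
    finally show "(1 + \<bar>x\<bar>) ^ N * exp (c * x ^ q + b * \<bar>x\<bar>) \<le> C" .
  qed (simp add: C_def)
qed

lemma integrable_inverse_one_plus_square: "integrable lborel (\<lambda>x::real. 1 / (1 + x\<^sup>2))"
  using integrable_inverse_1_plus_square by (simp add: set_integrable_def inverse_eq_divide)

lemma lborel_inverse_one_plus_square: "(LBINT x. 1 / (1 + x\<^sup>2)) = pi"
  using LBINT_inverse_1_plus_square
  by (simp add: interval_lebesgue_integral_def set_lebesgue_integral_def inverse_eq_divide)

section \<open>The local Laplace method\<close>

text \<open>The limit density, not normalised, in the variable \<open>x = t (k/n - a)\<close>, which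
  is half of the rescaled magnetization.\<close>

definition tilt :: "nat \<Rightarrow> real \<Rightarrow> real \<Rightarrow> real \<Rightarrow> real" where
  "tilt q c b x = exp (c * x ^ q + b * x)"

text \<open>Test functions of the Wasserstein distance after a normalisation at \<open>0\<close>.
  The growth bound is \<open>1 + |x|\<close> and not \<open>|x|\<close> so that the constant
  \<open>1\<close> belongs to the class: numerators and normalizing sums then obey the same
  estimate.\<close>

definition test_fun :: "(real \<Rightarrow> real) \<Rightarrow> bool" where
  "test_fun \<phi> \<longleftrightarrow> 1-lipschitz_on UNIV \<phi> \<and> (\<forall>x. \<bar>\<phi> x\<bar> \<le> 1 + \<bar>x\<bar>)"

definition bweight :: "(real \<Rightarrow> real) \<Rightarrow> (real \<Rightarrow> real) \<Rightarrow> real \<Rightarrow> nat \<Rightarrow> nat \<Rightarrow> real" where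
  "bweight f B s n k = real (n choose k) * exp (real n * f (real k / real n) + s * B (real k / real n))"

definition window :: "real \<Rightarrow> real \<Rightarrow> nat \<Rightarrow> nat set" where
  "window a \<delta> n = {k\<in>{..n}. \<bar>real k / real n - a\<bar> \<le> \<delta>}"

definition laplace_scale :: "(real \<Rightarrow> real) \<Rightarrow> (real \<Rightarrow> real) \<Rightarrow> real \<Rightarrow> real \<Rightarrow> nat \<Rightarrow> real" where
  "laplace_scale f B a s n =
     exp (real n * (f a + binary_entropy a) + s * B a - stirling_const) / sqrt (real n * a * (1 - a))"

text \<open>\<open>laplace_scale\<close> is the Stirling approximation of \<open>bweight\<close> at \<open>k = n a\<close>; the constant
  \<open>stirling_const\<close> need not be evaluated, since only ratios of weights matter.\<close>

definition rescaled_sum ::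
  "(real \<Rightarrow> real) \<Rightarrow> (real \<Rightarrow> real) \<Rightarrow> real \<Rightarrow> real \<Rightarrow> nat \<Rightarrow> nat set \<Rightarrow> (real \<Rightarrow> real) \<Rightarrow> real" where
  "rescaled_sum f B a t n S \<phi> =
     t / (real n * laplace_scale f B a t n) * (\<Sum>k\<in>S. \<phi> (t * (real k / real n - a)) * bweight f B t n k)"

text \<open>The constant is chosen before \<open>n\<close> and \<open>\<phi>\<close>; this
  uniformity is what allows the supremum over test functions to be taken at the end.\<close>

definition laplace_at ::
  "nat \<Rightarrow> (real \<Rightarrow> real) \<Rightarrow> (real \<Rightarrow> real) \<Rightarrow> real \<Rightarrow> real \<Rightarrow> real \<Rightarrow> real \<Rightarrow> bool" where
  "laplace_at q f B a c b \<delta> \<longleftrightarrow> (\<exists>C>0. \<forall>n>0. \<forall>\<phi>. test_fun \<phi> \<longrightarrow>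
     \<bar>rescaled_sum f B a (real n powr (1 / real q)) n (window a \<delta> n) \<phi> - (LBINT x. \<phi> x * tilt q c b x)\<bar>
       \<le> C / real n powr (1 / real q))"

section \<open>Decay and regularity of the tilted density\<close>

lemma root_rate:
  assumes "0 < n" "0 < q"
  shows "1 \<le> real n powr (1 / real q)" "real n = (real n powr (1 / real q)) ^ q"
  using assms by (auto simp: ge_one_powr_ge_zero powr_realpow[symmetric] powr_powr)

lemma tilt_pos: "0 < tilt q c b x" by (simp add: tilt_def)

lemma test_funD: assumes "test_fun \<phi>" shows "\<bar>\<phi> x - \<phi> y\<bar> \<le> \<bar>x - y\<bar>" "\<bar>\<phi> x\<bar> \<le> 1 + \<bar>x\<bar>"
  using assms lipschitz_onD[of 1 UNIV \<phi> x y] by (auto simp: test_fun_def dist_real_def)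

lemma test_fun_measurable: assumes "test_fun \<phi>" shows "\<phi> \<in> borel_measurable borel"
  using assms by (auto simp: test_fun_def intro!: borel_measurable_continuous_onI lipschitz_on_continuous_on)

lemma tilt_decay:
  assumes "c < 0" "even q" "2 \<le> q"
  shows "\<exists>C>0. \<forall>x. (1 + \<bar>x\<bar>) ^ N * tilt q c b x \<le> C"
proof -
  obtain C where C: "0 < C" "\<And>x. (1 + \<bar>x\<bar>) ^ N * exp (c * x ^ q + \<bar>b\<bar> * \<bar>x\<bar>) \<le> C"
    using poly_times_exp_bounded[OF assms, of N "\<bar>b\<bar>"] by blast
  have "(1 + \<bar>x\<bar>) ^ N * tilt q c b x \<le> C" for x
  proof -
    have "b * x \<le> \<bar>b\<bar> * \<bar>x\<bar>" by (metis abs_ge_self abs_mult)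
    then have "(1 + \<bar>x\<bar>) ^ N * tilt q c b x \<le> (1 + \<bar>x\<bar>) ^ N * exp (c * x ^ q + \<bar>b\<bar> * \<bar>x\<bar>)"
      unfolding tilt_def by (intro mult_left_mono) auto
    also have "\<dots> \<le> C" by (rule C)
    finally show ?thesis .
  qed
  then show ?thesis using C by blast
qed

text \<open>By the mean value theorem the difference is \<open>|x - y|\<close> times a polynomial of
  degree \<open>q - 1\<close> times the tilt at a point \<open>z\<close> between. Decay of order
  \<open>q + 3\<close> pays \<open>q\<close> for the polynomial and \<open>3\<close> for the weight;
  moving the weight from \<open>y\<close> to \<open>z\<close> costs \<open>2^3 = 8\<close>. Of the
  cubed weight, one power will absorb a test function and two will produce
  \<open>1 / (1 + y^2)\<close>.\<close>

lemma tilt_lipschitz_decay: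
  assumes "c < 0" "even q" "2 \<le> q"
  shows "\<exists>C>0. \<forall>x y. \<bar>x - y\<bar> \<le> 1 \<longrightarrow> (1 + \<bar>y\<bar>) ^ 3 * \<bar>tilt q c b x - tilt q c b y\<bar> \<le> C * \<bar>x - y\<bar>"
proof -
  obtain C0 where C0: "0 < C0" "\<And>x. (1 + \<bar>x\<bar>) ^ (q + 3) * tilt q c b x \<le> C0"
    using tilt_decay[OF assms, of "q + 3" b] by blast
  define M where "M = \<bar>c\<bar> * real q + \<bar>b\<bar> + 1"
  have M: "0 < M" by (simp add: M_def add_nonneg_pos)
  have main: "(1 + \<bar>y\<bar>) ^ 3 * \<bar>tilt q c b x - tilt q c b y\<bar> \<le> 8 * M * C0 * \<bar>x - y\<bar>"
    if xy: "\<bar>x - y\<bar> \<le> 1" "x < y \<or> y < x" for x y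
  proof -
    have der: "(tilt q c b has_real_derivative (c * (real q * z ^ (q - 1)) + b) * tilt q c b z) (at z)" for z
      unfolding tilt_def by (auto intro!: derivative_eq_intros)
    have "\<exists>z. \<bar>z - y\<bar> \<le> 1 \<and> \<bar>tilt q c b x - tilt q c b y\<bar>
        = \<bar>x - y\<bar> * \<bar>(c * (real q * z ^ (q - 1)) + b) * tilt q c b z\<bar>"
      using xy(2)
    proof
      assume "x < y"
      from MVT2[OF this, of "tilt q c b" "\<lambda>z. (c * (real q * z ^ (q - 1)) + b) * tilt q c b z"] der
      obtain z where "x < z" "z < y" "tilt q c b y - tilt q c b x = (y - x) * ((c * (real q * z ^ (q - 1)) + b) * tilt q c b z)"
        by blast
      then show ?thesis using xy(1)
        by (intro exI[of _ z]) (auto simp: abs_mult abs_minus_commute[of "tilt q c b x"] abs_minus_commute[of x])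
    next
      assume "y < x"
      from MVT2[OF this, of "tilt q c b" "\<lambda>z. (c * (real q * z ^ (q - 1)) + b) * tilt q c b z"] der
      obtain z where "y < z" "z < x" "tilt q c b x - tilt q c b y = (x - y) * ((c * (real q * z ^ (q - 1)) + b) * tilt q c b z)"
        by blast
      then show ?thesis using xy(1) by (intro exI[of _ z]) (auto simp: abs_mult)
    qed
    then obtain z where z: "\<bar>z - y\<bar> \<le> 1" "\<bar>tilt q c b x - tilt q c b y\<bar>
        = \<bar>x - y\<bar> * \<bar>(c * (real q * z ^ (q - 1)) + b) * tilt q c b z\<bar>" by blast
    have p1: "\<bar>z\<bar> ^ (q - 1) \<le> (1 + \<bar>z\<bar>) ^ q"
    proof -
      have "\<bar>z\<bar> ^ (q - 1) \<le> (1 + \<bar>z\<bar>) ^ (q - 1)" by (intro power_mono) auto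
      also have "\<dots> \<le> (1 + \<bar>z\<bar>) ^ q" by (intro power_increasing) auto
      finally show ?thesis .
    qed
    have p2: "1 \<le> (1 + \<bar>z\<bar>) ^ q" by simp
    have "\<bar>c * (real q * z ^ (q - 1)) + b\<bar> \<le> \<bar>c\<bar> * real q * \<bar>z\<bar> ^ (q - 1) + \<bar>b\<bar> * 1"
      by (rule order_trans[OF abs_triangle_ineq]) (simp add: abs_mult power_abs)
    also have "\<dots> \<le> \<bar>c\<bar> * real q * (1 + \<bar>z\<bar>) ^ q + \<bar>b\<bar> * (1 + \<bar>z\<bar>) ^ q"
      using p1 p2 by (intro add_mono mult_left_mono) auto
    also have "\<dots> \<le> M * (1 + \<bar>z\<bar>) ^ q" unfolding M_def distrib_right by simp
    finally have b1: "\<bar>c * (real q * z ^ (q - 1)) + b\<bar> \<le> M * (1 + \<bar>z\<bar>) ^ q" .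
    have "(1 + \<bar>y\<bar>) ^ 3 \<le> (2 * (1 + \<bar>z\<bar>)) ^ 3" using z(1) by (intro power_mono) auto
    then have b2: "(1 + \<bar>y\<bar>) ^ 3 \<le> 8 * (1 + \<bar>z\<bar>) ^ 3" unfolding power_mult_distrib by simp
    have "(1 + \<bar>y\<bar>) ^ 3 * \<bar>(c * (real q * z ^ (q - 1)) + b) * tilt q c b z\<bar>
        = (1 + \<bar>y\<bar>) ^ 3 * (\<bar>c * (real q * z ^ (q - 1)) + b\<bar> * tilt q c b z)"
      using tilt_pos[of q c b z] by (simp add: abs_mult)
    also have "\<dots> \<le> (8 * (1 + \<bar>z\<bar>) ^ 3) * ((M * (1 + \<bar>z\<bar>) ^ q) * tilt q c b z)"
      using b1 b2 tilt_pos[of q c b z] M by (intro mult_mono) (auto intro: less_imp_le)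
    also have "\<dots> = 8 * M * ((1 + \<bar>z\<bar>) ^ (q + 3) * tilt q c b z)" by (simp only: power_add mult_ac)
    also have "\<dots> \<le> 8 * M * C0" using M C0 by (intro mult_left_mono) auto
    finally have "(1 + \<bar>y\<bar>) ^ 3 * \<bar>(c * (real q * z ^ (q - 1)) + b) * tilt q c b z\<bar> \<le> 8 * M * C0" .
    then have "\<bar>x - y\<bar> * ((1 + \<bar>y\<bar>) ^ 3 * \<bar>(c * (real q * z ^ (q - 1)) + b) * tilt q c b z\<bar>)
        \<le> \<bar>x - y\<bar> * (8 * M * C0)" by (intro mult_left_mono) auto
    then show ?thesis unfolding z(2) by (simp only: mult_ac)
  qed
  show ?thesis
  proof (intro exI[of _ "8 * M * C0"] conjI allI impI)
    fix x y :: real assume "\<bar>x - y\<bar> \<le> 1"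
    then show "(1 + \<bar>y\<bar>) ^ 3 * \<bar>tilt q c b x - tilt q c b y\<bar> \<le> 8 * M * C0 * \<bar>x - y\<bar>"
      using main[of x y] by (cases x y rule: linorder_cases) auto
  qed (use M C0 in auto)
qed

lemma one_plus_square_le: "1 + x\<^sup>2 \<le> (1 + \<bar>x\<bar>)\<^sup>2" for x :: real
  by (simp add: power2_eq_square algebra_simps)

lemma integrable_test_fun_tilt:
  assumes "c < 0" "even q" "2 \<le> q" "test_fun \<phi>"
  shows "integrable lborel (\<lambda>x. \<phi> x * tilt q c b x)"
proof -
  obtain C where C: "0 < C" "\<And>x. (1 + \<bar>x\<bar>) ^ 3 * tilt q c b x \<le> C"
    using tilt_decay[OF assms(1-3), of 3 b] by blast
  show ?thesis
  proof (rule Bochner_Integration.integrable_bound)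
    show "integrable lborel (\<lambda>x. C * (1 / (1 + x\<^sup>2)))"
      by (intro integrable_mult_right integrable_inverse_one_plus_square)
    show "(\<lambda>x. \<phi> x * tilt q c b x) \<in> borel_measurable lborel"
      using test_fun_measurable[OF assms(4)] unfolding tilt_def by measurable
    show "AE x in lborel. norm (\<phi> x * tilt q c b x) \<le> norm (C * (1 / (1 + x\<^sup>2)))"
    proof (rule AE_I2)
      fix x :: real
      have "\<bar>\<phi> x\<bar> * tilt q c b x \<le> (1 + \<bar>x\<bar>) * tilt q c b x"
        using test_funD(2)[OF assms(4), of x] tilt_pos[of q c b x] by (intro mult_right_mono) auto
      then have "\<bar>\<phi> x\<bar> * tilt q c b x * (1 + x\<^sup>2) \<le> ((1 + \<bar>x\<bar>) * tilt q c b x) * (1 + \<bar>x\<bar>)\<^sup>2"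
        using one_plus_square_le[of x] tilt_pos[of q c b x] by (intro mult_mono) auto
      also have "\<dots> = (1 + \<bar>x\<bar>) ^ 3 * tilt q c b x" by (simp add: power2_eq_square power3_eq_cube)
      also have "\<dots> \<le> C" by (rule C)
      finally have "\<bar>\<phi> x\<bar> * tilt q c b x \<le> C * (1 / (1 + x\<^sup>2))"
        by (simp add: pos_le_divide_eq add_pos_nonneg)
      then show "norm (\<phi> x * tilt q c b x) \<le> norm (C * (1 / (1 + x\<^sup>2)))"
        using tilt_pos[of q c b x] C(1) by (simp add: abs_mult)
    qed
  qed
qed

text \<open>The sum is the integral of a step function, and the majorant \<open>D / (1 + y\<^sup>2)\<close> of the pointwise
  error has integral \<open>D \<pi>\<close>.\<close>

lemma riemann_sum_bound:
  fixes F :: "real \<Rightarrow> real" and G :: "nat \<Rightarrow> real"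
  assumes n: "0 < n" and t: "0 < t" and d: "0 \<le> a - \<delta>" "a + \<delta> \<le> 1"
    and F: "integrable lborel F"
    and close: "\<And>k y. k \<in> window a \<delta> n \<Longrightarrow> t * (real k / real n - a) \<le> y \<Longrightarrow>
        y < t * (real k / real n - a) + t / real n \<Longrightarrow> \<bar>G k - F y\<bar> \<le> D / (1 + y\<^sup>2)"
    and far: "\<And>y. \<delta> * t - t / real n < \<bar>y\<bar> \<Longrightarrow> \<bar>F y\<bar> \<le> D / (1 + y\<^sup>2)"
  shows "\<bar>t / real n * (\<Sum>k\<in>window a \<delta> n. G k) - (LBINT y. F y)\<bar> \<le> D * pi"
proof -
  define x where "x k = t * (real k / real n - a)" for k
  define K where "K = window a \<delta> n"
  define J where "J k = {x k..<x k + t / real n}" for k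
  define \<psi> where "\<psi> y = (\<Sum>k\<in>K. G k * indicator (J k) y)" for y
  have finK: "finite K" by (simp add: K_def window_def)
  have tn: "0 < t / real n" using n t by simp
  have intJ: "integrable lborel (\<lambda>y. G k * indicator (J k) y)" for k
    unfolding J_def using tn by (intro integrable_mult_right) (auto intro!: integrable_real_indicator)
  have mJ: "(LBINT y. G k * indicator (J k) y) = G k * (t / real n)" for k
    unfolding J_def using tn by simp
  have int\<psi>: "integrable lborel \<psi>" unfolding \<psi>_def by (intro Bochner_Integration.integrable_sum intJ)
  have I\<psi>: "(LBINT y. \<psi> y) = t / real n * (\<Sum>k\<in>K. G k)"
    unfolding \<psi>_def using intJ mJ by (subst Bochner_Integration.integral_sum) (auto simp: sum_distrib_left sum_divide_distrib mult.commute)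
  \<comment> \<open>The cells are half-open and as long as the spacing of their left endpoints, so
    at most one of them contains \<open>y\<close> and the step function takes a single value
    there.\<close>
  have same: "j = k" if "y \<in> J j" "y \<in> J k" for j k y
  proof -
    have "x j < x k + t / real n" "x k < x j + t / real n" using that unfolding J_def by auto
    then have "t * (real j - real k) < t * 1" "t * (real k - real j) < t * 1"
      using n unfolding x_def by (auto simp: field_simps)
    then have "real j - real k < 1" "real k - real j < 1"
      using t by (auto simp only: mult_less_cancel_left_pos)
    then show ?thesis by linarith
  qed
  have pw: "\<bar>\<psi> y - F y\<bar> \<le> D / (1 + y\<^sup>2)" for y
  proof (cases "\<exists>k\<in>K. y \<in> J k")
    case True
    then obtain k where k: "k \<in> K" "y \<in> J k" by blast
    have "\<psi> y = (\<Sum>j\<in>{k}. G j * indicator (J j) y)"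
      unfolding \<psi>_def using k same finK by (intro sum.mono_neutral_right) (auto simp: indicator_def)
    then have "\<psi> y = G k" using k by simp
    then show ?thesis using close[of k y] k unfolding K_def J_def x_def by auto
  next
    case False
    then have "\<psi> y = 0" unfolding \<psi>_def by (intro sum.neutral) (auto simp: indicator_def)
    moreover have "\<delta> * t - t / real n < \<bar>y\<bar>"
    proof (rule ccontr)
      assume "\<not> ?thesis"
      then have y: "\<bar>y\<bar> \<le> \<delta> * t - t / real n" by simp
      \<comment> \<open>The index of the grid point just left of \<open>y\<close>. Because
        \<open>y\<close> keeps a distance of one cell \<open>t/n\<close> from the edge, this grid
        point still lies in the window, and \<open>a - \<delta> \<ge> 0\<close>,
        \<open>a + \<delta> \<le> 1\<close> make \<open>m\<close> an admissible number of plus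
        spins.\<close>
      define m where "m = \<lfloor>real n * (y / t + a)\<rfloor>"
      have m: "real_of_int m \<le> real n * (y / t + a)" "real n * (y / t + a) < real_of_int m + 1"
        unfolding m_def by linarith+
      define u where "u = real_of_int m / real n - a"
      have nu: "real_of_int m = real n * (u + a)" using n by (simp add: u_def)
      have u1: "t * u \<le> y" "y < t * u + t / real n"
      proof -
        have "u + a \<le> y / t + a" using m(1) n unfolding nu by simp
        then show "t * u \<le> y" using t by (simp add: field_simps)
        have "real n * (y / t + a) < real n * (u + a + 1 / real n)" using m(2) n unfolding nu
          by (simp add: algebra_simps)
        then have "y / t + a < u + a + 1 / real n" using n by simp
        then have "y / t < u + 1 / real n" by simp
        then show "y < t * u + t / real n" using t by (simp add: field_simps)
      qed
      have "\<bar>t * u\<bar> \<le> \<delta> * t" using u1 y tn by linarith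
      then have "t * \<bar>u\<bar> \<le> t * \<delta>" using t by (simp add: abs_mult mult.commute)
      then have u2: "\<bar>u\<bar> \<le> \<delta>" using t by simp
      then have "0 \<le> u + a" "u + a \<le> 1" using d by linarith+
      then have "0 \<le> real n * (u + a)" "real n * (u + a) \<le> real n" using n by (auto intro: mult_left_le)
      then have m2: "0 \<le> m" "m \<le> int n" unfolding nu[symmetric] by linarith+
      define k where "k = nat m"
      have k: "real k = real_of_int m" "k \<le> n" using m2 by (auto simp: k_def)
      have "k \<in> K" using k u2 unfolding K_def window_def u_def by auto
      moreover have "y \<in> J k" unfolding J_def x_def k(1) using u1 unfolding u_def by auto
      ultimately show False using False by blast
    qed
    ultimately show ?thesis using far[of y] by auto
  qed
  have "\<bar>(LBINT y. \<psi> y) - (LBINT y. F y)\<bar> = \<bar>LBINT y. \<psi> y - F y\<bar>"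
    using int\<psi> F by (subst Bochner_Integration.integral_diff) auto
  also have "\<dots> \<le> (LBINT y. \<bar>\<psi> y - F y\<bar>)" by (rule integral_abs_bound)
  also have "\<dots> \<le> (LBINT y. D * (1 / (1 + y\<^sup>2)))"
    using int\<psi> F pw integrable_inverse_one_plus_square
    by (intro integral_mono integrable_abs Bochner_Integration.integrable_diff integrable_mult_right) auto
  also have "\<dots> = D * pi" by (simp only: integral_mult_right_zero lborel_inverse_one_plus_square)
  finally show ?thesis unfolding I\<psi> K_def .
qed


text \<open>The ratio of the weight to its scale is exactly \<open>tilt q c b x * exp e\<close>,
  where \<open>e\<close> collects the Stirling error, the Taylor errors of the free energy and of
  the perturbation, and the variation of the prefactor. Two bounds on \<open>e\<close> are combined
  through \<open>|exp e - 1| \<le> |e| exp |e|\<close>: the first factor uses the bound that is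
  small like \<open>1/t\<close>, the second one a bound that half of the decay of the tilt
  absorbs.\<close>

lemma weight_expansion:
  fixes f B :: "real \<Rightarrow> real"
  assumes a: "0 < a" "a < 1" and c: "c < 0" and q: "even q" "2 \<le> q" and d0: "0 < \<delta>0" and K: "0 \<le> K"
    and A: "\<And>u. \<bar>u\<bar> \<le> \<delta>0 \<Longrightarrow>
      \<bar>(f (a + u) + binary_entropy (a + u)) - (f a + binary_entropy a) - c * u ^ q\<bar> \<le> K * \<bar>u\<bar> ^ (q + 1)"
    and B: "\<And>u. \<bar>u\<bar> \<le> \<delta>0 \<Longrightarrow> \<bar>B (a + u) - B a - b * u\<bar> \<le> K * u\<^sup>2"
  shows "\<exists>\<delta>1>0. \<delta>1 \<le> a \<and> \<delta>1 \<le> 1 - a \<and> (\<exists>C>0. \<forall>n t k. 1 \<le> t \<longrightarrow> real n = t ^ q \<longrightarrow> k \<in> window a \<delta>1 n \<longrightarrow>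
     (1 + \<bar>t * (real k / real n - a)\<bar>) ^ 3 *
       \<bar>bweight f B t n k / laplace_scale f B a t n - tilt q c b (t * (real k / real n - a))\<bar> \<le> C / t)"
proof -
  \<comment> \<open>The logarithm of \<open>x (1 - x)\<close> and its derivative: expanded to first
    order, they control the change of the Stirling prefactor across the window.\<close>
  define D :: "nat \<Rightarrow> real \<Rightarrow> real" where
    "D m x = (if m = 0 then ln x + ln (1 - x) else 1 / x - 1 / (1 - x))" for m x
  define \<epsilon> where "\<epsilon> = min a (1 - a) / 2"
  have \<epsilon>: "0 < \<epsilon>" "\<epsilon> < a" "\<epsilon> < 1 - a" "2 * \<epsilon> \<le> a" "2 * \<epsilon> \<le> 1 - a" using a by (auto simp: \<epsilon>_def)
  have "\<exists>K\<ge>0. \<forall>u. \<bar>u\<bar> \<le> \<epsilon> \<longrightarrow> \<bar>D 0 (a + u) - (\<Sum>m<1. D m a / fact m * u ^ m)\<bar> \<le> K * \<bar>u\<bar> ^ 1"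
  proof (rule taylor_remainder_bound)
    fix m :: nat and x :: real assume "m < 1" "\<bar>x - a\<bar> \<le> \<epsilon>"
    then have "m = 0" "0 < x" "x < 1" using \<epsilon> by auto
    then show "(D m has_real_derivative D (Suc m) x) (at x)"
      unfolding D_def by (auto intro!: derivative_eq_intros)
  next
    show "continuous_on {a - \<epsilon>..a + \<epsilon>} (D 1)"
      unfolding D_def using \<epsilon> by (auto intro!: continuous_intros)
  qed (use \<epsilon> in auto)
  then obtain K4 where K4: "0 \<le> K4"
    "\<And>u. \<bar>u\<bar> \<le> \<epsilon> \<Longrightarrow> \<bar>(ln (a + u) + ln (1 - (a + u))) - (ln a + ln (1 - a))\<bar> \<le> K4 * \<bar>u\<bar>"
    unfolding D_def by auto
  define K1 where "K1 = 2 + 4 / \<epsilon>"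
  have K1: "0 < K1" using \<epsilon> by (simp add: K1_def add_pos_pos)
  define M where "M = K1 + 2 * K + K4"
  have M: "0 < M" using K1 K K4(1) by (simp add: M_def)
  \<comment> \<open>The radius \<open>\<epsilon>\<close> keeps \<open>k/n\<close> in the range of
    the Stirling estimate, the entry \<open>1\<close> gives \<open>|x|/t \<le> 1\<close>, and the
    last entry makes \<open>K * \<delta>1\<close> at most half of \<open>-c\<close>.\<close>
  define \<delta>1 where "\<delta>1 = Min {\<delta>0, \<epsilon>, 1, - c / (2 * (K + 1))}"
  have \<delta>1: "0 < \<delta>1" "\<delta>1 \<le> \<delta>0" "\<delta>1 \<le> \<epsilon>" "\<delta>1 \<le> 1" "\<delta>1 \<le> - c / (2 * (K + 1))"
    unfolding \<delta>1_def using d0 \<epsilon> c K by (auto simp: divide_neg_pos)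
  have K\<delta>: "K * \<delta>1 \<le> - c / 2"
  proof -
    have "K * \<delta>1 \<le> (K + 1) * \<delta>1" using \<delta>1 by simp
    also have "\<dots> \<le> (K + 1) * (- c / (2 * (K + 1)))" using \<delta>1 K by (intro mult_left_mono) auto
    also have "\<dots> = - c / 2" using K by (simp add: field_simps)
    finally show ?thesis .
  qed
  \<comment> \<open>Only \<open>c / 2\<close> of the decay is left after absorbing the error. The
    power \<open>q + 4\<close> is \<open>q + 1\<close> from the Taylor error plus \<open>3\<close>
    from the weight.\<close>
  obtain C0 where C0: "0 < C0" "\<And>x. (1 + \<bar>x\<bar>) ^ (q + 4) * exp (c / 2 * x ^ q + (\<bar>b\<bar> + M) * \<bar>x\<bar>) \<le> C0"
    using poly_times_exp_bounded[of "c / 2" q "q + 4" "\<bar>b\<bar> + M"] c q by auto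
  define C where "C = M * exp M * C0"
  have main: "(1 + \<bar>x\<bar>) ^ 3 * \<bar>bweight f B t n k / laplace_scale f B a t n - tilt q c b x\<bar> \<le> C / t"
    if t: "1 \<le> t" and nt: "real n = t ^ q" and k: "k \<in> window a \<delta>1 n" and x: "x = t * (real k / real n - a)"
    for n t k x
  proof -
    define y where "y = real k / real n"
    define u where "u = y - a"
    have n0: "0 < real n" using t nt by simp
    have u: "\<bar>u\<bar> \<le> \<delta>1" and kn: "k \<le> n" using k by (auto simp: window_def u_def y_def)
    have y: "\<epsilon> \<le> y" "y \<le> 1 - \<epsilon>" using u \<delta>1 \<epsilon> by (auto simp: u_def)
    have y01: "0 < y" "0 < 1 - y" using y \<epsilon> by auto
    have ya: "y = a + u" by (simp add: u_def)
    have xu: "x = t * u" by (simp add: x u_def y_def)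
    have k0: "0 < k" "k < n"
    proof -
      show "0 < k" using y01 by (auto simp: y_def intro!: gr0I)
      have "y * real n < 1 * real n" using y01 n0 by (intro mult_strict_right_mono) auto
      then show "k < n" using n0 by (simp add: y_def)
    qed
    have bpos: "0 < real (n choose k)" using kn by simp
    define e1 where "e1 = ln (real (n choose k)) - real n * binary_entropy y + ln (real n * y * (1 - y)) / 2 + stirling_const"
    define e2 where "e2 = real n * ((f y + binary_entropy y) - (f a + binary_entropy a) - c * u ^ q)"
    define e3 where "e3 = t * (B y - B a - b * u)"
    define e4 where "e4 = (ln y + ln (1 - y)) - (ln a + ln (1 - a))"
    define e where "e = e1 + e2 + e3 - e4 / 2"
    have t0: "0 < t" using t by simp
    have tq: "t \<le> real n" using t q nt by (simp add: self_le_power)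
    have e1: "\<bar>e1\<bar> \<le> K1 / t"
    proof -
      have "\<bar>e1\<bar> \<le> K1 / real n" unfolding e1_def K1_def
        using k0 y \<epsilon> by (intro ln_binomial_stirling) (auto simp: y_def)
      also have "\<dots> \<le> K1 / t" using tq t0 K1 by (intro divide_left_mono) auto
      finally show ?thesis .
    qed
    have xp: "real n * \<bar>u\<bar> ^ (q + 1) = \<bar>x\<bar> ^ (q + 1) / t"
      unfolding xu nt using t0 by (simp add: abs_mult power_mult_distrib)
    have xp2: "t * u\<^sup>2 = x\<^sup>2 / t" unfolding xu using t0 by (simp add: power2_eq_square)
    have xp1: "\<bar>u\<bar> = \<bar>x\<bar> / t" unfolding xu using t0 by (simp add: abs_mult)
    have ud: "\<bar>u\<bar> \<le> \<delta>0" "\<bar>u\<bar> \<le> \<epsilon>" using u \<delta>1 by auto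
    have e2: "\<bar>e2\<bar> \<le> K * (\<bar>x\<bar> ^ (q + 1) / t)"
    proof -
      have "\<bar>e2\<bar> = real n * \<bar>(f y + binary_entropy y) - (f a + binary_entropy a) - c * u ^ q\<bar>"
        unfolding e2_def using n0 by (simp add: abs_mult)
      also have "\<dots> \<le> real n * (K * \<bar>u\<bar> ^ (q + 1))"
        unfolding ya by (intro mult_left_mono A ud) auto
      finally show ?thesis using xp by (simp add: mult.left_commute)
    qed
    have e3: "\<bar>e3\<bar> \<le> K * (x\<^sup>2 / t)"
    proof -
      have "\<bar>e3\<bar> = t * \<bar>B y - B a - b * u\<bar>" unfolding e3_def using t0 by (simp add: abs_mult)
      also have "\<dots> \<le> t * (K * u\<^sup>2)" unfolding ya using t0 by (intro mult_left_mono B ud) auto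
      finally show ?thesis using xp2 by (simp add: mult.left_commute)
    qed
    have e4: "\<bar>e4\<bar> \<le> K4 * (\<bar>x\<bar> / t)"
      unfolding e4_def ya xp1[symmetric] by (intro K4 ud)
    have tri: "\<bar>e\<bar> \<le> \<bar>e1\<bar> + \<bar>e2\<bar> + \<bar>e3\<bar> + \<bar>e4\<bar>" unfolding e_def by linarith
    define P where "P = (1 + \<bar>x\<bar>) ^ (q + 1)"
    have P: "1 \<le> P" "\<bar>x\<bar> ^ (q + 1) \<le> P" "x\<^sup>2 \<le> P" "\<bar>x\<bar> \<le> P"
    proof -
      show "1 \<le> P" unfolding P_def by (rule one_le_power) simp
      show "\<bar>x\<bar> ^ (q + 1) \<le> P" unfolding P_def by (intro power_mono) auto
      have "\<bar>x\<bar>\<^sup>2 \<le> (1 + \<bar>x\<bar>)\<^sup>2" by (intro power_mono) auto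
      also have "\<dots> \<le> P" unfolding P_def using q by (intro power_increasing) auto
      finally show "x\<^sup>2 \<le> P" by simp
      have "\<bar>x\<bar> \<le> (1 + \<bar>x\<bar>) ^ 1" by simp
      also have "\<dots> \<le> P" unfolding P_def by (intro power_increasing) auto
      finally show "\<bar>x\<bar> \<le> P" .
    qed
    have eP: "\<bar>e\<bar> \<le> M / t * P"
    proof -
      have "K1 / t \<le> K1 * (P / t)" using P(1) K1 t0 by (simp add: divide_right_mono)
      moreover have "K * (\<bar>x\<bar> ^ (q + 1) / t) \<le> K * (P / t)"
        "K * (x\<^sup>2 / t) \<le> K * (P / t)" "K4 * (\<bar>x\<bar> / t) \<le> K4 * (P / t)"
        using P K K4(1) t0 by (auto intro!: mult_left_mono divide_right_mono)
      ultimately have "\<bar>e\<bar> \<le> K1 * (P / t) + K * (P / t) + K * (P / t) + K4 * (P / t)"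
        using tri e1 e2 e3 e4 by linarith
      also have "\<dots> = M / t * P" unfolding M_def by (simp add: algebra_simps add_divide_distrib)
      finally show ?thesis .
    qed
    \<comment> \<open>This bound has no factor \<open>1/t\<close> but grows slower than the decay:
      one factor \<open>|x|/t\<close> of the Taylor error is replaced by \<open>\<delta>1\<close>,
      so that \<open>|x|^(q+1)/t\<close> costs only half of \<open>-c x^q\<close>.\<close>
    have eb: "\<bar>e\<bar> \<le> M + M * \<bar>x\<bar> - c / 2 * x ^ q"
    proof -
      have xd: "\<bar>x\<bar> / t \<le> \<delta>1" using u xp1 by simp
      have "K1 / t \<le> K1" using K1 t by (simp add: divide_le_eq)
      moreover have "K * (\<bar>x\<bar> ^ (q + 1) / t) \<le> - c / 2 * x ^ q"
      proof -
        have "K * (\<bar>x\<bar> ^ (q + 1) / t) = (K * (\<bar>x\<bar> / t)) * \<bar>x\<bar> ^ q" by simp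
        also have "\<dots> \<le> (K * \<delta>1) * \<bar>x\<bar> ^ q" using xd K by (intro mult_right_mono mult_left_mono) auto
        also have "\<dots> \<le> - c / 2 * \<bar>x\<bar> ^ q" by (intro mult_right_mono K\<delta>) auto
        finally show ?thesis using q by (simp add: power_even_abs)
      qed
      moreover have "K * (x\<^sup>2 / t) \<le> K * \<bar>x\<bar>"
      proof -
        have "x\<^sup>2 / t = (\<bar>x\<bar> / t) * \<bar>x\<bar>" by (simp add: power2_eq_square)
        also have "\<dots> \<le> 1 * \<bar>x\<bar>" using xd \<delta>1 by (intro mult_right_mono) auto
        finally show ?thesis using K by (intro mult_left_mono) auto
      qed
      moreover have "K4 * (\<bar>x\<bar> / t) \<le> K4 * 1" using xd \<delta>1 K4(1) by (intro mult_left_mono) auto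
      moreover have "K * \<bar>x\<bar> \<le> M * \<bar>x\<bar>" unfolding M_def using K1 K K4(1) by (intro mult_right_mono) auto
      moreover have "K1 + K4 \<le> M" using K unfolding M_def by simp
      ultimately show ?thesis using tri e1 e2 e3 e4 by linarith
    qed
    let ?R = "bweight f B t n k / laplace_scale f B a t n" and ?G = "exp (c / 2 * x ^ q + b * x + M * \<bar>x\<bar>)"
    have "?R = tilt q c b x * exp e"
    proof -
      have bw: "bweight f B t n k = exp (ln (real (n choose k)) + real n * f y + t * B y)"
        unfolding bweight_def y_def[symmetric] using bpos by (simp add: exp_add)
      have sq: "sqrt (real n * a * (1 - a)) = exp ((ln (real n) + ln a + ln (1 - a)) / 2)"
      proof -
        have "sqrt (real n * a * (1 - a)) = exp (ln (sqrt (real n * a * (1 - a))))"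
          using n0 a by simp
        also have "ln (sqrt (real n * a * (1 - a))) = (ln (real n) + ln a + ln (1 - a)) / 2"
          using n0 a by (simp add: ln_sqrt ln_mult)
        finally show ?thesis .
      qed
      have ls: "laplace_scale f B a t n = exp (real n * (f a + binary_entropy a) + t * B a - stirling_const
          - (ln (real n) + ln a + ln (1 - a)) / 2)"
        unfolding laplace_scale_def sq by (simp only: exp_diff)
      have lny: "ln (real n * y * (1 - y)) = ln (real n) + ln y + ln (1 - y)"
        using n0 y01 by (simp add: ln_mult)
      have nx: "c * x ^ q = real n * (c * u ^ q)" unfolding xu nt by (simp add: power_mult_distrib)
      show ?thesis unfolding bw ls tilt_def exp_diff[symmetric] exp_add[symmetric] nx
        unfolding e_def e1_def e2_def e3_def e4_def lny xu
        by (rule arg_cong[where f = exp]) (simp add: algebra_simps add_divide_distrib diff_divide_distrib)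
    qed
    then have "?R - tilt q c b x = tilt q c b x * (exp e - 1)"
      by (simp add: algebra_simps)
    then have "\<bar>?R - tilt q c b x\<bar> = tilt q c b x * \<bar>exp e - 1\<bar>"
      using tilt_pos[of q c b x] by (simp add: abs_mult)
    also have "\<dots> \<le> tilt q c b x * (\<bar>e\<bar> * exp \<bar>e\<bar>)"
      using tilt_pos[of q c b x] by (intro mult_left_mono abs_exp_minus_one_le) auto
    also have "\<dots> \<le> tilt q c b x * ((M / t * P) * exp (M + M * \<bar>x\<bar> - c / 2 * x ^ q))"
      using tilt_pos[of q c b x] eP eb M t0 P by (intro mult_left_mono mult_mono) auto
    also have "\<dots> = (M * exp M / t) * (P * ?G)"
    proof -
      have "exp (c * x ^ q + b * x) * exp (M + M * \<bar>x\<bar> - c / 2 * x ^ q) = exp M * ?G"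
        unfolding exp_add[symmetric] by (rule arg_cong[where f = exp]) simp
      then have "(M / t * P) * (exp (c * x ^ q + b * x) * exp (M + M * \<bar>x\<bar> - c / 2 * x ^ q))
          = (M / t * P) * (exp M * ?G)" by simp
      then show ?thesis unfolding tilt_def by (simp add: mult_ac)
    qed
    finally have fin: "\<bar>?R - tilt q c b x\<bar>
        \<le> (M * exp M / t) * (P * ?G)" .
    have bx: "b * x \<le> \<bar>b\<bar> * \<bar>x\<bar>" by (metis abs_ge_self abs_mult)
    have "(1 + \<bar>x\<bar>) ^ 3 * \<bar>?R - tilt q c b x\<bar>
        \<le> (1 + \<bar>x\<bar>) ^ 3 * ((M * exp M / t) * (P * ?G))"
      by (intro mult_left_mono fin) auto
    also have "\<dots> = (M * exp M / t) * ((1 + \<bar>x\<bar>) ^ (q + 4) * ?G)"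
    proof -
      have "(1 + \<bar>x\<bar>) ^ (q + 4) = (1 + \<bar>x\<bar>) ^ 3 * P" unfolding P_def power_add[symmetric]
        by (rule arg_cong[where f = "power (1 + \<bar>x\<bar>)"]) simp
      then show ?thesis by (simp add: mult_ac)
    qed
    also have "\<dots> \<le> (M * exp M / t) * ((1 + \<bar>x\<bar>) ^ (q + 4) * exp (c / 2 * x ^ q + (\<bar>b\<bar> + M) * \<bar>x\<bar>))"
      using M t0 bx by (intro mult_left_mono) (auto simp: distrib_right)
    also have "\<dots> \<le> (M * exp M / t) * C0"
      using M t0 by (intro mult_left_mono C0) auto
    finally show ?thesis unfolding C_def by (simp add: mult_ac)
  qed
  show ?thesis
  proof (rule exI[of _ \<delta>1], intro conjI)
    have "0 < C" unfolding C_def using M C0 by simp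
    then show "\<exists>C>0. \<forall>n t k. 1 \<le> t \<longrightarrow> real n = t ^ q \<longrightarrow> k \<in> window a \<delta>1 n \<longrightarrow>
       (1 + \<bar>t * (real k / real n - a)\<bar>) ^ 3 *
         \<bar>bweight f B t n k / laplace_scale f B a t n - tilt q c b (t * (real k / real n - a))\<bar> \<le> C / t"
      using main by blast
  qed (use \<delta>1 \<epsilon> in auto)
qed

text \<open>On the cell of \<open>k\<close> the error has three sources: the weight against the tilt
  at the grid point, the variation of the test function, and the variation of the tilt. Each is of
  order \<open>1/t\<close> after multiplication by \<open>1 + y^2\<close>, because a cell is no
  longer than \<open>1/t\<close>. Beyond the window the integrand itself is small. Shrinking a
  window preserves the expansion, hence every radius up to \<open>\<delta>1\<close> is
  admissible.\<close>

lemma local_laplace: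
  fixes f B :: "real \<Rightarrow> real"
  assumes a: "0 < a" "a < 1" and c: "c < 0" and q: "even q" "2 \<le> q" and d0: "0 < \<delta>0" and K: "0 \<le> K"
    and A: "\<And>u. \<bar>u\<bar> \<le> \<delta>0 \<Longrightarrow>
      \<bar>(f (a + u) + binary_entropy (a + u)) - (f a + binary_entropy a) - c * u ^ q\<bar> \<le> K * \<bar>u\<bar> ^ (q + 1)"
    and B: "\<And>u. \<bar>u\<bar> \<le> \<delta>0 \<Longrightarrow> \<bar>B (a + u) - B a - b * u\<bar> \<le> K * u\<^sup>2"
  shows "\<exists>\<delta>1>0. \<forall>\<delta>. 0 < \<delta> \<and> \<delta> \<le> \<delta>1 \<longrightarrow> laplace_at q f B a c b \<delta>"
proof -
  obtain \<delta>1 C1 where d1: "0 < \<delta>1" "\<delta>1 \<le> a" "\<delta>1 \<le> 1 - a" and C1: "0 < C1"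
    and exp: "\<And>n t k. 1 \<le> t \<Longrightarrow> real n = t ^ q \<Longrightarrow> k \<in> window a \<delta>1 n \<Longrightarrow>
     (1 + \<bar>t * (real k / real n - a)\<bar>) ^ 3 *
       \<bar>bweight f B t n k / laplace_scale f B a t n - tilt q c b (t * (real k / real n - a))\<bar> \<le> C1 / t"
    using weight_expansion[OF a c q d0 K A B] by blast
  obtain C2 where C2: "0 < C2" "\<And>x. (1 + \<bar>x\<bar>) ^ 4 * tilt q c b x \<le> C2"
    using tilt_decay[OF c q, of 4 b] by blast
  obtain C3 where C3: "0 < C3" "\<And>x y. \<bar>x - y\<bar> \<le> 1 \<Longrightarrow> (1 + \<bar>y\<bar>) ^ 3 * \<bar>tilt q c b x - tilt q c b y\<bar> \<le> C3 * \<bar>x - y\<bar>"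
    using tilt_lipschitz_decay[OF c q, of b] by blast
  show ?thesis
  proof (rule exI[of _ \<delta>1], intro conjI allI impI)
    fix \<delta> assume d: "0 < \<delta> \<and> \<delta> \<le> \<delta>1"
    \<comment> \<open>The factor \<open>4\<close> is the price of passing from
      \<open>1 + y^2\<close> to \<open>(1 + |x|)^2\<close> within a cell, and
      \<open>C2 / \<delta>\<close> bounds the integrand outside the window.\<close>
    define D where "D = 4 * (C1 + C2) + C3 + C2 / \<delta>"
    have D: "0 < D" using C1 C2 C3 d by (simp add: D_def add_pos_pos)
    show "laplace_at q f B a c b \<delta>" unfolding laplace_at_def
    proof (intro exI[of _ "D * pi"] conjI allI impI)
      fix n :: nat and \<phi> :: "real \<Rightarrow> real" assume n0: "0 < n" and \<phi>: "test_fun \<phi>"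
      define t where "t = real n powr (1 / real q)"
      have t: "1 \<le> t" and nt: "real n = t ^ q" using root_rate[OF n0, of q] q unfolding t_def by auto
      have t0: "0 < t" using t by simp
      have tn: "t / real n \<le> 1 / t"
      proof -
        have "t * t = t ^ 2" by (simp add: power2_eq_square)
        also have "\<dots> \<le> t ^ q" using t q by (intro power_increasing) auto
        finally have "t * t \<le> real n" using nt by simp
        then show ?thesis using t0 n0 by (simp add: field_simps)
      qed
      have it: "1 / t \<le> 1" using t by simp
      have "\<bar>t / real n * (\<Sum>k\<in>window a \<delta> n. \<phi> (t * (real k / real n - a)) * (bweight f B t n k / laplace_scale f B a t n))
       - (LBINT x. \<phi> x * tilt q c b x)\<bar> \<le> (D / t) * pi"
      proof (rule riemann_sum_bound)
        show "integrable lborel (\<lambda>x. \<phi> x * tilt q c b x)" by (rule integrable_test_fun_tilt[OF c q \<phi>])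
      next
        fix k y assume k: "k \<in> window a \<delta> n" and ky: "t * (real k / real n - a) \<le> y"
          "y < t * (real k / real n - a) + t / real n"
        define x where "x = t * (real k / real n - a)"
        define V where "V = bweight f B t n k / laplace_scale f B a t n"
        have xy: "\<bar>x - y\<bar> \<le> 1 / t" "\<bar>x - y\<bar> \<le> 1" using ky tn it unfolding x_def by auto
        have k1: "k \<in> window a \<delta>1 n" using k d by (auto simp: window_def)
        have px: "0 < 1 + \<bar>x\<bar>" and py: "0 < 1 + \<bar>y\<bar>" by auto
        have E: "(1 + \<bar>x\<bar>) ^ 3 * \<bar>V - tilt q c b x\<bar> \<le> C1 / t"
          unfolding V_def x_def by (rule exp[OF t nt k1])
        have sq2: "1 + y\<^sup>2 \<le> 4 * (1 + \<bar>x\<bar>)\<^sup>2"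
        proof -
          have "1 + y\<^sup>2 \<le> (1 + \<bar>y\<bar>)\<^sup>2" by (rule one_plus_square_le)
          also have "\<dots> \<le> (2 * (1 + \<bar>x\<bar>))\<^sup>2" using xy(2) by (intro power_mono) auto
          finally show ?thesis unfolding power_mult_distrib by simp
        qed
        have T1: "(1 + y\<^sup>2) * (\<bar>\<phi> x\<bar> * \<bar>V - tilt q c b x\<bar>) \<le> 4 * (C1 / t)"
        proof -
          have "(1 + y\<^sup>2) * (\<bar>\<phi> x\<bar> * \<bar>V - tilt q c b x\<bar>)
              \<le> (4 * (1 + \<bar>x\<bar>)\<^sup>2) * ((1 + \<bar>x\<bar>) * \<bar>V - tilt q c b x\<bar>)"
            using sq2 test_funD(2)[OF \<phi>, of x] by (intro mult_mono) auto
          also have "\<dots> = 4 * ((1 + \<bar>x\<bar>) ^ 3 * \<bar>V - tilt q c b x\<bar>)"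
            by (simp add: power2_eq_square power3_eq_cube)
          also have "\<dots> \<le> 4 * (C1 / t)" using E by simp
          finally show ?thesis .
        qed
        have T2: "(1 + y\<^sup>2) * (\<bar>\<phi> x - \<phi> y\<bar> * tilt q c b x) \<le> 4 * (C2 / t)"
        proof -
          have "(1 + y\<^sup>2) * (\<bar>\<phi> x - \<phi> y\<bar> * tilt q c b x) \<le> (4 * (1 + \<bar>x\<bar>)\<^sup>2) * (1 / t * tilt q c b x)"
            using sq2 test_funD(1)[OF \<phi>, of x y] xy tilt_pos[of q c b x] t0 by (intro mult_mono) auto
          also have "\<dots> \<le> (4 * (1 + \<bar>x\<bar>) ^ 4) * (1 / t * tilt q c b x)"
            using tilt_pos[of q c b x] t0
            by (intro mult_right_mono mult_left_mono power_increasing) auto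
          also have "\<dots> = 4 * (((1 + \<bar>x\<bar>) ^ 4 * tilt q c b x) / t)" by simp
          also have "\<dots> \<le> 4 * (C2 / t)" using C2(2)[of x] t0 by (intro mult_left_mono divide_right_mono) auto
          finally show ?thesis .
        qed
        have T3: "(1 + y\<^sup>2) * (\<bar>\<phi> y\<bar> * \<bar>tilt q c b x - tilt q c b y\<bar>) \<le> C3 / t"
        proof -
          have "(1 + y\<^sup>2) * (\<bar>\<phi> y\<bar> * \<bar>tilt q c b x - tilt q c b y\<bar>)
              \<le> (1 + \<bar>y\<bar>)\<^sup>2 * ((1 + \<bar>y\<bar>) * \<bar>tilt q c b x - tilt q c b y\<bar>)"
            using one_plus_square_le[of y] test_funD(2)[OF \<phi>, of y] by (intro mult_mono) auto
          also have "\<dots> = (1 + \<bar>y\<bar>) ^ 3 * \<bar>tilt q c b x - tilt q c b y\<bar>"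
            by (simp add: power2_eq_square power3_eq_cube)
          also have "\<dots> \<le> C3 * \<bar>x - y\<bar>" by (rule C3(2)[OF xy(2)])
          also have "\<dots> \<le> C3 * (1 / t)" using C3(1) xy(1) by (intro mult_left_mono) auto
          finally show ?thesis by simp
        qed
        \<comment> \<open>Telescoping through \<open>\<phi> x * tilt q c b x\<close> and
          \<open>\<phi> y * tilt q c b x\<close>, one summand for each of \<open>T1\<close>,
          \<open>T2\<close>, \<open>T3\<close>.\<close>
        have split: "\<phi> x * V - \<phi> y * tilt q c b y = \<phi> x * (V - tilt q c b x) + (\<phi> x - \<phi> y) * tilt q c b x
            + \<phi> y * (tilt q c b x - tilt q c b y)" by (simp add: algebra_simps)
        have "\<bar>\<phi> x * V - \<phi> y * tilt q c b y\<bar> \<le> \<bar>\<phi> x\<bar> * \<bar>V - tilt q c b x\<bar> + \<bar>\<phi> x - \<phi> y\<bar> * tilt q c b x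
            + \<bar>\<phi> y\<bar> * \<bar>tilt q c b x - tilt q c b y\<bar>"
          unfolding split using tilt_pos[of q c b x]
          by (intro order_trans[OF abs_triangle_ineq] add_mono) (auto simp: abs_mult)
        then have "(1 + y\<^sup>2) * \<bar>\<phi> x * V - \<phi> y * tilt q c b y\<bar> \<le> (1 + y\<^sup>2) * (\<bar>\<phi> x\<bar> * \<bar>V - tilt q c b x\<bar>
            + \<bar>\<phi> x - \<phi> y\<bar> * tilt q c b x + \<bar>\<phi> y\<bar> * \<bar>tilt q c b x - tilt q c b y\<bar>)"
          by (intro mult_left_mono) auto
        also have "\<dots> \<le> 4 * (C1 / t) + 4 * (C2 / t) + C3 / t"
          unfolding distrib_left by (intro add_mono T1 T2 T3)
        also have "\<dots> = (4 * (C1 + C2) + C3) / t" by (simp add: add_divide_distrib)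
        also have "\<dots> \<le> D / t" unfolding D_def using C2 d t0 by (intro divide_right_mono) auto
        finally show "\<bar>\<phi> (t * (real k / real n - a)) * (bweight f B t n k / laplace_scale f B a t n)
            - \<phi> y * tilt q c b y\<bar> \<le> D / t / (1 + y\<^sup>2)"
          unfolding x_def[symmetric] V_def[symmetric]
          by (subst pos_le_divide_eq) (auto simp: add_pos_nonneg mult.commute)
      next
        fix y assume "\<delta> * t - t / real n < \<bar>y\<bar>"
        \<comment> \<open>Outside the window \<open>1 + |y|\<close> is at least
          \<open>\<delta> t\<close>, so the fourth power of decay, one more than the integrable
          majorant requires, is converted into the factor \<open>1/t\<close>.\<close>
        then have y: "\<delta> * t \<le> 1 + \<bar>y\<bar>" using tn it by linarith
        have dt: "0 < \<delta> * t" using d t0 by simp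
        have tp: "0 \<le> tilt q c b y" using tilt_pos[of q c b y] by simp
        have "(1 + y\<^sup>2) * \<bar>\<phi> y * tilt q c b y\<bar> = (1 + y\<^sup>2) * (\<bar>\<phi> y\<bar> * tilt q c b y)"
          using tp by (simp add: abs_mult)
        also have "\<dots> \<le> (1 + \<bar>y\<bar>)\<^sup>2 * ((1 + \<bar>y\<bar>) * tilt q c b y)"
          using one_plus_square_le[of y] test_funD(2)[OF \<phi>, of y] tp by (intro mult_mono mult_right_mono) auto
        also have "\<dots> = (1 + \<bar>y\<bar>) ^ 3 * tilt q c b y" by (simp add: power2_eq_square power3_eq_cube)
        finally have "(1 + y\<^sup>2) * \<bar>\<phi> y * tilt q c b y\<bar> \<le> (1 + \<bar>y\<bar>) ^ 3 * tilt q c b y" .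
        then have "(\<delta> * t) * ((1 + y\<^sup>2) * \<bar>\<phi> y * tilt q c b y\<bar>) \<le> (1 + \<bar>y\<bar>) * ((1 + \<bar>y\<bar>) ^ 3 * tilt q c b y)"
          by (rule mult_mono[OF y]) auto
        also have "\<dots> = (1 + \<bar>y\<bar>) ^ 4 * tilt q c b y" by (simp add: power_numeral_reduce)
        also have "\<dots> \<le> C2" by (rule C2)
        finally have "(1 + y\<^sup>2) * \<bar>\<phi> y * tilt q c b y\<bar> \<le> C2 / (\<delta> * t)"
          using dt by (simp add: pos_le_divide_eq mult.commute)
        also have "\<dots> = C2 / \<delta> / t" by simp
        also have "\<dots> \<le> D / t" unfolding D_def using C1 C2 C3 t0 by (intro divide_right_mono) auto
        finally show "\<bar>\<phi> y * tilt q c b y\<bar> \<le> D / t / (1 + y\<^sup>2)"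
          by (subst pos_le_divide_eq) (auto simp: add_pos_nonneg mult.commute)
      qed (use n0 t0 d d1 in auto)
      moreover have "rescaled_sum f B a t n (window a \<delta> n) \<phi> = t / real n *
          (\<Sum>k\<in>window a \<delta> n. \<phi> (t * (real k / real n - a)) * (bweight f B t n k / laplace_scale f B a t n))"
        unfolding rescaled_sum_def by (simp add: sum_divide_distrib[symmetric])
      ultimately show "\<bar>rescaled_sum f B a (real n powr (1 / real q)) n (window a \<delta> n) \<phi>
          - (LBINT x. \<phi> x * tilt q c b x)\<bar> \<le> D * pi / real n powr (1 / real q)"
        unfolding t_def[symmetric] by simp
    qed (use D in auto)
  qed (use d1 in auto)
qed

section \<open>Gibbs expectations as binomial sums\<close>

text \<open>A configuration is the same as its set of plus sites; grouping these sets by cardinality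
  produces the binomial coefficients.\<close>

lemma sum_configs_card:
  fixes G :: "nat \<Rightarrow> real"
  shows "(\<Sum>\<omega>\<in>configs n. G (card {i\<in>{1..n}. \<omega> i = 1})) = (\<Sum>k\<le>n. real (n choose k) * G k)"
proof -
  \<comment> \<open>The restricted abstraction makes the result \<open>undefined\<close> outside the
    sites, as membership in the extensional function space requires.\<close>
  define enc where "enc S = (\<lambda>i\<in>{1..n}. if i \<in> S then 1 else - 1 :: real)" for S :: "nat set"
  have bij: "bij_betw (\<lambda>\<omega>. {i\<in>{1..n}. \<omega> i = 1}) (configs n) (Pow {1..n})"
  proof (rule bij_betw_byWitness[where f' = enc])
    show "\<forall>\<omega>\<in>configs n. enc {i \<in> {1..n}. \<omega> i = 1} = \<omega>"
    proof
      fix \<omega> assume w: "\<omega> \<in> configs n"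
      show "enc {i \<in> {1..n}. \<omega> i = 1} = \<omega>"
      proof
        fix i show "enc {i \<in> {1..n}. \<omega> i = 1} i = \<omega> i"
        proof (cases "i \<in> {1..n}")
          case True
          then have "\<omega> i \<in> {1, - 1}" using w unfolding configs_def by (rule PiE_mem[rotated])
          then show ?thesis using True by (auto simp: enc_def)
        next
          case False
          have "\<omega> i = undefined" using w False unfolding configs_def by (rule PiE_arb)
          then show ?thesis using False by (auto simp: enc_def)
        qed
      qed
    qed
    show "\<forall>S\<in>Pow {1..n}. {i \<in> {1..n}. enc S i = 1} = S" by (auto simp: enc_def)
    show "enc ` Pow {1..n} \<subseteq> configs n" by (auto simp: enc_def configs_def)
  qed auto
  have "(\<Sum>\<omega>\<in>configs n. G (card {i\<in>{1..n}. \<omega> i = 1})) = (\<Sum>S\<in>Pow {1..n}. G (card S))"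
    by (rule sum.reindex_bij_betw[OF bij])
  also have "\<dots> = (\<Sum>k\<in>{..n}. \<Sum>S\<in>{S\<in>Pow {1..n}. card S = k}. G (card S))"
  proof (rule sum.group[symmetric])
    show "card ` Pow {1..n} \<subseteq> {..n}"
      using card_mono[of "{1..n}"] by fastforce
  qed auto
  also have "\<dots> = (\<Sum>k\<le>n. real (n choose k) * G k)"
  proof (rule sum.cong[OF refl])
    fix k
    have "(\<Sum>S\<in>{S\<in>Pow {1..n}. card S = k}. G (card S)) = (\<Sum>S\<in>{S\<in>Pow {1..n}. card S = k}. G k)"
      by (rule sum.cong) auto
    also have "\<dots> = real (card {S. S \<subseteq> {1..n} \<and> card S = k}) * G k" by (simp add: Pow_def)
    also have "card {S. S \<subseteq> {1..n} \<and> card S = k} = n choose k"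
      using n_subsets[of "{1..n}" k] by simp
    finally show "(\<Sum>S\<in>{S\<in>Pow {1..n}. card S = k}. G (card S)) = real (n choose k) * G k" .
  qed
  finally show ?thesis .
qed

lemma finite_configs: "finite (configs n)" unfolding configs_def by (intro finite_PiE) auto

lemma configs_nonempty: "configs n \<noteq> {}" unfolding configs_def by (simp add: PiE_eq_empty_iff)

lemma magnetization_eq:
  assumes "\<omega> \<in> configs n"
  shows "magnetization n \<omega> = 2 * real (card {i\<in>{1..n}. \<omega> i = 1}) - real n"
proof -
  let ?S = "{i\<in>{1..n}. \<omega> i = 1}"
  have "magnetization n \<omega> = (\<Sum>i=1..n. 2 * (if \<omega> i = 1 then 1 else 0) - 1)"
    unfolding magnetization_def
  proof (rule sum.cong[OF refl])
    fix i assume "i \<in> {1..n}"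
    then have "\<omega> i \<in> {1, - 1}" using assms unfolding configs_def by (rule PiE_mem[rotated])
    then show "\<omega> i = 2 * (if \<omega> i = 1 then 1 else 0) - 1" by auto
  qed
  also have "\<dots> = 2 * (\<Sum>i=1..n. if \<omega> i = 1 then 1 else 0) - real n"
    by (simp add: sum_subtractf sum_distrib_left)
  also have "(\<Sum>i=1..n. if \<omega> i = 1 then 1 else (0::real)) = real (card ?S)"
    by (simp add: sum.inter_filter[symmetric])
  finally show ?thesis .
qed

lemma gibbs_weights:
  fixes H :: "real \<Rightarrow> real" and n :: nat
  defines "w \<equiv> \<lambda>\<omega>. exp (H (frac_plus n \<omega>)) / (\<Sum>\<eta>\<in>configs n. exp (H (frac_plus n \<eta>)))"
  shows "0 \<le> w \<omega>" "(\<Sum>\<omega>\<in>configs n. w \<omega>) = 1"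
proof -
  have "0 < (\<Sum>\<eta>\<in>configs n. exp (H (frac_plus n \<eta>)))"
    by (intro sum_pos finite_configs configs_nonempty) auto
  then show "(\<Sum>\<omega>\<in>configs n. w \<omega>) = 1" unfolding w_def by (simp add: sum_divide_distrib[symmetric])
  show "0 \<le> w \<omega>" unfolding w_def by (intro divide_nonneg_nonneg sum_nonneg) auto
qed

lemma space_gibbs: "space (gibbs n H) = configs n"
  and sets_gibbs: "sets (gibbs n H) = Pow (configs n)"
  by (simp_all add: gibbs_def space_point_measure sets_point_measure)

lemma prob_space_gibbs: "prob_space (gibbs n H)"
  unfolding gibbs_def
  by (rule prob_spaceI)
    (simp add: space_point_measure emeasure_point_measure_finite finite_configs gibbs_weights sum_ennreal)

lemma measurable_gibbs: "X \<in> measurable (gibbs n H) borel"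
  by (auto simp: measurable_def space_gibbs sets_gibbs)

lemma integral_gibbs:
  fixes G :: "(nat \<Rightarrow> real) \<Rightarrow> real"
  assumes G: "\<And>\<omega>. \<omega> \<in> configs n \<Longrightarrow> G \<omega> = g (card {i\<in>{1..n}. \<omega> i = 1})"
  shows "integral\<^sup>L (gibbs n H) G =
    (\<Sum>k\<le>n. g k * (real (n choose k) * exp (H (real k / real n)))) / (\<Sum>k\<le>n. real (n choose k) * exp (H (real k / real n)))"
proof -
  let ?Z = "\<Sum>\<eta>\<in>configs n. exp (H (frac_plus n \<eta>))"
  have Z: "?Z = (\<Sum>k\<le>n. real (n choose k) * exp (H (real k / real n)))"
    unfolding frac_plus_def by (rule sum_configs_card)
  have "integral\<^sup>L (gibbs n H) G = (\<Sum>\<omega>\<in>configs n. exp (H (frac_plus n \<omega>)) / ?Z * G \<omega>)"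
    unfolding gibbs_def by (subst lebesgue_integral_point_measure_finite) (auto simp: finite_configs gibbs_weights)
  also have "\<dots> = (\<Sum>\<omega>\<in>configs n. (\<lambda>k. exp (H (real k / real n)) * g k) (card {i\<in>{1..n}. \<omega> i = 1})) / ?Z"
    unfolding sum_divide_distrib frac_plus_def by (intro sum.cong refl) (simp add: G)
  also have "\<dots> = (\<Sum>k\<le>n. real (n choose k) * (exp (H (real k / real n)) * g k)) / ?Z"
    by (subst sum_configs_card) simp
  finally show ?thesis unfolding Z by (simp add: mult_ac)
qed

lemma measure_gibbs:
  assumes P: "\<And>\<omega>. \<omega> \<in> configs n \<Longrightarrow> P \<omega> \<longleftrightarrow> card {i\<in>{1..n}. \<omega> i = 1} \<in> S"
  shows "measure (gibbs n H) {\<omega> \<in> space (gibbs n H). P \<omega>} =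
    (\<Sum>k\<in>{..n} \<inter> S. real (n choose k) * exp (H (real k / real n))) / (\<Sum>k\<le>n. real (n choose k) * exp (H (real k / real n)))"
proof -
  interpret prob_space "gibbs n H" by (rule prob_space_gibbs)
  let ?A = "{\<omega> \<in> space (gibbs n H). P \<omega>}"
  have "measure (gibbs n H) ?A = integral\<^sup>L (gibbs n H) (indicator ?A)"
  proof -
    have "?A \<inter> space (gibbs n H) = ?A" by auto
    then show ?thesis by (simp only: Bochner_Integration.integral_indicator)
  qed
  also have "\<dots> = (\<Sum>k\<le>n. indicator S k * (real (n choose k) * exp (H (real k / real n)))) / (\<Sum>k\<le>n. real (n choose k) * exp (H (real k / real n)))"
    by (rule integral_gibbs) (auto simp: indicator_def P space_gibbs)
  also have "(\<Sum>k\<le>n. indicator S k * (real (n choose k) * exp (H (real k / real n)))) = (\<Sum>k\<in>{..n} \<inter> S. real (n choose k) * exp (H (real k / real n)))"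
    by (rule sum.mono_neutral_cong_right) (auto simp: indicator_def)
  finally show ?thesis .
qed

lemma integral_uniform_measure:
  fixes g :: "'a \<Rightarrow> real"
  assumes A: "A \<in> sets M" "emeasure M A \<noteq> 0" "emeasure M A \<noteq> \<infinity>" and g: "g \<in> borel_measurable M"
  shows "integral\<^sup>L (uniform_measure M A) g = (LINT x|M. indicator A x * g x) / measure M A"
proof -
  have pos: "0 < measure M A" using A by (simp add: measure_def enn2real_positive_iff less_top zero_less_iff_neq_zero)
  have "uniform_measure M A = density M (\<lambda>x. ennreal (indicator A x / measure M A))"
    unfolding uniform_measure_def using A pos
    by (intro arg_cong[where f = "density M"] ext)
      (auto simp: indicator_def emeasure_eq_ennreal_measure divide_ennreal[symmetric] top_unique)
  then have "integral\<^sup>L (uniform_measure M A) g = (LINT x|M. indicator A x / measure M A * g x)"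
    using A g pos by (simp add: integral_density)
  also have "\<dots> = (LINT x|M. indicator A x * g x / measure M A)" by (simp add: field_simps)
  finally show ?thesis by simp
qed

text \<open>The partition function cancels between the integral over the event and its probability,
  leaving sums over \<open>S\<close> only. Nonemptiness makes the probability of the event positive,
  so that the conditional law is a genuine one.\<close>

lemma integral_gibbs_conditional:
  assumes G: "\<And>\<omega>. \<omega> \<in> configs n \<Longrightarrow> G \<omega> = g (card {i\<in>{1..n}. \<omega> i = 1})"
    and P: "\<And>\<omega>. \<omega> \<in> configs n \<Longrightarrow> P \<omega> \<longleftrightarrow> card {i\<in>{1..n}. \<omega> i = 1} \<in> S"
    and ne: "{..n} \<inter> S \<noteq> {}"
  shows "integral\<^sup>L (uniform_measure (gibbs n H) {\<omega> \<in> space (gibbs n H). P \<omega>}) G =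
    (\<Sum>k\<in>{..n} \<inter> S. g k * (real (n choose k) * exp (H (real k / real n)))) /
    (\<Sum>k\<in>{..n} \<inter> S. real (n choose k) * exp (H (real k / real n)))"
proof -
  interpret prob_space "gibbs n H" by (rule prob_space_gibbs)
  let ?A = "{\<omega> \<in> space (gibbs n H). P \<omega>}" and ?w = "\<lambda>k. real (n choose k) * exp (H (real k / real n))"
  have A: "?A \<in> sets (gibbs n H)" by (auto simp: sets_gibbs space_gibbs)
  have Z: "0 < (\<Sum>k\<le>n. ?w k)" by (intro sum_pos) auto
  have W: "0 < (\<Sum>k\<in>{..n} \<inter> S. ?w k)" using ne by (intro sum_pos) auto
  have m: "measure (gibbs n H) ?A = (\<Sum>k\<in>{..n} \<inter> S. ?w k) / (\<Sum>k\<le>n. ?w k)"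
    by (rule measure_gibbs[OF P])
  have m0: "measure (gibbs n H) ?A \<noteq> 0" unfolding m using Z W by simp
  have "integral\<^sup>L (uniform_measure (gibbs n H) ?A) G = (LINT \<omega>|gibbs n H. indicator ?A \<omega> * G \<omega>) / measure (gibbs n H) ?A"
    using A m0 by (intro integral_uniform_measure measurable_gibbs) (auto simp: emeasure_eq_measure)
  also have "(LINT \<omega>|gibbs n H. indicator ?A \<omega> * G \<omega>) = (\<Sum>k\<le>n. (indicator S k * g k) * ?w k) / (\<Sum>k\<le>n. ?w k)"
    by (rule integral_gibbs) (auto simp: indicator_def P G space_gibbs)
  also have "(\<Sum>k\<le>n. (indicator S k * g k) * ?w k) = (\<Sum>k\<in>{..n} \<inter> S. g k * ?w k)"
    by (rule sum.mono_neutral_cong_right) (auto simp: indicator_def)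
  finally show ?thesis unfolding m using Z W by (simp add: field_simps)
qed

section \<open>Derivatives of the free energy\<close>

text \<open>Differentiating the \<open>k\<close>-th iterate at a point uses its values nearby, so
  the induction carries the identity over the whole open set.\<close>

lemma higher_deriv_eq:
  fixes D :: "nat \<Rightarrow> real \<Rightarrow> real"
  assumes "open S" and D: "\<And>k x. x \<in> S \<Longrightarrow> (D k has_real_derivative D (Suc k) x) (at x)" and "x \<in> S"
  shows "(deriv ^^ k) (D 0) x = D k x"
  using assms(3)
proof (induction k arbitrary: x)
  case (Suc k)
  have "((deriv ^^ k) (D 0) has_real_derivative D (Suc k) x) (at x)"
    by (rule has_field_derivative_transform_within_open[OF D[OF Suc.prems] assms(1) Suc.prems])
      (simp add: Suc.IH)
  then show ?case by (simp add: DERIV_imp_deriv)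
qed simp

text \<open>The product is a falling factorial in truncated subtraction: for \<open>k > p\<close> it
  contains the factor \<open>p - p\<close>, so the truncated exponent \<open>p - k\<close> does no
  harm.\<close>

definition pspin_deriv :: "nat \<Rightarrow> real \<Rightarrow> real \<Rightarrow> nat \<Rightarrow> real \<Rightarrow> real" where
  "pspin_deriv p \<beta> h k x = \<beta> * 2 ^ k * (\<Prod>i<k. real (p - i)) * (2 * x - 1) ^ (p - k)
     + (if k = 0 then h * (2 * x - 1) else if k = 1 then 2 * h else 0)"

text \<open>From order two on these are the derivatives of \<open>-1/x - 1/(1-x)\<close>, which
  explains the factorial and the alternating sign of the first summand.\<close>

fun entropy_deriv :: "nat \<Rightarrow> real \<Rightarrow> real" where
  "entropy_deriv 0 x = binary_entropy x"
| "entropy_deriv (Suc 0) x = ln (1 - x) - ln x"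
| "entropy_deriv (Suc (Suc j)) x = fact j * ((- 1) ^ Suc j * inverse x ^ Suc j - inverse (1 - x) ^ Suc j)"

lemma pspin_deriv_0: "pspin_deriv p \<beta> h 0 = pspin p \<beta> h"
  by (auto simp: pspin_deriv_def pspin_def)

lemma has_derivative_pspin_deriv:
  "(pspin_deriv p \<beta> h k has_real_derivative pspin_deriv p \<beta> h (Suc k) x) (at x)"
proof -
  have "((\<lambda>x. \<beta> * 2 ^ k * (\<Prod>i<k. real (p - i)) * (2 * x - 1) ^ (p - k)) has_real_derivative
      \<beta> * 2 ^ Suc k * (\<Prod>i<Suc k. real (p - i)) * (2 * x - 1) ^ (p - Suc k)) (at x)"
    by (rule derivative_eq_intros refl)+ simp
  moreover have "((\<lambda>x. if k = 0 then h * (2 * x - 1) else if k = 1 then 2 * h else 0) has_real_derivative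
      (if Suc k = 0 then h * (2 * x - 1) else if Suc k = 1 then 2 * h else 0)) (at x)"
    by (cases "k = 0") (auto intro!: derivative_eq_intros)
  ultimately show ?thesis unfolding pspin_deriv_def[abs_def] by (rule DERIV_add)
qed

lemma has_derivative_inverse_power:
  fixes x :: real assumes "x \<noteq> 0"
  shows "((\<lambda>x. inverse x ^ m) has_real_derivative - real m * inverse x ^ Suc m) (at x)"
proof (cases m)
  case (Suc j)
  have "((\<lambda>x. inverse x ^ Suc j) has_real_derivative
      real (Suc j) * (- (inverse x ^ Suc (Suc 0)) * inverse x ^ (Suc j - Suc 0))) (at x)"
    by (rule DERIV_power[OF DERIV_inverse[OF assms], of "Suc j"])
  moreover have "real (Suc j) * (- (inverse x ^ Suc (Suc 0)) * inverse x ^ (Suc j - Suc 0))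
      = - real (Suc j) * inverse x ^ Suc (Suc j)" by (simp add: algebra_simps)
  ultimately show ?thesis unfolding Suc by simp
qed simp

lemma has_derivative_entropy_deriv:
  assumes "0 < x" "x < 1"
  shows "(entropy_deriv k has_real_derivative entropy_deriv (Suc k) x) (at x)"
proof -
  consider (1) "k = 0" | (2) "k = Suc 0" | (3) j where "k = Suc (Suc j)" by (metis not0_implies_Suc)
  then show ?thesis
  proof cases
  case 1
  then show ?thesis using assms
    by (auto simp: binary_entropy_def[abs_def] entropy_deriv.simps[abs_def] intro!: derivative_eq_intros)
next
  case 2
  then show ?thesis using assms
    by (auto simp: entropy_deriv.simps[abs_def] inverse_eq_divide intro!: derivative_eq_intros)
next
  case (3 j)
  have "((\<lambda>x. inverse (1 - x) ^ Suc j) has_real_derivative real (Suc j) * inverse (1 - x) ^ Suc (Suc j)) (at x)"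
  proof -
    have "((\<lambda>x. 1 - x) has_real_derivative - 1) (at x)" by (auto intro!: derivative_eq_intros)
    then have "((\<lambda>x. inverse (1 - x) ^ Suc j) has_real_derivative
        (- real (Suc j) * inverse (1 - x) ^ Suc (Suc j)) * (- 1)) (at x)"
      using assms by (intro DERIV_chain2[where f = "\<lambda>x. inverse x ^ Suc j" and g = "\<lambda>x. 1 - x"]
          has_derivative_inverse_power) auto
    then show ?thesis by (simp only: minus_mult_left[symmetric] mult_minus_right mult_1_right minus_minus)
  qed
  moreover have "((\<lambda>x. inverse x ^ Suc j) has_real_derivative - real (Suc j) * inverse x ^ Suc (Suc j)) (at x)"
    using assms by (intro has_derivative_inverse_power) auto
  ultimately have "((\<lambda>x. fact j * ((- 1) ^ Suc j * inverse x ^ Suc j - inverse (1 - x) ^ Suc j)) has_real_derivative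
      fact j * ((- 1) ^ Suc j * (- real (Suc j) * inverse x ^ Suc (Suc j)) - real (Suc j) * inverse (1 - x) ^ Suc (Suc j))) (at x)"
    by (intro DERIV_cmult DERIV_diff)
  moreover have "fact j * ((- 1) ^ Suc j * (- real (Suc j) * inverse x ^ Suc (Suc j)) - real (Suc j) * inverse (1 - x) ^ Suc (Suc j))
      = entropy_deriv (Suc (Suc (Suc j))) x"
    by (simp add: algebra_simps)
  moreover have "entropy_deriv (Suc (Suc j)) = (\<lambda>x. fact j * ((- 1) ^ Suc j * inverse x ^ Suc j - inverse (1 - x) ^ Suc j))"
    by (rule ext) (rule entropy_deriv.simps(3))
  ultimately show ?thesis unfolding 3 by (simp only:)
qed
qed

definition energy_deriv :: "nat \<Rightarrow> real \<Rightarrow> real \<Rightarrow> nat \<Rightarrow> real \<Rightarrow> real" where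
  "energy_deriv p \<beta> h k x = pspin_deriv p \<beta> h k x + entropy_deriv k x"

lemma energy_deriv_0: "energy_deriv p \<beta> h 0 = free_energy p \<beta> h"
  by (auto simp: energy_deriv_def free_energy_def pspin_deriv_0)

lemma has_derivative_energy_deriv:
  assumes "0 < x" "x < 1"
  shows "(energy_deriv p \<beta> h k has_real_derivative energy_deriv p \<beta> h (Suc k) x) (at x)"
  unfolding energy_deriv_def[abs_def]
  by (intro DERIV_add has_derivative_pspin_deriv has_derivative_entropy_deriv assms)

lemma higher_deriv_free_energy:
  assumes "0 < x" "x < 1"
  shows "(deriv ^^ k) (free_energy p \<beta> h) x = energy_deriv p \<beta> h k x"
  using higher_deriv_eq[of "{0<..<1}" "energy_deriv p \<beta> h" x k] has_derivative_energy_deriv assms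
  unfolding energy_deriv_0 by auto

lemma deriv_pspin: "deriv (pspin p \<beta> h) x = pspin_deriv p \<beta> h 1 x"
  using has_derivative_pspin_deriv[of p \<beta> h 0 x] by (simp add: pspin_deriv_0 DERIV_imp_deriv)

lemma free_energy_expansion:
  assumes a: "0 < a" "a < 1" and q: "0 < q" and z: "\<And>m. 0 < m \<Longrightarrow> m < q \<Longrightarrow> energy_deriv p \<beta> h m a = 0"
  shows "\<exists>\<delta>>0. \<exists>K\<ge>0. \<forall>u. \<bar>u\<bar> \<le> \<delta> \<longrightarrow>
    \<bar>free_energy p \<beta> h (a + u) - free_energy p \<beta> h a - energy_deriv p \<beta> h q a / fact q * u ^ q\<bar> \<le> K * \<bar>u\<bar> ^ (q + 1)"
proof -
  define \<delta> where "\<delta> = min a (1 - a) / 2"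
  have \<delta>: "0 < \<delta>" "\<delta> < a" "\<delta> < 1 - a" using a by (auto simp: \<delta>_def)
  have sub: "0 < x \<and> x < 1" if "\<bar>x - a\<bar> \<le> \<delta>" for x using that \<delta> by linarith
  have "\<exists>K\<ge>0. \<forall>u. \<bar>u\<bar> \<le> \<delta> \<longrightarrow> \<bar>energy_deriv p \<beta> h 0 (a + u)
      - (\<Sum>m<q + 1. energy_deriv p \<beta> h m a / fact m * u ^ m)\<bar> \<le> K * \<bar>u\<bar> ^ (q + 1)"
  proof (rule taylor_remainder_bound)
    show "continuous_on {a - \<delta>..a + \<delta>} (energy_deriv p \<beta> h (q + 1))"
    proof (intro continuous_at_imp_continuous_on ballI DERIV_isCont)
      fix x assume "x \<in> {a - \<delta>..a + \<delta>}"
      then have "\<bar>x - a\<bar> \<le> \<delta>" by auto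
      from sub[OF this] show "(energy_deriv p \<beta> h (q + 1) has_real_derivative energy_deriv p \<beta> h (Suc (q + 1)) x) (at x)"
        by (intro has_derivative_energy_deriv) auto
    qed
  qed (use \<delta> sub in \<open>auto intro: has_derivative_energy_deriv\<close>)
  moreover have "(\<Sum>m<q + 1. energy_deriv p \<beta> h m a / fact m * u ^ m)
      = free_energy p \<beta> h a + energy_deriv p \<beta> h q a / fact q * u ^ q" for u
  proof -
    have "(\<Sum>m<q + 1. energy_deriv p \<beta> h m a / fact m * u ^ m) = (\<Sum>m\<in>{0, q}. energy_deriv p \<beta> h m a / fact m * u ^ m)"
      using z by (intro sum.mono_neutral_right) auto
    then show ?thesis using q by (simp add: energy_deriv_0)
  qed
  ultimately have "\<exists>K\<ge>0. \<forall>u. \<bar>u\<bar> \<le> \<delta> \<longrightarrow>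
    \<bar>free_energy p \<beta> h (a + u) - free_energy p \<beta> h a - energy_deriv p \<beta> h q a / fact q * u ^ q\<bar> \<le> K * \<bar>u\<bar> ^ (q + 1)"
    unfolding energy_deriv_0 by (simp only: diff_diff_eq)
  then show ?thesis using \<delta>(1) by blast
qed

lemma pspin_expansion:
  "\<exists>K\<ge>0. \<forall>u. \<bar>u\<bar> \<le> 1 \<longrightarrow> \<bar>pspin p \<beta> h (a + u) - pspin p \<beta> h a - deriv (pspin p \<beta> h) a * u\<bar> \<le> K * u\<^sup>2"
proof -
  have "\<exists>K\<ge>0. \<forall>u. \<bar>u\<bar> \<le> 1 \<longrightarrow> \<bar>pspin_deriv p \<beta> h 0 (a + u)
      - (\<Sum>m<2. pspin_deriv p \<beta> h m a / fact m * u ^ m)\<bar> \<le> K * \<bar>u\<bar> ^ 2"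
    by (rule taylor_remainder_bound)
      (auto intro!: has_derivative_pspin_deriv continuous_at_imp_continuous_on DERIV_isCont)
  then show ?thesis unfolding pspin_deriv_0 deriv_pspin
    by (auto simp: lessThan_nat_numeral eval_nat_numeral pspin_deriv_0 diff_diff_eq ac_simps)
qed

section \<open>Derivatives at a maximizer and the gap away from the maximizers\<close>

lemma maximizers_le:
  assumes "a \<in> maximizers p \<beta> h" "0 \<le> x" "x \<le> 1"
  shows "free_energy p \<beta> h x \<le> free_energy p \<beta> h a"
  using assms by (auto simp: maximizers_def is_arg_max_def not_less)

lemma maximizer_deriv_eq_0:
  assumes "a \<in> maximizers p \<beta> h" "0 < a" "a < 1"
  shows "energy_deriv p \<beta> h 1 a = 0"
proof (rule DERIV_local_max)
  show "(free_energy p \<beta> h has_real_derivative energy_deriv p \<beta> h 1 a) (at a)"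
    using has_derivative_energy_deriv[OF assms(2,3), of p \<beta> h 0] by (simp add: energy_deriv_0)
  show "0 < min a (1 - a)" using assms by simp
  show "\<forall>y. \<bar>a - y\<bar> < min a (1 - a) \<longrightarrow> free_energy p \<beta> h y \<le> free_energy p \<beta> h a"
    using assms by (auto intro!: maximizers_le)
qed

text \<open>Near \<open>a\<close> the free energy changes by \<open>d u^3 + O(u^4)\<close>. The
  cubic term changes sign with \<open>u\<close>, so maximality at both \<open>a + u\<close> and
  \<open>a - u\<close> forces \<open>|d| \<le> K u\<close>, and \<open>u\<close> tends to
  \<open>0\<close>.\<close>

lemma maximizer_third_deriv_eq_0:
  assumes a: "a \<in> maximizers p \<beta> h" "0 < a" "a < 1" and d2: "energy_deriv p \<beta> h 2 a = 0"
  shows "energy_deriv p \<beta> h 3 a = 0"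
proof -
  have "energy_deriv p \<beta> h m a = 0" if "0 < m" "m < 3" for m
  proof -
    have "m = 1 \<or> m = 2" using that by auto
    then show ?thesis using maximizer_deriv_eq_0[OF a] d2 by auto
  qed
  then obtain \<delta> K where \<delta>: "0 < \<delta>" and K: "0 \<le> K"
    and ex: "\<And>u. \<bar>u\<bar> \<le> \<delta> \<Longrightarrow> \<bar>free_energy p \<beta> h (a + u) - free_energy p \<beta> h a
       - energy_deriv p \<beta> h 3 a / fact 3 * u ^ 3\<bar> \<le> K * \<bar>u\<bar> ^ (3 + 1)"
    using free_energy_expansion[OF a(2,3), of 3 p \<beta> h] by auto
  define d where "d = energy_deriv p \<beta> h 3 a / fact 3"
  have bound: "\<bar>d\<bar> \<le> K * u" if u: "0 < u" "u \<le> \<delta>" "u \<le> a" "u \<le> 1 - a" for u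
  proof -
    have "free_energy p \<beta> h (a + u) \<le> free_energy p \<beta> h a" "free_energy p \<beta> h (a + - u) \<le> free_energy p \<beta> h a"
      using a u by (auto intro!: maximizers_le)
    moreover have "\<bar>free_energy p \<beta> h (a + u) - free_energy p \<beta> h a - d * u ^ 3\<bar> \<le> K * u ^ 4"
      using ex[of u] u unfolding d_def by simp
    moreover have "\<bar>free_energy p \<beta> h (a + - u) - free_energy p \<beta> h a - d * (- u) ^ 3\<bar> \<le> K * u ^ 4"
      using ex[of "- u"] u unfolding d_def by simp
    moreover have "d * (- u) ^ 3 = - (d * u ^ 3)" by simp
    ultimately have "\<bar>d * u ^ 3\<bar> \<le> K * u ^ 4" by linarith
    then have "\<bar>d\<bar> * u ^ 3 \<le> (K * u) * u ^ 3" using u by (simp add: abs_mult power_numeral_reduce)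
    then show ?thesis using u by simp
  qed
  have "\<bar>d\<bar> \<le> 0"
  proof (rule tendsto_lowerbound)
    show "((\<lambda>u. K * u) \<longlongrightarrow> 0) (at_right 0)" by (rule tendsto_eq_intros refl)+ simp
    have "\<forall>\<^sub>F u in at_right 0. u \<in> {0<..<Min {\<delta>, a, 1 - a}}"
      using \<delta> a by (intro eventually_at_right_real) auto
    then show "\<forall>\<^sub>F u in at_right 0. \<bar>d\<bar> \<le> K * u" by eventually_elim (auto intro!: bound)
  qed simp
  then have "d = 0" by simp
  then show ?thesis by (simp add: d_def)
qed

text \<open>With \<open>m = 2 a - 1\<close> and \<open>v = 1 - m\<^sup>2\<close>, eliminating \<open>\<beta>\<close> from \<open>A\<^sup>(\<^sup>2\<^sup>) = A\<^sup>(\<^sup>3\<^sup>) = 0\<close> gives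
  \<open>2 m\<^sup>2 = (p - 2) v\<close>, and then \<open>A\<^sup>(\<^sup>4\<^sup>) v\<^sup>3 = - 64\<close> if \<open>m \<noteq> 0\<close>.\<close>

lemma fourth_deriv_neg:
  assumes p: "2 \<le> p" and a: "0 < a" "a < 1" and d2: "energy_deriv p \<beta> h 2 a = 0" and d3: "energy_deriv p \<beta> h 3 a = 0"
  shows "energy_deriv p \<beta> h 4 a < 0"
proof -
  define m where "m = 2 * a - 1"
  \<comment> \<open>From order two on the linear field term has disappeared, and \<open>P k\<close>
    is the whole energy part of the \<open>k\<close>-th derivative.\<close>
  define P where "P k = \<beta> * 2 ^ k * (\<Prod>i<k. real (p - i)) * m ^ (p - k)" for k
  define v where "v = 1 - m\<^sup>2"
  have v4: "v = 4 * a * (1 - a)" by (simp add: v_def m_def power2_eq_square algebra_simps)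
  have v: "0 < v" unfolding v4 using a by simp
  have ds: "energy_deriv p \<beta> h k a = P k + entropy_deriv k a" if "2 \<le> k" for k
    using that unfolding energy_deriv_def pspin_deriv_def P_def m_def by simp
  \<comment> \<open>The recurrence is kept multiplied by \<open>m\<close>, so that it survives
    \<open>m = 0\<close>; for \<open>k \<ge> p\<close> both sides vanish.\<close>
  have st: "m * P (Suc k) = 2 * real (p - k) * P k" for k
  proof (cases "k < p")
    case True
    then have "p - k = Suc (p - Suc k)" by simp
    then have "m ^ (p - k) = m * m ^ (p - Suc k)" by simp
    then show ?thesis unfolding P_def by simp
  qed (simp add: P_def)
  have e2: "entropy_deriv 2 a * v = - 4" 
    unfolding v4 using a by (simp add: eval_nat_numeral field_simps)
  have e3: "entropy_deriv 3 a * v\<^sup>2 = - 16 * m"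
  proof -
    define b where "b = 1 - a"
    have "entropy_deriv 3 a = inverse a ^ 2 - inverse b ^ 2"
      by (simp add: eval_nat_numeral b_def)
    moreover have "v ^ 2 = 16 * (a ^ 2 * b ^ 2)"
      unfolding v4 b_def by (simp add: power_mult_distrib mult.assoc)
    moreover have "inverse a ^ 2 * a ^ 2 = 1" "inverse b ^ 2 * b ^ 2 = 1"
      using a by (simp_all add: power_mult_distrib[symmetric] b_def)
    ultimately have "entropy_deriv 3 a * v ^ 2 = 16 * (b ^ 2 - a ^ 2)" by algebra
    then show ?thesis unfolding b_def m_def by (simp add: power2_eq_square algebra_simps)
  qed
  have e4: "entropy_deriv 4 a * v ^ 3 = - 32 * (1 + 3 * m\<^sup>2)"
  proof -
    define b where "b = 1 - a"
    have "entropy_deriv 4 a = - 2 * inverse a ^ 3 - 2 * inverse b ^ 3"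
      by (simp add: eval_nat_numeral b_def algebra_simps)
    moreover have "v ^ 3 = 64 * (a ^ 3 * b ^ 3)"
      unfolding v4 b_def by (simp add: power_mult_distrib mult.assoc)
    moreover have "inverse a ^ 3 * a ^ 3 = 1" "inverse b ^ 3 * b ^ 3 = 1"
      using a by (simp_all add: power_mult_distrib[symmetric] b_def)
    ultimately have "entropy_deriv 4 a * v ^ 3 = - 128 * (b ^ 3 + a ^ 3)" by algebra
    then show ?thesis unfolding b_def m_def by (simp add: power2_eq_square power3_eq_cube algebra_simps)
  qed
  have P2: "P 2 * v = 4" using e2 d2 ds[of 2] by (simp add: add_eq_0_iff)
  have P3: "P 3 * v\<^sup>2 = 16 * m" using e3 d3 ds[of 3] by (simp add: add_eq_0_iff)
  have s3: "m * P 3 = 2 * real (p - 2) * P 2" using st[of 2] by (simp add: eval_nat_numeral)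
  have s4: "m * P 4 = 2 * real (p - 3) * P 3" using st[of 3] by (simp add: eval_nat_numeral)
  have pm: "2 * m\<^sup>2 = real (p - 2) * v"
  proof -
    have "m * (P 3 * v\<^sup>2) = 2 * real (p - 2) * (P 2 * v) * v" using s3 by (simp add: power2_eq_square)
    then show ?thesis unfolding P2 P3 by (simp add: power2_eq_square)
  qed
  have "P 4 * v ^ 3 < 32 * (1 + 3 * m\<^sup>2)"
  \<comment> \<open>Division by \<open>m\<close> is impossible here, but \<open>pm\<close> then
    forces \<open>p = 2\<close>, and the fourth derivative of a quadratic energy is zero.\<close>
  proof (cases "m = 0")
    case True
    then have "real (p - 2) = 0" using pm v by simp
    then have "p = 2" using p by simp
    then have "P 4 = 0" unfolding P_def by (simp add: eval_nat_numeral)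
    then show ?thesis using True by simp
  next
    case False
    then have "real (p - 2) \<noteq> 0" using pm by auto
    \<comment> \<open>Truncated subtraction: \<open>p - 2\<close> is nonzero, hence \<open>p\<close>
      is at least \<open>3\<close> and the real identity holds.\<close>
    then have p3: "real (p - 3) = real (p - 2) - 1" by auto
    have "m * (P 4 * v ^ 3) = 2 * real (p - 3) * (P 3 * v\<^sup>2) * v" using s4 by (simp add: power2_eq_square power3_eq_cube)
    also have "\<dots> = m * (32 * (real (p - 3) * v))" unfolding P3 by simp
    finally have "P 4 * v ^ 3 = 32 * (real (p - 3) * v)" using False by simp
    also have "real (p - 3) * v = 3 * m\<^sup>2 - 1" unfolding p3 left_diff_distrib pm[symmetric] by (simp add: v_def)
    finally show ?thesis by simp
  qed
  then have "(P 4 + entropy_deriv 4 a) * v ^ 3 < 0" using e4 by (simp add: algebra_simps)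
  then show ?thesis using ds[of 4] v by (simp add: mult_less_0_iff)
qed

text \<open>At the endpoints continuity rests on \<open>x ln x\<close> tending to \<open>0\<close>,
  which agrees with the value that \<open>ln 0 = 0\<close> produces.\<close>

lemma continuous_on_free_energy: "continuous_on {0..1} (free_energy p \<beta> h)"
proof -
  have "continuous_on {0..1::real} (\<lambda>x. x * ln x)"
    unfolding continuous_on_def
  proof
    fix x :: real assume x: "x \<in> {0..1}"
    show "((\<lambda>x. x * ln x) \<longlongrightarrow> x * ln x) (at x within {0..1})"
    proof (cases "x = 0")
      case True
      have "((\<lambda>x::real. x * ln x) \<longlongrightarrow> 0) (at_right 0)" by real_asymp
      then have "((\<lambda>x::real. x * ln x) \<longlongrightarrow> 0) (at 0 within {0..1})"
        by (simp add: at_within_Icc_at_right)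
      then show ?thesis using True by simp
    next
      case False
      then show ?thesis using x by (auto intro!: tendsto_intros)
    qed
  qed
  note xlnx = this
  have "continuous_on {0..1::real} (\<lambda>x. (1 - x) * ln (1 - x))"
    by (rule continuous_on_compose2[OF xlnx, of "{0..1}" "\<lambda>x. 1 - x"]) (auto intro!: continuous_intros)
  then have "continuous_on {0..1} (\<lambda>a. - (a * ln a) - (1 - a) * ln (1 - a) :: real)"
    using xlnx by (intro continuous_on_diff continuous_on_minus)
  then have "continuous_on {0..1} (\<lambda>a. (\<beta> * (2 * a - 1) ^ p + h * (2 * a - 1)) + (- (a * ln a) - (1 - a) * ln (1 - a)))"
    by (rule continuous_on_add[rotated]) (intro continuous_intros)
  then show ?thesis unfolding free_energy_def[abs_def] pspin_def[abs_def] binary_entropy_def[abs_def]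
    by (simp add: mult_minus_left)
qed

text \<open>The points at distance at least \<open>\<delta>\<close> from every maximizer form a
  compact set without maximizers, so the supremum there is attained and lies strictly below the
  global maximum. If the set is empty, any gap will do.\<close>

lemma free_energy_gap:
  assumes ne: "a0 \<in> maximizers p \<beta> h" and d: "0 < \<delta>"
  shows "\<exists>\<eta>>0. \<forall>x. 0 \<le> x \<and> x \<le> 1 \<and> (\<forall>a\<in>maximizers p \<beta> h. \<delta> \<le> \<bar>x - a\<bar>) \<longrightarrow>
    free_energy p \<beta> h x \<le> free_energy p \<beta> h a0 - \<eta>"
proof -
  define S where "S = {0..1} \<inter> (\<Inter>a\<in>maximizers p \<beta> h. {x. \<delta> \<le> \<bar>x - a\<bar>})"
  have "closed {x::real. \<delta> \<le> \<bar>x - a\<bar>}" for a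
    by (intro closed_Collect_le continuous_intros)
  then have S: "compact S" unfolding S_def by (intro compact_Int_closed closed_INT) auto
  show ?thesis
  proof (cases "S = {}")
    case True
    then have "\<not> (0 \<le> x \<and> x \<le> 1 \<and> (\<forall>a\<in>maximizers p \<beta> h. \<delta> \<le> \<bar>x - a\<bar>))" for x
      unfolding S_def by auto
    then show ?thesis by (intro exI[of _ 1]) auto
  next
    case False
    have "continuous_on S (free_energy p \<beta> h)"
      by (rule continuous_on_subset[OF continuous_on_free_energy]) (auto simp: S_def)
    from continuous_attains_sup[OF S False this]
    obtain z where z: "z \<in> S" "\<And>x. x \<in> S \<Longrightarrow> free_energy p \<beta> h x \<le> free_energy p \<beta> h z" by blast
    have "z \<notin> maximizers p \<beta> h" using z(1) d unfolding S_def by force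
    then obtain y where y: "0 \<le> y" "y \<le> 1" "free_energy p \<beta> h z < free_energy p \<beta> h y"
      using z(1) unfolding maximizers_def is_arg_max_def S_def by auto
    have "free_energy p \<beta> h y \<le> free_energy p \<beta> h a0" using maximizers_le[OF ne y(1,2)] .
    then show ?thesis using y(3) z(2)
      by (intro exI[of _ "free_energy p \<beta> h a0 - free_energy p \<beta> h z"]) (auto simp: S_def)
  qed
qed

section \<open>Global tail bound and comparison in Wasserstein distance\<close>

lemma test_fun_one: "test_fun (\<lambda>_. 1)"
  by (auto simp: test_fun_def intro!: lipschitz_onI)

lemma test_fun_abs: "test_fun (\<lambda>x. 1 + \<bar>x\<bar>)"
  by (auto simp: test_fun_def dist_real_def intro!: lipschitz_onI)

lemma integrable_tilt: assumes "c < 0" "even q" "2 \<le> q" shows "integrable lborel (tilt q c b)"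
  using integrable_test_fun_tilt[OF assms test_fun_one] by simp

lemma integral_tilt_pos:
  assumes "c < 0" "even q" "2 \<le> q" shows "0 < (LBINT x. tilt q c b x)"
proof -
  have "(LBINT x. tilt q c b x) \<noteq> 0"
  proof
    assume "(LBINT x. tilt q c b x) = 0"
    then have "AE x in lborel. tilt q c b x = 0"
      using integral_nonneg_eq_0_iff_AE[OF integrable_tilt[OF assms]] tilt_pos by (simp add: less_imp_le)
    then have "AE x in (lborel :: real measure). False" by eventually_elim (use tilt_pos in \<open>auto simp: less_le\<close>)
    then have "emeasure lborel (UNIV :: real set) = 0" by (simp add: AE_iff_measurable[where N = UNIV])
    then show False by simp
  qed
  moreover have "0 \<le> (LBINT x. tilt q c b x)" using tilt_pos by (intro integral_nonneg_AE) (simp add: less_imp_le)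
  ultimately show ?thesis by simp
qed

lemma bweight_pos: "k \<le> n \<Longrightarrow> 0 < bweight f B s n k"
  by (simp add: bweight_def)

lemma bweight_nonneg: "0 \<le> bweight f B s n k"
  by (simp add: bweight_def)

lemma laplace_scale_pos: assumes "0 < a" "a < 1" "0 < n" shows "0 < laplace_scale f B a s n"
  using assms by (simp add: laplace_scale_def)

lemma finite_window [simp]: "finite (window a \<delta> n)"
  by (simp add: window_def)

lemma divide_le_half:
  fixes t :: real assumes "0 < t" "0 < I" "2 * C / I \<le> t" shows "C / t \<le> I / 2"
proof -
  have "2 * C \<le> t * I" using assms by (simp add: pos_divide_le_eq)
  then have "C \<le> I / 2 * t" by (simp add: mult.commute)
  then show ?thesis using assms(1) by (simp add: pos_divide_le_eq)
qed

lemma abs_pspin_le: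
  assumes "0 \<le> x" "x \<le> 1" shows "\<bar>pspin p \<beta> h x\<bar> \<le> \<bar>\<beta>\<bar> + \<bar>h\<bar>"
proof -
  have m: "\<bar>2 * x - 1\<bar> \<le> 1" using assms by auto
  then have "\<bar>2 * x - 1\<bar> ^ p \<le> 1" by (intro power_le_one) auto
  then have "\<bar>\<beta>\<bar> * \<bar>2 * x - 1\<bar> ^ p \<le> \<bar>\<beta>\<bar> * 1" by (rule mult_left_mono) simp
  moreover have "\<bar>h\<bar> * \<bar>2 * x - 1\<bar> \<le> \<bar>h\<bar> * 1" using m by (rule mult_left_mono) simp
  ultimately show ?thesis unfolding pspin_def
    by (intro order_trans[OF abs_triangle_ineq]) (auto simp: abs_mult power_abs)
qed

text \<open>Outside there are at most \<open>n + 1\<close> terms, each at most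
  \<open>exp (n (A - \<eta>) + sqrt n M)\<close>. A single window around one reference maximizer
  already bounds the partition function below by \<open>exp (n A - sqrt n M)\<close> up to a power
  of \<open>n\<close> and a constant. The perturbation costs only \<open>exp (O(sqrt n))\<close>,
  since \<open>t \<le> sqrt n\<close>, so the gap \<open>\<eta> n\<close> wins.\<close>

lemma outside_exponentially_small:
  fixes \<beta> h \<beta>' h' :: real and p q :: nat
  defines "f \<equiv> pspin p \<beta> h" and "B \<equiv> pspin p \<beta>' h'" and "t \<equiv> \<lambda>n. real n powr (1 / real q)"
  assumes a: "a \<in> maximizers p \<beta> h" "0 < a" "a < 1" and c: "c < 0" and q: "even q" "2 \<le> q"
    and L: "laplace_at q f B a c b \<delta>0" and d: "0 < \<delta>"
  shows "\<exists>c'>0. \<forall>\<^sub>F n in sequentially.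
    (\<Sum>k | k \<le> n \<and> (\<forall>a\<in>maximizers p \<beta> h. \<delta> < \<bar>real k / real n - a\<bar>). bweight f B (t n) n k)
      \<le> exp (- c' * real n) * (\<Sum>k\<le>n. bweight f B (t n) n k)"
proof -
  obtain \<eta> where \<eta>: "0 < \<eta>" and gap: "\<And>x. 0 \<le> x \<Longrightarrow> x \<le> 1 \<Longrightarrow> (\<forall>a\<in>maximizers p \<beta> h. \<delta> \<le> \<bar>x - a\<bar>) \<Longrightarrow>
    free_energy p \<beta> h x \<le> free_energy p \<beta> h a - \<eta>"
    using free_energy_gap[OF a(1) d] by blast
  obtain C where C: "0 < C" "\<And>n \<phi>. 0 < n \<Longrightarrow> test_fun \<phi> \<Longrightarrow>
     \<bar>rescaled_sum f B a (t n) n (window a \<delta>0 n) \<phi> - (LBINT x. \<phi> x * tilt q c b x)\<bar> \<le> C / t n"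
    using L unfolding laplace_at_def t_def by blast
  define I1 where "I1 = (LBINT x. tilt q c b x)"
  have I1: "0 < I1" unfolding I1_def by (rule integral_tilt_pos[OF c q])
  define M where "M = \<bar>\<beta>'\<bar> + \<bar>h'\<bar> + 1"
  have M: "0 < M" unfolding M_def by simp
  have BM: "\<bar>B x\<bar> \<le> M" if "0 \<le> x" "x \<le> 1" for x
    using abs_pspin_le[OF that, of p \<beta>' h'] unfolding B_def M_def by simp
  define A where "A = free_energy p \<beta> h a"
  have fA: "f x + binary_entropy x = free_energy p \<beta> h x" for x by (simp add: f_def free_energy_def)
  define \<kappa> where "\<kappa> = stirling_const"
  have tlim: "filterlim t at_top sequentially"
  proof -
    have "0 < 1 / real q" using q by simp
    then show ?thesis unfolding t_def by real_asymp
  qed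
  have small: "\<forall>\<^sub>F n in sequentially. C / t n \<le> I1 / 2"
  proof -
    have "\<forall>\<^sub>F n in sequentially. 2 * C / I1 \<le> t n" using tlim unfolding filterlim_at_top by blast
    then show ?thesis using eventually_gt_at_top[of 0]
    proof eventually_elim
      case (elim n)
      have "0 < t n" using elim unfolding t_def by simp
      then show ?case using elim I1 by (intro divide_le_half)
    qed
  qed
  \<comment> \<open>A quarter of the gap is spent on the polynomial factor and a quarter on the
    exponent of order \<open>sqrt n\<close>, which leaves \<open>\<eta> / 2\<close>.\<close>
  have asy: "\<forall>\<^sub>F n in sequentially. (real n + 1) * exp (- \<eta> * real n + 2 * sqrt (real n) * M + \<kappa>) * sqrt (real n) * (2 / I1)
      \<le> exp (- (\<eta> / 2) * real n)"
  proof -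
    have "\<forall>\<^sub>F n in sequentially. (real n + 1) * sqrt (real n) * (2 / I1) \<le> exp (\<eta> / 4 * real n)"
      using \<eta> I1 by real_asymp
    moreover have "\<forall>\<^sub>F n in sequentially. 2 * sqrt (real n) * M + \<kappa> \<le> \<eta> / 4 * real n"
      using \<eta> M by real_asymp
    ultimately show ?thesis
    proof eventually_elim
      case (elim n)
      have "(real n + 1) * exp (- \<eta> * real n + 2 * sqrt (real n) * M + \<kappa>) * sqrt (real n) * (2 / I1)
          = ((real n + 1) * sqrt (real n) * (2 / I1)) * exp (- \<eta> * real n + (2 * sqrt (real n) * M + \<kappa>))"
        by (simp only: add.assoc mult_ac)
      also have "\<dots> \<le> exp (\<eta> / 4 * real n) * exp (- \<eta> * real n + \<eta> / 4 * real n)"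
        using elim I1 by (intro mult_mono) auto
      also have "\<dots> = exp (- (\<eta> / 2) * real n)"
        unfolding exp_add[symmetric] by (rule arg_cong[where f = exp]) (simp add: algebra_simps)
      finally show ?case .
    qed
  qed
  show ?thesis
  proof (intro exI[of _ "\<eta> / 2"] conjI)
    show "\<forall>\<^sub>F n in sequentially.
      (\<Sum>k | k \<le> n \<and> (\<forall>a\<in>maximizers p \<beta> h. \<delta> < \<bar>real k / real n - a\<bar>). bweight f B (t n) n k)
        \<le> exp (- (\<eta> / 2) * real n) * (\<Sum>k\<le>n. bweight f B (t n) n k)"
      using small asy eventually_gt_at_top[of 0]
    proof eventually_elim
      case (elim n)
      note n = elim(3)
      define Z where "Z = (\<Sum>k\<le>n. bweight f B (t n) n k)"
      define S where "S = {k. k \<le> n \<and> (\<forall>a\<in>maximizers p \<beta> h. \<delta> < \<bar>real k / real n - a\<bar>)}"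
      have t1: "1 \<le> t n" "real n = t n ^ q" using root_rate[of n q] n q unfolding t_def by auto
      have ts: "t n \<le> sqrt (real n)"
      proof -
        have "t n ^ 2 \<le> t n ^ q" using t1 q by (intro power_increasing) auto
        then have "t n ^ 2 \<le> real n" using t1 by simp
        then show ?thesis by (simp add: real_le_rsqrt)
      qed
      let ?sc = "laplace_scale f B a (t n) n" and ?E = "exp (- \<eta> * real n + 2 * sqrt (real n) * M + \<kappa>)"
        and ?F = "exp (real n * (A - \<eta>) + sqrt (real n) * M)"
      have sc: "0 < ?sc" using a n by (intro laplace_scale_pos) auto
      define W where "W = (\<Sum>k\<in>window a \<delta>0 n. bweight f B (t n) n k)"
      have "rescaled_sum f B a (t n) n (window a \<delta>0 n) (\<lambda>_. 1) = t n / real n * (W / ?sc)"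
        unfolding rescaled_sum_def W_def by simp
      moreover have "(LBINT x. 1 * tilt q c b x) = I1" unfolding I1_def by simp
      \<comment> \<open>The constant test function turns the Laplace estimate into a lower bound for
        the mass of the window once its error is below half of the limit.\<close>
      ultimately have "I1 / 2 \<le> t n / real n * (W / ?sc)"
        using C(2)[OF n test_fun_one] elim(1) by linarith
      also have "\<dots> \<le> 1 * (W / ?sc)"
      proof (rule mult_right_mono)
        have "t n \<le> real n" using t1 q by (metis self_le_power gr0I not_numeral_le_zero)
        then show "t n / real n \<le> 1" using n by simp
      qed (use sc in \<open>auto simp: W_def intro!: sum_nonneg bweight_nonneg divide_nonneg_pos\<close>)
      also have "\<dots> = W / ?sc" by simp
      also have "\<dots> \<le> Z / ?sc"
        unfolding Z_def W_def using sc by (intro divide_right_mono sum_mono2) (auto simp: window_def bweight_nonneg)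
      finally have Z: "?sc \<le> (2 / I1) * Z" using sc I1 by (simp add: field_simps)
      have low: "exp (real n * A - sqrt (real n) * M - \<kappa>) \<le> ?sc * sqrt (real n)"
      proof -
        have "- B a \<le> M" using BM[of a] a by auto
        then have "t n * (- B a) \<le> t n * M" using t1 by (intro mult_left_mono) auto
        also have "\<dots> \<le> sqrt (real n) * M" using ts M by (intro mult_right_mono) auto
        finally have le1: "real n * A - sqrt (real n) * M - \<kappa> \<le> real n * A + t n * B a - \<kappa>" by simp
        have "real n * a * (1 - a) \<le> real n"
        proof -
          have "a * (1 - a) \<le> 1" using a by (intro mult_le_one) auto
          then have "real n * (a * (1 - a)) \<le> real n * 1" by (intro mult_left_mono) auto
          then show ?thesis by (simp add: mult.assoc)
        qed
        then have sq: "sqrt (real n * a * (1 - a)) \<le> sqrt (real n)" by simp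
        have sp: "0 < sqrt (real n * a * (1 - a))" using a n by simp
        have "exp (real n * A + t n * B a - \<kappa>) \<le> ?sc * sqrt (real n)"
        proof -
          have "exp (real n * A + t n * B a - \<kappa>) = ?sc * sqrt (real n * a * (1 - a))"
          proof -
            have "E = E / S * S" if "0 < S" for E S :: real using that by simp
            from this[OF sp] show ?thesis unfolding laplace_scale_def fA A_def \<kappa>_def .
          qed
          also have "\<dots> \<le> ?sc * sqrt (real n)"
            using sq sc by (intro mult_left_mono) auto
          finally show ?thesis .
        qed
        with le1 show ?thesis by (meson exp_le_cancel_iff order_trans)
      qed
      have "(\<Sum>k\<in>S. bweight f B (t n) n k) \<le> (\<Sum>k\<in>S. ?F)"
      proof (rule sum_mono)
        fix k assume k: "k \<in> S"
        define y where "y = real k / real n"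
        have y: "0 \<le> y" "y \<le> 1" "k \<le> n" using k n by (auto simp: S_def y_def)
        have "free_energy p \<beta> h y \<le> A - \<eta>"
          unfolding A_def using k y by (intro gap) (auto simp: S_def y_def less_imp_le)
        then have 1: "real n * (f y + binary_entropy y) \<le> real n * (A - \<eta>)"
          unfolding fA by (intro mult_left_mono) auto
        have "t n * B y \<le> t n * M" using BM[OF y(1,2)] t1 by (intro mult_left_mono) auto
        also have "\<dots> \<le> sqrt (real n) * M" using ts M by (intro mult_right_mono) auto
        finally have 2: "t n * B y \<le> sqrt (real n) * M" .
        have "bweight f B (t n) n k \<le> exp (real n * binary_entropy y) * exp (real n * f y + t n * B y)"
          unfolding bweight_def y_def by (intro mult_right_mono binomial_le_exp_entropy) (use y n in auto)
        also have "\<dots> = exp (real n * (f y + binary_entropy y) + t n * B y)"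
          unfolding exp_add[symmetric] by (simp add: algebra_simps)
        also have "\<dots> \<le> ?F" using 1 2 by simp
        finally show "bweight f B (t n) n k \<le> ?F" .
      qed
      also have "\<dots> = real (card S) * ?F" by simp
      also have "\<dots> \<le> (real n + 1) * ?F"
      proof (rule mult_right_mono)
        have "card S \<le> card {..n}" by (rule card_mono) (auto simp: S_def)
        then show "real (card S) \<le> real n + 1" by simp
      qed simp
      also have "?F =
          ?E * exp (real n * A - sqrt (real n) * M - \<kappa>)"
        unfolding exp_add[symmetric] by (simp add: algebra_simps)
      also have "(real n + 1) * \<dots> \<le> (real n + 1) * (?E *
          (?sc * sqrt (real n)))"
        by (intro mult_left_mono low) auto
      also have "\<dots> \<le> (real n + 1) * (?E * ((2 / I1 * Z) * sqrt (real n)))"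
        by (intro mult_left_mono mult_right_mono Z) auto
      also have "\<dots> = ((real n + 1) * ?E * sqrt (real n) * (2 / I1)) * Z"
        by (simp add: mult_ac)
      also have "\<dots> \<le> exp (- (\<eta> / 2) * real n) * Z"
        by (intro mult_right_mono elim(2)) (simp add: Z_def sum_nonneg bweight_nonneg)
      finally show ?case unfolding S_def Z_def .
    qed
  qed (use \<eta> in simp)
qed


text \<open>After normalising \<open>g\<close> to a test function \<open>\<phi>\<close>, both
  expectations are \<open>2\<close> times a ratio plus \<open>g 0\<close>, and the additive
  constants cancel. The ratios are compared through errors \<open>C / t n\<close> in numerator and
  denominator, with the denominator bounded below and \<open>I \<phi>\<close> bounded uniformly. The
  index sets \<open>S n\<close> are left general: all numbers of plus spins give the unconditional
  law, a window gives the conditional one.\<close>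

lemma wasserstein_from_ratio:
  fixes t :: "nat \<Rightarrow> real" and w sc :: "nat \<Rightarrow> nat \<Rightarrow> real"
  assumes c: "c < 0" "even q" "2 \<le> q" and C: "0 < C"
    and t: "filterlim t at_top sequentially"
    and approx: "\<forall>\<^sub>F n in sequentially. \<forall>\<phi>. test_fun \<phi> \<longrightarrow>
       \<bar>s n * (\<Sum>k\<in>S n. \<phi> (t n * (real k / real n - a)) * w n k) - (LBINT x. \<phi> x * tilt q c b x)\<bar> \<le> C / t n"
    and \<mu>: "\<forall>\<^sub>F n in sequentially. \<forall>g. 1-lipschitz_on UNIV g \<longrightarrow> integral\<^sup>L (\<mu> n) g =
       (\<Sum>k\<in>S n. g (2 * (t n * (real k / real n - a))) * w n k) / (\<Sum>k\<in>S n. w n k)"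
    and \<nu>: "\<And>g. 1-lipschitz_on UNIV g \<Longrightarrow> integral\<^sup>L \<nu> g =
       (LBINT x. g (2 * x) * tilt q c b x) / (LBINT x. tilt q c b x)"
  shows "\<exists>C'. \<forall>\<^sub>F n in sequentially. wasserstein (\<mu> n) \<nu> \<le> ennreal (C' / t n)"
proof -
  define I where "I \<phi> = (LBINT x. \<phi> x * tilt q c b x)" for \<phi>
  define I1 where "I1 = (LBINT x. tilt q c b x)"
  have I1: "0 < I1" unfolding I1_def by (rule integral_tilt_pos[OF c])
  define Ia where "Ia = I (\<lambda>x. 1 + \<bar>x\<bar>)"
  have Ibound: "\<bar>I \<phi>\<bar> \<le> Ia" if "test_fun \<phi>" for \<phi>
  proof -
    have "\<bar>I \<phi>\<bar> \<le> (LBINT x. \<bar>\<phi> x * tilt q c b x\<bar>)" unfolding I_def by (rule integral_abs_bound)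
    also have "\<dots> \<le> Ia" unfolding Ia_def I_def
    proof (intro integral_mono integrable_abs integrable_test_fun_tilt c that test_fun_abs)
      fix x :: real
      have "\<bar>\<phi> x\<bar> * tilt q c b x \<le> (1 + \<bar>x\<bar>) * tilt q c b x"
        by (rule mult_right_mono[OF test_funD(2)[OF that] less_imp_le[OF tilt_pos]])
      then show "\<bar>\<phi> x * tilt q c b x\<bar> \<le> (1 + \<bar>x\<bar>) * tilt q c b x"
        using tilt_pos[of q c b x] by (simp add: abs_mult)
    qed
    finally show ?thesis .
  qed
  have Ia: "0 \<le> Ia" using Ibound[OF test_fun_one] by linarith
  \<comment> \<open>The \<open>4\<close> is \<open>2\<close> from
    \<open>g (2 * x) = 2 * \<phi> x + g 0\<close> times \<open>2\<close> from the lower bound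
    \<open>I1 / 2\<close> for the denominator.\<close>
  define C' where "C' = 4 * C * (I1 + Ia) / I1\<^sup>2"
  have tpos: "\<forall>\<^sub>F n in sequentially. max 1 (2 * C / I1) \<le> t n" using t unfolding filterlim_at_top by blast
  show ?thesis
  proof (intro exI[of _ C'])
    show "\<forall>\<^sub>F n in sequentially. wasserstein (\<mu> n) \<nu> \<le> ennreal (C' / t n)"
      using approx \<mu> tpos
    proof eventually_elim
      case (elim n)
      have t0: "0 < t n" "2 * C / I1 \<le> t n" using elim(3) by auto
      define N where "N \<phi> = s n * (\<Sum>k\<in>S n. \<phi> (t n * (real k / real n - a)) * w n k)" for \<phi> :: "real \<Rightarrow> real"
      define W where "W = (\<Sum>k\<in>S n. w n k)"
      have NI: "\<bar>N \<phi> - I \<phi>\<bar> \<le> C / t n" if "test_fun \<phi>" for \<phi> using elim(1) that unfolding N_def I_def by blast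
      define N1 where "N1 = s n * W"
      have N1: "\<bar>N1 - I1\<bar> \<le> C / t n" using NI[OF test_fun_one] unfolding N1_def I1_def N_def I_def W_def by simp
      have "C / t n \<le> I1 / 2" using t0 I1 by (intro divide_le_half)
      then have N1h: "I1 / 2 \<le> N1" using N1 by linarith
      then have N1p: "0 < N1" using I1 by linarith
      then have sW: "s n \<noteq> 0" "W \<noteq> 0" unfolding N1_def by auto
      show "wasserstein (\<mu> n) \<nu> \<le> ennreal (C' / t n)"
        unfolding wasserstein_def
      proof (intro SUP_least ennreal_leI)
        fix g :: "real \<Rightarrow> real" assume "g \<in> {g. 1-lipschitz_on UNIV g}"
        then have g: "1-lipschitz_on UNIV g" by simp
        have gl: "\<bar>g x - g y\<bar> \<le> \<bar>x - y\<bar>" for x y using lipschitz_onD[OF g, of x y] by (simp add: dist_real_def)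
        \<comment> \<open>Halving restores the Lipschitz constant that the argument
          \<open>2 * x\<close> doubles, and subtracting \<open>g 0\<close> gives the linear growth
          bound.\<close>
        define \<phi> where "\<phi> x = (g (2 * x) - g 0) / 2" for x
        have \<phi>: "test_fun \<phi>" unfolding test_fun_def
        proof (intro conjI allI lipschitz_onI)
          fix x y :: real
          show "dist (\<phi> x) (\<phi> y) \<le> 1 * dist x y"
          proof -
            have "\<phi> x - \<phi> y = (g (2 * x) - g (2 * y)) / 2" by (simp add: \<phi>_def diff_divide_distrib)
            from arg_cong[OF this, of "\<lambda>z. 2 * \<bar>z\<bar>"]
            have "2 * \<bar>\<phi> x - \<phi> y\<bar> = \<bar>g (2 * x) - g (2 * y)\<bar>" by simp
            moreover have "\<bar>2 * x - 2 * y\<bar> = 2 * \<bar>x - y\<bar>"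
              unfolding right_diff_distrib[symmetric] abs_mult by simp
            ultimately have "2 * \<bar>\<phi> x - \<phi> y\<bar> \<le> 2 * \<bar>x - y\<bar>" using gl[of "2 * x" "2 * y"] by (simp only:)
            then show ?thesis unfolding dist_real_def by simp
          qed
          show "\<bar>\<phi> x\<bar> \<le> 1 + \<bar>x\<bar>" 
          proof -
            have "2 * \<bar>\<phi> x\<bar> = \<bar>g (2 * x) - g 0\<bar>" by (simp add: \<phi>_def)
            then show ?thesis using gl[of "2 * x" 0] by linarith
          qed
        qed simp
        have g\<phi>: "g (2 * x) = 2 * \<phi> x + g 0" for x by (simp add: \<phi>_def diff_divide_distrib)
        have m: "integral\<^sup>L (\<mu> n) g = 2 * (N \<phi> / N1) + g 0"
        proof -
          have "(\<Sum>k\<in>S n. g (2 * (t n * (real k / real n - a))) * w n k)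
              = 2 * (\<Sum>k\<in>S n. \<phi> (t n * (real k / real n - a)) * w n k) + g 0 * W"
            unfolding g\<phi> W_def by (simp add: distrib_right sum.distrib sum_distrib_left mult.assoc)
          moreover have "N \<phi> / N1 = (\<Sum>k\<in>S n. \<phi> (t n * (real k / real n - a)) * w n k) / W"
            using sW unfolding N_def N1_def by simp
          ultimately show ?thesis using elim(2) g sW unfolding W_def[symmetric] by (simp add: add_divide_distrib)
        qed
        have v: "integral\<^sup>L \<nu> g = 2 * (I \<phi> / I1) + g 0"
        proof -
          have "(LBINT x. g (2 * x) * tilt q c b x) = (LBINT x. 2 * (\<phi> x * tilt q c b x) + g 0 * tilt q c b x)"
            unfolding g\<phi> by (simp add: distrib_right mult.assoc)
          also have "\<dots> = 2 * I \<phi> + g 0 * I1" unfolding I_def I1_def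
            using integrable_test_fun_tilt[OF c \<phi>] integrable_tilt[OF c] by simp
          finally show ?thesis using \<nu>[OF g] I1 unfolding I1_def[symmetric] by (simp add: add_divide_distrib)
        qed
        have "\<bar>integral\<^sup>L (\<mu> n) g - integral\<^sup>L \<nu> g\<bar> = 2 * \<bar>N \<phi> / N1 - I \<phi> / I1\<bar>"
        proof -
          have "\<bar>(2 * y + z) - (2 * y' + z)\<bar> = 2 * \<bar>y - y'\<bar>" for y y' z :: real
          proof -
            have "(2 * y + z) - (2 * y' + z) = 2 * (y - y')" by simp
            then show ?thesis by (simp only: abs_mult abs_numeral)
          qed
          then show ?thesis unfolding m v .
        qed
        also have "N \<phi> / N1 - I \<phi> / I1 = ((N \<phi> - I \<phi>) * I1 + I \<phi> * (I1 - N1)) / (N1 * I1)"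
          using N1p I1 by (simp add: field_simps)
        also have "\<bar>\<dots>\<bar> = \<bar>(N \<phi> - I \<phi>) * I1 + I \<phi> * (I1 - N1)\<bar> / (N1 * I1)"
          using N1p I1 by (simp add: abs_mult)
        also have "\<dots> \<le> ((C / t n) * I1 + Ia * (C / t n)) / (I1 / 2 * I1)"
        proof (rule frac_le)
          have "\<bar>(N \<phi> - I \<phi>) * I1\<bar> \<le> (C / t n) * I1"
            unfolding abs_mult using NI[OF \<phi>] I1 by (intro mult_mono) auto
          moreover have "\<bar>I \<phi> * (I1 - N1)\<bar> \<le> Ia * (C / t n)"
            unfolding abs_mult using N1 Ibound[OF \<phi>] Ia by (intro mult_mono) (auto simp: abs_minus_commute)
          ultimately show "\<bar>(N \<phi> - I \<phi>) * I1 + I \<phi> * (I1 - N1)\<bar> \<le> (C / t n) * I1 + Ia * (C / t n)"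
            by linarith
          show "0 \<le> (C / t n) * I1 + Ia * (C / t n)" using C t0 I1 Ia by (intro add_nonneg_nonneg mult_nonneg_nonneg) auto
          show "0 < I1 / 2 * I1" using I1 by simp
          show "I1 / 2 * I1 \<le> N1 * I1" using N1h I1 by (intro mult_right_mono) auto
        qed
        also have "2 * \<dots> = C' / t n" unfolding C'_def using I1 t0 by (simp add: field_simps power2_eq_square)
        finally show "\<bar>integral\<^sup>L (\<mu> n) g - integral\<^sup>L \<nu> g\<bar> \<le> C' / t n" by simp
      qed
    qed
  qed
qed

text \<open>Substituting \<open>2 * x\<close> turns the density into a multiple of the tilt. The
  multiple is identified from the total mass being one, so the integral of the tilt never has to be
  evaluated.\<close>

lemma integral_scaled_density:
  fixes D :: "real \<Rightarrow> real"
  assumes c: "c < 0" "even q" "2 \<le> q" and D: "\<And>x. D (2 * x) = r * tilt q c b x" and r: "0 < r"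
    and one: "(LBINT x. D x) = 1" and meas: "D \<in> borel_measurable borel" and g: "1-lipschitz_on UNIV g"
  shows "integral\<^sup>L (density lborel (\<lambda>x. ennreal (D x))) g = (LBINT x. g (2 * x) * tilt q c b x) / (LBINT x. tilt q c b x)"
proof -
  have gm: "g \<in> borel_measurable borel"
    using g by (intro borel_measurable_continuous_onI lipschitz_on_continuous_on)
  have D0: "0 \<le> D x" for x using D[of "x / 2"] r tilt_pos[of q c b "x / 2"] by simp
  have "integral\<^sup>L (density lborel (\<lambda>x. ennreal (D x))) g = (LBINT x. D x * g x)"
    using gm meas D0 by (subst integral_density) auto
  also have "\<dots> = 2 * (LBINT x. D (2 * x) * g (2 * x))"
    using lborel_integral_real_affine[of 2 "\<lambda>x. D x * g x" 0] by simp
  also have "\<dots> = (2 * r) * (LBINT x. g (2 * x) * tilt q c b x)" unfolding D by (simp add: mult_ac)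
  finally have 1: "integral\<^sup>L (density lborel (\<lambda>x. ennreal (D x))) g = (2 * r) * (LBINT x. g (2 * x) * tilt q c b x)" .
  have "1 = 2 * (LBINT x. D (2 * x))"
    using lborel_integral_real_affine[of 2 D 0] one by simp
  also have "\<dots> = (2 * r) * (LBINT x. tilt q c b x)" unfolding D by simp
  finally have "2 * r = 1 / (LBINT x. tilt q c b x)"
    using integral_tilt_pos[OF c, of b] by (simp add: field_simps)
  then show ?thesis unfolding 1 by simp
qed

text \<open>Completing the square in \<open>A/2 x^2 + b x\<close> gives mean \<open>b/|A|\<close>
  and variance \<open>1/|A|\<close>; doubling the variable gives the stated parameters. The leftover
  constant is \<open>exp (b^2 / (2 A))\<close>.\<close>

lemma integral_normal_law:
  assumes A: "A < 0" and g: "1-lipschitz_on UNIV g"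
  shows "integral\<^sup>L (normal_law (2 * b / \<bar>A\<bar>) (4 / \<bar>A\<bar>)) g =
    (LBINT x. g (2 * x) * tilt 2 (A / 2) b x) / (LBINT x. tilt 2 (A / 2) b x)"
  unfolding normal_law_def
proof (rule integral_scaled_density)
  let ?s = "sqrt (4 / \<bar>A\<bar>)"
  have s: "0 < ?s" using A by simp
  show "0 < 1 / sqrt (2 * pi * ?s\<^sup>2) * exp (b\<^sup>2 / (2 * A))" using s by (simp add: real_sqrt_gt_0_iff)
  show "(LBINT x. normal_density (2 * b / \<bar>A\<bar>) ?s x) = 1" by (rule integral_normal_density[OF s])
  show "normal_density (2 * b / \<bar>A\<bar>) ?s (2 * x) = 1 / sqrt (2 * pi * ?s\<^sup>2) * exp (b\<^sup>2 / (2 * A)) * tilt 2 (A / 2) b x" for x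
  proof -
    have "- (2 * x - 2 * b / \<bar>A\<bar>)\<^sup>2 / (2 * ?s\<^sup>2) = b\<^sup>2 / (2 * A) + (A / 2 * x\<^sup>2 + b * x)"
      using A by (simp add: field_simps power2_eq_square)
    then show ?thesis unfolding normal_density_def tilt_def mult.assoc exp_add[symmetric] by simp
  qed
qed (use A g in auto)

text \<open>The denominators \<open>16\<close> and \<open>2\<close> in the density are those that
  \<open>y = 2 x\<close> removes, which leaves \<open>c x^4 + b x\<close>.\<close>

lemma integral_quartic_law:
  assumes c: "c < 0" and g: "1-lipschitz_on UNIV g"
  shows "integral\<^sup>L (quartic_law c b) g = (LBINT x. g (2 * x) * tilt 4 c b x) / (LBINT x. tilt 4 c b x)"
  unfolding quartic_law_def
proof (rule integral_scaled_density)
  let ?D = "\<lambda>y. exp (c * y ^ 4 / 16 + b * y / 2)"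
  have D2: "?D (2 * x) = tilt 4 c b x" for x by (simp add: tilt_def power_mult_distrib)
  have "(LBINT y. ?D y) = 2 * (LBINT x. ?D (2 * x))"
    using lborel_integral_real_affine[of 2 ?D 0] by simp
  then have Z: "0 < (LBINT y. ?D y)" unfolding D2 using integral_tilt_pos[OF c, of 4 b] by simp
  show "0 < 1 / (LBINT y. ?D y)" using Z by simp
  show "(LBINT x. ?D x / (LBINT y. ?D y)) = 1" using Z by simp
  show "?D (2 * x) / (LBINT y. ?D y) = 1 / (LBINT y. ?D y) * tilt 4 c b x" for x unfolding D2 by simp
qed (use c g in auto)

section \<open>Sums over all configurations and weights of the modes\<close>

lemma laplace_at_maximizer:
  assumes a: "0 < a" "a < 1" and q: "even q" "2 \<le> q"
    and z: "\<And>m. 0 < m \<Longrightarrow> m < q \<Longrightarrow> energy_deriv p \<beta> h m a = 0" and neg: "energy_deriv p \<beta> h q a < 0"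
  shows "\<exists>\<delta>1>0. \<forall>\<delta>. 0 < \<delta> \<and> \<delta> \<le> \<delta>1 \<longrightarrow> laplace_at q (pspin p \<beta> h) (pspin p \<beta>' h') a
    (energy_deriv p \<beta> h q a / fact q) (deriv (pspin p \<beta>' h') a) \<delta>"
proof -
  obtain \<delta>A KA where A: "0 < \<delta>A" "0 \<le> KA" "\<And>u. \<bar>u\<bar> \<le> \<delta>A \<Longrightarrow>
    \<bar>free_energy p \<beta> h (a + u) - free_energy p \<beta> h a - energy_deriv p \<beta> h q a / fact q * u ^ q\<bar> \<le> KA * \<bar>u\<bar> ^ (q + 1)"
    using free_energy_expansion[OF a _ z] q by (metis gr0I not_numeral_le_zero)
  obtain KB where B: "0 \<le> KB" "\<And>u. \<bar>u\<bar> \<le> 1 \<Longrightarrow>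
    \<bar>pspin p \<beta>' h' (a + u) - pspin p \<beta>' h' a - deriv (pspin p \<beta>' h') a * u\<bar> \<le> KB * u\<^sup>2"
    using pspin_expansion by blast
  show ?thesis
  proof (rule local_laplace[where ?\<delta>0.0 = "min \<delta>A 1" and K = "max KA KB"])
    show "energy_deriv p \<beta> h q a / fact q < 0" using neg by (simp add: divide_neg_pos)
    fix u assume u: "\<bar>u\<bar> \<le> min \<delta>A 1"
    have "KA * \<bar>u\<bar> ^ (q + 1) \<le> max KA KB * \<bar>u\<bar> ^ (q + 1)" by (intro mult_right_mono) auto
    then show "\<bar>pspin p \<beta> h (a + u) + binary_entropy (a + u) - (pspin p \<beta> h a + binary_entropy a)
        - energy_deriv p \<beta> h q a / fact q * u ^ q\<bar> \<le> max KA KB * \<bar>u\<bar> ^ (q + 1)"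
      using A(3)[of u] u unfolding free_energy_def by simp
    have "KB * u\<^sup>2 \<le> max KA KB * u\<^sup>2" by (intro mult_right_mono) auto
    then show "\<bar>pspin p \<beta>' h' (a + u) - pspin p \<beta>' h' a - deriv (pspin p \<beta>' h') a * u\<bar> \<le> max KA KB * u\<^sup>2"
      using B(2)[of u] u by simp
  qed (use a q A B in auto)
qed

text \<open>A test function is at most \<open>2 * t n\<close> at every grid point, so the
  exponentially small mass outside the window contributes less than \<open>1 / t n\<close> up to a
  constant.\<close>

lemma full_sum_approx:
  fixes \<beta> h \<beta>' h' :: real and p q :: nat
  defines "f \<equiv> pspin p \<beta> h" and "B \<equiv> pspin p \<beta>' h'" and "t \<equiv> \<lambda>n. real n powr (1 / real q)"
  assumes a: "maximizers p \<beta> h = {a}" "0 < a" "a < 1" and c: "c < 0" and q: "even q" "2 \<le> q"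
    and L: "laplace_at q f B a c b \<delta>" and d: "0 < \<delta>"
  shows "\<exists>C>0. \<forall>\<^sub>F n in sequentially. \<forall>\<phi>. test_fun \<phi> \<longrightarrow>
    \<bar>rescaled_sum f B a (t n) n {..n} \<phi> - (LBINT x. \<phi> x * tilt q c b x)\<bar> \<le> C / t n"
proof -
  have q0: "0 < q" using q by simp
  obtain C where C: "0 < C" and win: "\<And>n \<phi>. 0 < n \<Longrightarrow> test_fun \<phi> \<Longrightarrow>
    \<bar>rescaled_sum f B a (t n) n (window a \<delta> n) \<phi> - (LBINT x. \<phi> x * tilt q c b x)\<bar> \<le> C / t n"
    using L unfolding laplace_at_def t_def by blast
  define I1 where "I1 = (LBINT x. tilt q c b x)"
  have I1: "0 < I1" unfolding I1_def by (rule integral_tilt_pos[OF c q])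
  have am: "a \<in> maximizers p \<beta> h" using a(1) by simp
  have "\<exists>c'>0. \<forall>\<^sub>F n in sequentially.
    (\<Sum>k | k \<le> n \<and> (\<forall>x\<in>{a}. \<delta> < \<bar>real k / real n - x\<bar>). bweight f B (t n) n k)
      \<le> exp (- c' * real n) * (\<Sum>k\<le>n. bweight f B (t n) n k)"
    unfolding f_def B_def t_def
    using outside_exponentially_small[OF am a(2,3) c q L[unfolded f_def B_def] d, unfolded a(1)] .
  then obtain c' where c': "0 < c'" and out: "\<forall>\<^sub>F n in sequentially.
    (\<Sum>k | k \<le> n \<and> (\<forall>x\<in>{a}. \<delta> < \<bar>real k / real n - x\<bar>). bweight f B (t n) n k)
      \<le> exp (- c' * real n) * (\<Sum>k\<le>n. bweight f B (t n) n k)"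
    by (elim exE conjE) (rule that)
  have e1: "\<forall>\<^sub>F n in sequentially. exp (- c' * real n) \<le> 1 / 2" using c' by real_asymp
  \<comment> \<open>Since \<open>t n * t n \<le> n\<close>, this absorbs two factors
    \<open>t n\<close>: one from the size of the test function and one to leave the rate
    \<open>1 / t n\<close>.\<close>
  have e2: "\<forall>\<^sub>F n in sequentially. real n * exp (- c' * real n) \<le> 1" using c' by real_asymp
  define C' where "C' = C + 4 * (I1 + C)"
  show ?thesis
  proof (intro exI[of _ C'] conjI)
    show "\<forall>\<^sub>F n in sequentially. \<forall>\<phi>. test_fun \<phi> \<longrightarrow>
      \<bar>rescaled_sum f B a (t n) n {..n} \<phi> - (LBINT x. \<phi> x * tilt q c b x)\<bar> \<le> C' / t n"
      using out e1 e2 eventually_gt_at_top[of 0]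
    proof eventually_elim
      case (elim n)
      note n = elim(4)
      show ?case
      proof (intro allI impI)
        fix \<phi> :: "real \<Rightarrow> real" assume \<phi>: "test_fun \<phi>"
        define Oc where "Oc = {k. k \<le> n \<and> (\<forall>x\<in>{a}. \<delta> < \<bar>real k / real n - x\<bar>)}"
        define w where "w k = bweight f B (t n) n k" for k
        define s where "s = t n / (real n * laplace_scale f B a (t n) n)"
        define \<psi> where "\<psi> k = \<phi> (t n * (real k / real n - a))" for k
        have t1: "1 \<le> t n" "real n = t n ^ q" using root_rate[OF n q0] unfolding t_def by auto
        have tt: "t n * t n \<le> real n"
        proof -
          have "t n ^ 2 \<le> t n ^ q" using t1 q by (intro power_increasing) auto
          then show ?thesis using t1 by (simp add: power2_eq_square)
        qed
        have w: "0 \<le> w k" for k unfolding w_def by (rule bweight_nonneg)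
        have s: "0 < s" unfolding s_def using n t1 a by (intro divide_pos_pos mult_pos_pos laplace_scale_pos) auto
        have split: "sum g {..n} = sum g (window a \<delta> n) + sum g Oc" for g :: "nat \<Rightarrow> real"
          by (subst sum.union_disjoint[symmetric]) (auto simp: Oc_def window_def not_less intro!: sum.cong)
        have W: "s * sum w (window a \<delta> n) \<le> I1 + C"
        proof -
          have "s * sum w (window a \<delta> n) \<le> I1 + C / t n"
            using win[OF n test_fun_one] unfolding rescaled_sum_def s_def w_def I1_def by simp
          also have "C / t n \<le> C" using C t1 by (simp add: divide_le_eq)
          finally show ?thesis by simp
        qed
        have oz: "sum w Oc \<le> exp (- c' * real n) * sum w {..n}" using elim(1) unfolding Oc_def w_def by simp
        \<comment> \<open>The outside bound is relative to the whole sum. As it is at most half of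
          it, the whole sum is at most twice the window sum, whose size is known.\<close>
        also have "\<dots> \<le> 1 / 2 * sum w {..n}" using elim(2) w by (intro mult_right_mono sum_nonneg) auto
        finally have "sum w {..n} \<le> 2 * sum w (window a \<delta> n)" unfolding split by simp
        then have "sum w Oc \<le> exp (- c' * real n) * (2 * sum w (window a \<delta> n))"
          using oz by (meson exp_ge_zero mult_left_mono order_trans)
        then have "s * sum w Oc \<le> s * (exp (- c' * real n) * (2 * sum w (window a \<delta> n)))"
          using s by (intro mult_left_mono) auto
        also have "\<dots> = 2 * exp (- c' * real n) * (s * sum w (window a \<delta> n))" by simp
        also have "\<dots> \<le> 2 * exp (- c' * real n) * (I1 + C)" by (intro mult_left_mono W) auto
        finally have sOc: "s * sum w Oc \<le> 2 * exp (- c' * real n) * (I1 + C)" .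
        have "\<bar>s * (\<Sum>k\<in>Oc. \<psi> k * w k)\<bar> = s * \<bar>\<Sum>k\<in>Oc. \<psi> k * w k\<bar>" using s by (simp add: abs_mult)
        also have "\<dots> \<le> s * (\<Sum>k\<in>Oc. 2 * t n * w k)"
        proof (intro mult_left_mono order_trans[OF sum_abs] sum_mono)
          fix k assume k: "k \<in> Oc"
          have "\<bar>real k / real n - a\<bar> \<le> 1"
          proof -
            have "0 \<le> real k / real n" "real k / real n \<le> 1" using k n by (auto simp: Oc_def)
            moreover have "\<bar>y - a\<bar> \<le> 1" if "0 \<le> y" "y \<le> 1" for y using that a by linarith
            ultimately show ?thesis by blast
          qed
          then have "t n * \<bar>real k / real n - a\<bar> \<le> t n * 1" using t1 by (intro mult_left_mono) auto
          moreover have "\<bar>t n * (real k / real n - a)\<bar> = t n * \<bar>real k / real n - a\<bar>"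
            using t1(1) by (simp add: abs_mult)
          ultimately have "\<bar>\<psi> k\<bar> \<le> 2 * t n"
            using test_funD(2)[OF \<phi>, of "t n * (real k / real n - a)"] t1(1) unfolding \<psi>_def by linarith
          then show "\<bar>\<psi> k * w k\<bar> \<le> 2 * t n * w k" using w[of k] by (simp add: abs_mult mult_right_mono)
        qed (use s in auto)
        also have "\<dots> = 2 * t n * (s * sum w Oc)" by (simp add: sum_distrib_left mult_ac)
        also have "\<dots> \<le> 2 * t n * (2 * exp (- c' * real n) * (I1 + C))" using t1 by (intro mult_left_mono sOc) auto
        also have "\<dots> = 4 * (I1 + C) * ((t n * t n) * exp (- c' * real n)) / t n" using t1 by simp
        also have "\<dots> \<le> 4 * (I1 + C) * 1 / t n"
        proof -
          have "(t n * t n) * exp (- c' * real n) \<le> real n * exp (- c' * real n)" using tt by (intro mult_right_mono) auto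
          also have "\<dots> \<le> 1" by (rule elim(3))
          finally show ?thesis using t1 I1 C by (intro divide_right_mono mult_left_mono) auto
        qed
        finally have Oc: "\<bar>s * (\<Sum>k\<in>Oc. \<psi> k * w k)\<bar> \<le> 4 * (I1 + C) / t n" by simp
        have "s * (\<Sum>k\<in>{..n}. \<psi> k * w k) = s * (\<Sum>k\<in>window a \<delta> n. \<psi> k * w k) + s * (\<Sum>k\<in>Oc. \<psi> k * w k)"
          unfolding split by (simp add: distrib_left)
        moreover have "\<bar>s * (\<Sum>k\<in>window a \<delta> n. \<psi> k * w k) - (LBINT x. \<phi> x * tilt q c b x)\<bar> \<le> C / t n"
          using win[OF n \<phi>] unfolding rescaled_sum_def s_def \<psi>_def w_def .
        moreover have "C' / t n = C / t n + 4 * (I1 + C) / t n" unfolding C'_def by (simp add: add_divide_distrib)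
        ultimately have "\<bar>s * (\<Sum>k\<in>{..n}. \<psi> k * w k) - (LBINT x. \<phi> x * tilt q c b x)\<bar> \<le> C' / t n"
          using Oc by linarith
        then show "\<bar>rescaled_sum f B a (t n) n {..n} \<phi> - (LBINT x. \<phi> x * tilt q c b x)\<bar> \<le> C' / t n"
          unfolding rescaled_sum_def s_def \<psi>_def w_def .
      qed
    qed
  qed (use C I1 in \<open>simp add: C'_def add_pos_pos\<close>)
qed

section \<open>Laws of the magnetization as weighted sums\<close>

lemma lipschitz_measurable:
  fixes g :: "real \<Rightarrow> real" assumes "1-lipschitz_on UNIV g" shows "g \<in> borel_measurable borel"
  using assms by (intro borel_measurable_continuous_onI lipschitz_on_continuous_on)

lemma magnetization_scaled:
  assumes "\<omega> \<in> configs n" "0 < n" "0 < t" "r = real n / t"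
  shows "(magnetization n \<omega> - real n * (2 * a - 1)) / r = 2 * (t * (real (card {i\<in>{1..n}. \<omega> i = 1}) / real n - a))"
  unfolding magnetization_eq[OF assms(1)] assms(4) using assms(2,3) by (simp add: field_simps)

lemma magnetization_density:
  assumes "\<omega> \<in> configs n" "0 < n"
  shows "magnetization n \<omega> / real n = 2 * (real (card {i\<in>{1..n}. \<omega> i = 1}) / real n) - 1"
  unfolding magnetization_eq[OF assms(1)] using assms(2) by (simp add: field_simps)

lemma integral_distr_magnetization:
  fixes g :: "real \<Rightarrow> real"
  assumes n: "0 < n" and t: "0 < t" and r: "r = real n / t" and g: "g \<in> borel_measurable borel"
  shows "integral\<^sup>L (distr (gibbs n (\<lambda>y. real n * f y + s * B y)) borel (\<lambda>\<omega>. (magnetization n \<omega> - real n * (2 * a - 1)) / r)) g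
    = (\<Sum>k\<in>{..n}. g (2 * (t * (real k / real n - a))) * bweight f B s n k) / (\<Sum>k\<in>{..n}. bweight f B s n k)"
proof (subst integral_distr[OF measurable_gibbs g])
  show "(LINT \<omega>|gibbs n (\<lambda>y. real n * f y + s * B y). g ((magnetization n \<omega> - real n * (2 * a - 1)) / r))
    = (\<Sum>k\<in>{..n}. g (2 * (t * (real k / real n - a))) * bweight f B s n k) / (\<Sum>k\<in>{..n}. bweight f B s n k)"
    unfolding bweight_def
    by (rule integral_gibbs[where g = "\<lambda>k. g (2 * (t * (real k / real n - a)))"])
      (simp add: magnetization_scaled[OF _ n t r])
qed

text \<open>The magnetization density is \<open>2 k/n - 1\<close>, so a radius
  \<open>\<delta>\<close> around \<open>2 a - 1\<close> is a window of radius
  \<open>\<delta> / 2\<close> around \<open>a\<close>.\<close>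

lemma integral_distr_magnetization_conditional:
  fixes f B g :: "real \<Rightarrow> real" and s :: real and n :: nat
  assumes n: "0 < n" and t: "0 < t" and r: "r = real n / t" and g: "g \<in> borel_measurable borel"
    and ne: "window a (\<delta> / 2) n \<noteq> {}"
  defines "\<mu> \<equiv> gibbs n (\<lambda>y. real n * f y + s * B y)"
  shows "integral\<^sup>L (distr (uniform_measure \<mu> {\<omega> \<in> space \<mu>. \<bar>magnetization n \<omega> / real n - (2 * a - 1)\<bar> \<le> \<delta>}) borel
      (\<lambda>\<omega>. (magnetization n \<omega> - real n * (2 * a - 1)) / r)) g
    = (\<Sum>k\<in>window a (\<delta> / 2) n. g (2 * (t * (real k / real n - a))) * bweight f B s n k) / (\<Sum>k\<in>window a (\<delta> / 2) n. bweight f B s n k)"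
proof -
  define U where "U = uniform_measure \<mu> {\<omega> \<in> space \<mu>. \<bar>magnetization n \<omega> / real n - (2 * a - 1)\<bar> \<le> \<delta>}"
  have m: "X \<in> measurable U borel" for X :: "(nat \<Rightarrow> real) \<Rightarrow> real"
  proof -
    have "measurable U borel = measurable \<mu> borel" by (rule measurable_cong_sets) (auto simp: U_def)
    moreover have "X \<in> measurable \<mu> borel" unfolding \<mu>_def by (rule measurable_gibbs)
    ultimately show ?thesis by (rule ssubst)
  qed
  have wi: "window a (\<delta> / 2) n = {..n} \<inter> {k. \<bar>real k / real n - a\<bar> \<le> \<delta> / 2}" by (auto simp: window_def)
  have "integral\<^sup>L (distr U borel (\<lambda>\<omega>. (magnetization n \<omega> - real n * (2 * a - 1)) / r)) g
      = integral\<^sup>L U (\<lambda>\<omega>. g ((magnetization n \<omega> - real n * (2 * a - 1)) / r))"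
    by (rule integral_distr[OF m g])
  also have "\<dots> = (\<Sum>k\<in>window a (\<delta> / 2) n. g (2 * (t * (real k / real n - a))) * bweight f B s n k) / (\<Sum>k\<in>window a (\<delta> / 2) n. bweight f B s n k)"
    unfolding U_def \<mu>_def bweight_def wi
  proof (rule integral_gibbs_conditional)
    fix \<omega> assume w: "\<omega> \<in> configs n"
    show "g ((magnetization n \<omega> - real n * (2 * a - 1)) / r) = g (2 * (t * (real (card {i\<in>{1..n}. \<omega> i = 1}) / real n - a)))"
      by (simp add: magnetization_scaled[OF w n t r])
    show "\<bar>magnetization n \<omega> / real n - (2 * a - 1)\<bar> \<le> \<delta> \<longleftrightarrow> card {i\<in>{1..n}. \<omega> i = 1} \<in> {k. \<bar>real k / real n - a\<bar> \<le> \<delta> / 2}"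
      unfolding magnetization_density[OF w n] mem_Collect_eq by linarith
  qed (use ne wi in auto)
  finally show ?thesis unfolding U_def .
qed

lemma window_nonempty:
  assumes "0 \<le> a" "a \<le> 1" "0 < n" "1 / real n \<le> \<delta>"
  shows "window a \<delta> n \<noteq> {}"
proof -
  define k where "k = nat \<lfloor>real n * a\<rfloor>"
  have na: "0 \<le> real n * a" "real n * a \<le> real n" using assms by (auto intro: mult_left_le)
  have k: "real k \<le> real n * a" "real n * a < real k + 1" using na(1) unfolding k_def by linarith+
  have "k \<le> n" using k(1) na(2) by linarith
  moreover have "\<bar>real k / real n - a\<bar> \<le> \<delta>"
  proof -
    have "real k / real n - a = (real k - real n * a) / real n" using assms(3) by (simp add: field_simps)
    then have "\<bar>real k / real n - a\<bar> = \<bar>real k - real n * a\<bar> / real n" by simp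
    also have "\<dots> \<le> 1 / real n" using k by (intro divide_right_mono) auto
    finally show ?thesis using assms(4) by simp
  qed
  ultimately show ?thesis unfolding window_def by auto
qed

text \<open>No bound on the mass outside the windows is needed: the limits \<open>pr i\<close> already sum to \<open>1\<close>.\<close>

lemma weak_conv_from_windows:
  fixes w :: "nat \<Rightarrow> nat \<Rightarrow> real" and \<mu> :: "nat \<Rightarrow> real measure" and a pr :: "nat \<Rightarrow> real"
  assumes M: "real_distribution M" and \<mu>: "\<And>n. real_distribution (\<mu> n)" and J: "finite J" "inj_on a J"
    and pr: "(\<Sum>i\<in>J. pr i) = 1" "\<And>i. i \<in> J \<Longrightarrow> 0 \<le> pr i"
    and w: "\<And>n k. 0 \<le> w n k" "\<And>n. 0 < n \<Longrightarrow> (\<Sum>k\<le>n. w n k) = 1"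
    and lim: "0 < \<delta>0" "\<And>\<delta> i. 0 < \<delta> \<Longrightarrow> \<delta> < \<delta>0 \<Longrightarrow> i \<in> J \<Longrightarrow> (\<lambda>n. \<Sum>k\<in>window (a i) \<delta> n. w n k) \<longlonglongrightarrow> pr i"
    and int\<mu>: "\<And>n g. 0 < n \<Longrightarrow> g \<in> borel_measurable borel \<Longrightarrow>
      integral\<^sup>L (\<mu> n) g = (\<Sum>k\<le>n. g (2 * (real k / real n) - 1) * w n k)"
    and intM: "\<And>g. g \<in> borel_measurable borel \<Longrightarrow> integral\<^sup>L M g = (\<Sum>i\<in>J. pr i * g (2 * a i - 1))"
  shows "weak_conv_m \<mu> M"
proof (rule integral_cts_step_conv_imp_weak_conv[OF \<mu> M])
  fix x y :: real assume xy: "x < y"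
  \<comment> \<open>Weak convergence may be tested on continuous steps, which are bounded by one and
    uniformly continuous; the latter makes \<open>g\<close> nearly constant on a small
    window.\<close>
  define g where "g = cts_step x y"
  have uc: "uniformly_continuous_on UNIV g" unfolding g_def by (rule cts_step_uniformly_continuous[OF xy])
  then have gm: "g \<in> borel_measurable borel"
    by (intro borel_measurable_continuous_onI uniformly_continuous_imp_continuous)
  have g1: "\<bar>g z\<bar> \<le> 1" for z using xy by (auto simp: g_def cts_step_def)
  obtain \<delta>s where \<delta>s: "0 < \<delta>s" "\<And>i j. i \<in> J \<Longrightarrow> j \<in> J \<Longrightarrow> i \<noteq> j \<Longrightarrow> 2 * \<delta>s < \<bar>a i - a j\<bar>"
  proof -
    \<comment> \<open>A third of the smallest distance between modes makes the windows disjoint; the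
      inserted \<open>1\<close> keeps the minimum defined when there is only one mode.\<close>
    define D where "D = insert 1 ((\<lambda>(i, j). \<bar>a i - a j\<bar> / 3) ` {ij \<in> J \<times> J. fst ij \<noteq> snd ij})"
    have fD: "finite D" "D \<noteq> {}" unfolding D_def using J(1) by auto
    have "0 < Min D" using fD J(2) by (subst Min_gr_iff) (auto simp: D_def inj_on_def)
    moreover have "2 * Min D < \<bar>a i - a j\<bar>" if "i \<in> J" "j \<in> J" "i \<noteq> j" for i j
    proof -
      have "Min D \<le> \<bar>a i - a j\<bar> / 3" using fD that by (intro Min_le) (auto simp: D_def)
      moreover have "2 * x < m" if "x \<le> m / 3" "0 < x" for x m :: real using that by linarith
      ultimately show ?thesis using \<open>0 < Min D\<close> by blast
    qed
    ultimately show ?thesis using that by blast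
  qed
  have "(\<lambda>n. integral\<^sup>L (\<mu> n) g) \<longlonglongrightarrow> integral\<^sup>L M g"
  proof (rule LIMSEQ_I)
    fix e :: real assume e: "0 < e"
    obtain d where d: "0 < d" "\<And>z z'. dist z' z < d \<Longrightarrow> dist (g z') (g z) < e / 2"
      using uc e unfolding uniformly_continuous_on_def by (metis UNIV_I half_gt_zero)
    define \<delta> where "\<delta> = Min {\<delta>0, \<delta>s, d / 2} / 2"
    have \<delta>: "0 < \<delta>" "\<delta> < \<delta>0" "\<delta> < \<delta>s" "2 * \<delta> < d" using lim(1) \<delta>s(1) d(1) by (auto simp: \<delta>_def min_def)
    define P where "P i n = (\<Sum>k\<in>window (a i) \<delta> n. w n k)" for i n
    have "(\<lambda>n. \<Sum>i\<in>J. \<bar>P i n - pr i\<bar>) \<longlonglongrightarrow> (\<Sum>i\<in>J. \<bar>pr i - pr i\<bar>)"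
      unfolding P_def by (intro tendsto_intros lim \<delta>)
    \<comment> \<open>A quarter of \<open>e\<close> suffices because these differences enter twice,
      in \<open>T2\<close> and in \<open>T3\<close>, while the oscillation of \<open>g\<close> in
      \<open>T1\<close> takes the remaining half.\<close>
    then have "\<forall>\<^sub>F n in sequentially. (\<Sum>i\<in>J. \<bar>P i n - pr i\<bar>) < e / 4"
      using e by (intro order_tendstoD(2)) auto
    then have "\<forall>\<^sub>F n in sequentially. \<bar>integral\<^sup>L (\<mu> n) g - integral\<^sup>L M g\<bar> < e"
      using eventually_gt_at_top[of 0]
    proof eventually_elim
      case (elim n)
      define U where "U = (\<Union>i\<in>J. window (a i) \<delta> n)"
      have disj: "window (a i) \<delta> n \<inter> window (a j) \<delta> n = {}" if "i \<in> J" "j \<in> J" "i \<noteq> j" for i j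
        using \<delta>s(2)[OF that] \<delta>(3) by (fastforce simp: window_def)
      have U: "sum F U = (\<Sum>i\<in>J. sum F (window (a i) \<delta> n))" for F :: "nat \<Rightarrow> real"
        unfolding U_def using disj J(1) by (intro sum.UNION_disjoint) auto
      have Un: "U \<subseteq> {..n}" by (auto simp: U_def window_def)
      have finU: "finite U" using Un finite_subset by blast
      define G where "G k = g (2 * (real k / real n) - 1)" for k
      have rest: "sum F {..n} = sum F U + sum F ({..n} - U)" for F :: "nat \<Rightarrow> real"
        using Un by (simp add: sum.subset_diff)
      \<comment> \<open>The weights and the limits have the same total one, so the mass left outside
        is the sum of the same differences that already tend to zero.\<close>
      have wU: "sum (w n) ({..n} - U) = (\<Sum>i\<in>J. pr i) - (\<Sum>i\<in>J. P i n)"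
        using rest[of "w n"] w(2)[OF elim(2)] pr(1) unfolding U P_def by simp
      have T3: "\<bar>\<Sum>k\<in>{..n} - U. G k * w n k\<bar> \<le> (\<Sum>i\<in>J. \<bar>P i n - pr i\<bar>)"
      proof -
        have "\<bar>\<Sum>k\<in>{..n} - U. G k * w n k\<bar> \<le> (\<Sum>k\<in>{..n} - U. w n k)"
          using g1 w(1) by (intro order_trans[OF sum_abs] sum_mono)
            (auto simp: G_def abs_mult mult_left_le_one_le)
        also have "\<dots> = (\<Sum>i\<in>J. pr i - P i n)" unfolding wU by (simp add: sum_subtractf)
        also have "\<dots> \<le> (\<Sum>i\<in>J. \<bar>P i n - pr i\<bar>)" by (intro sum_mono) auto
        finally show ?thesis .
      qed
      have T1: "\<bar>\<Sum>i\<in>J. \<Sum>k\<in>window (a i) \<delta> n. (G k - g (2 * a i - 1)) * w n k\<bar> \<le> e / 2"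
      proof -
        have "\<bar>\<Sum>i\<in>J. \<Sum>k\<in>window (a i) \<delta> n. (G k - g (2 * a i - 1)) * w n k\<bar>
            \<le> (\<Sum>i\<in>J. \<Sum>k\<in>window (a i) \<delta> n. e / 2 * w n k)"
        proof (intro order_trans[OF sum_abs] sum_mono)
          fix i k assume "i \<in> J" and k: "k \<in> window (a i) \<delta> n"
          have "\<bar>real k / real n - a i\<bar> \<le> \<delta>" using k by (simp add: window_def)
          then have "dist (2 * (real k / real n) - 1) (2 * a i - 1) < d" using \<delta>(4) unfolding dist_real_def by linarith
          from d(2)[OF this] have "\<bar>G k - g (2 * a i - 1)\<bar> \<le> e / 2" unfolding G_def dist_real_def by simp
          then have "\<bar>G k - g (2 * a i - 1)\<bar> * \<bar>w n k\<bar> \<le> e / 2 * \<bar>w n k\<bar>" by (rule mult_right_mono) simp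
          then show "\<bar>(G k - g (2 * a i - 1)) * w n k\<bar> \<le> e / 2 * w n k"
            unfolding abs_mult abs_of_nonneg[OF w(1)] .
        qed
        also have "\<dots> = e / 2 * sum (w n) U" unfolding U by (simp add: sum_distrib_left)
        also have "\<dots> \<le> e / 2 * 1"
        proof (intro mult_left_mono)
          have "sum (w n) U \<le> sum (w n) {..n}" using Un w(1) by (intro sum_mono2) auto
          then show "sum (w n) U \<le> 1" using w(2)[OF elim(2)] by simp
        qed (use e in simp)
        finally show ?thesis by simp
      qed
      have T2: "\<bar>\<Sum>i\<in>J. (P i n - pr i) * g (2 * a i - 1)\<bar> \<le> (\<Sum>i\<in>J. \<bar>P i n - pr i\<bar>)"
        using g1 by (intro order_trans[OF sum_abs] sum_mono) (auto simp: abs_mult mult_right_le_one_le)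
      have "integral\<^sup>L (\<mu> n) g = (\<Sum>i\<in>J. \<Sum>k\<in>window (a i) \<delta> n. G k * w n k) + (\<Sum>k\<in>{..n} - U. G k * w n k)"
        unfolding int\<mu>[OF elim(2) gm] G_def[symmetric] rest U ..
      moreover have "(\<Sum>k\<in>window (a i) \<delta> n. G k * w n k) = (\<Sum>k\<in>window (a i) \<delta> n. (G k - g (2 * a i - 1)) * w n k)
          + ((P i n - pr i) * g (2 * a i - 1) + pr i * g (2 * a i - 1))" for i
      proof -
        have "(\<Sum>k\<in>window (a i) \<delta> n. (G k - g (2 * a i - 1)) * w n k)
            = (\<Sum>k\<in>window (a i) \<delta> n. G k * w n k) - g (2 * a i - 1) * P i n"
          unfolding P_def by (simp add: left_diff_distrib sum_subtractf sum_distrib_left)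
        then show ?thesis by (simp add: algebra_simps)
      qed
      ultimately have "integral\<^sup>L (\<mu> n) g - integral\<^sup>L M g =
          (\<Sum>i\<in>J. \<Sum>k\<in>window (a i) \<delta> n. (G k - g (2 * a i - 1)) * w n k)
          + (\<Sum>i\<in>J. (P i n - pr i) * g (2 * a i - 1)) + (\<Sum>k\<in>{..n} - U. G k * w n k)"
        unfolding intM[OF gm] by (simp add: sum.distrib)
      then show ?case using T1 T2 T3 elim(1) by linarith
    qed
    then show "\<exists>no. \<forall>n\<ge>no. norm (integral\<^sup>L (\<mu> n) g - integral\<^sup>L M g) < e"
      unfolding eventually_sequentially by simp
  qed
  then show "(\<lambda>n. integral\<^sup>L (\<mu> n) (cts_step x y)) \<longlonglongrightarrow> integral\<^sup>L M (cts_step x y)" unfolding g_def .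
qed

lemma finite_index_radius:
  fixes P :: "'i \<Rightarrow> real \<Rightarrow> bool"
  assumes "finite K" "\<And>i. i \<in> K \<Longrightarrow> \<exists>d>0. \<forall>\<delta>. 0 < \<delta> \<and> \<delta> \<le> d \<longrightarrow> P i \<delta>"
  shows "\<exists>d>0. \<forall>\<delta>. 0 < \<delta> \<and> \<delta> \<le> d \<longrightarrow> (\<forall>i\<in>K. P i \<delta>)"
  using assms
proof (induction K rule: finite_induct)
  case empty
  then show ?case by (intro exI[of _ 1]) auto
next
  case (insert i K)
  have "\<exists>d>0. \<forall>\<delta>. 0 < \<delta> \<and> \<delta> \<le> d \<longrightarrow> (\<forall>i\<in>K. P i \<delta>)"
    by (rule insert.IH) (rule insert.prems, simp)
  then obtain d1 where "0 < d1" "\<forall>\<delta>. 0 < \<delta> \<and> \<delta> \<le> d1 \<longrightarrow> (\<forall>i\<in>K. P i \<delta>)" by blast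
  moreover obtain d2 where "0 < d2" "\<forall>\<delta>. 0 < \<delta> \<and> \<delta> \<le> d2 \<longrightarrow> P i \<delta>"
    using insert.prems[of i] by blast
  ultimately show ?case by (intro exI[of _ "min d1 d2"]) auto
qed

text \<open>All windows are measured on one common scale \<open>R n\<close>. Relative to it, the
  window of mode \<open>i\<close> carries the factors \<open>exp (t (B (a i) - Bm))\<close> and
  \<open>(a i (1 - a i))^(-1/2)\<close> times a Laplace sum. The first factor is \<open>1\<close> on
  the top modes and tends to \<open>0\<close> elsewhere, so the limits are the mode weights on
  \<open>J\<close> and zero off \<open>J\<close>. The windows asymptotically carry all the mass, and
  the quotient follows.\<close>

lemma mode_limits:
  fixes \<beta> h \<beta>' h' :: real and p k :: nat and a :: "nat \<Rightarrow> real"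
  defines "f \<equiv> pspin p \<beta> h" and "B \<equiv> pspin p \<beta>' h'" and "t \<equiv> \<lambda>n. real n powr (1 / real 2)"
  assumes k: "1 \<le> k" and inj: "inj_on a {1..k}" and a: "a ` {1..k} = maximizers p \<beta> h" "maximizers p \<beta> h \<subseteq> {0<..<1}"
    and neg: "\<And>i. i \<in> {1..k} \<Longrightarrow> energy_deriv p \<beta> h 2 (a i) < 0"
  shows "\<exists>\<delta>0>0. \<forall>\<delta>. 0 < \<delta> \<and> \<delta> < \<delta>0 \<longrightarrow> (\<forall>i\<in>top_indices B k a.
    (\<lambda>n. (\<Sum>j\<in>window (a i) \<delta> n. bweight f B (t n) n j) / (\<Sum>j\<le>n. bweight f B (t n) n j))
      \<longlonglongrightarrow> mode_prob (free_energy p \<beta> h) B k a i)"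
  and "0 < mode_weight (free_energy p \<beta> h) B (a i) \<or> i \<notin> {1..k}"
proof -
  define c where "c i = energy_deriv p \<beta> h 2 (a i) / fact 2" for i
  define b where "b i = deriv B (a i)" for i
  define J where "J = top_indices B k a"
  define mw where "mw i = mode_weight (free_energy p \<beta> h) B (a i)" for i
  define I1 where "I1 i = (LBINT x. tilt 2 (c i) (b i) x)" for i
  have ai: "0 < a i" "a i < 1" "a i \<in> maximizers p \<beta> h" if "i \<in> {1..k}" for i
  proof -
    show "a i \<in> maximizers p \<beta> h" using a(1) that by blast
    then show "0 < a i" "a i < 1" using a(2) by auto
  qed
  have c: "c i < 0" if "i \<in> {1..k}" for i using neg[OF that] by (simp add: c_def)
  have mw: "mw i = I1 i * (a i * (1 - a i)) powr (- 1 / 2)" if "i \<in> {1..k}" for i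
  proof -
    have "(deriv ^^ 2) (free_energy p \<beta> h) (a i) = 2 * c i"
      using higher_deriv_free_energy[OF ai(1,2)[OF that], of 2] by (simp add: c_def)
    then show ?thesis unfolding mw_def mode_weight_def I1_def tilt_def b_def by simp
  qed
  have mw_pos: "0 < mw i" if "i \<in> {1..k}" for i
    unfolding mw[OF that] I1_def using ai[OF that] c[OF that] by (intro mult_pos_pos integral_tilt_pos) auto
  then show "0 < mode_weight (free_energy p \<beta> h) B (a i) \<or> i \<notin> {1..k}" unfolding mw_def by auto
  define Bm where "Bm = Max ((\<lambda>l. B (a l)) ` {1..k})"
  have Bm: "B (a i) \<le> Bm" if "i \<in> {1..k}" for i unfolding Bm_def using that by (intro Max_ge) auto
  have Jeq: "J = {i\<in>{1..k}. B (a i) = Bm}" unfolding J_def top_indices_def Bm_def ..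
  have Jne: "J \<noteq> {}"
  proof -
    have "Bm \<in> (\<lambda>l. B (a l)) ` {1..k}" unfolding Bm_def using k by (intro Max_in) auto
    then show ?thesis unfolding Jeq by auto
  qed
  obtain d1 where d1: "0 < d1" "\<And>\<delta>. 0 < \<delta> \<Longrightarrow> \<delta> \<le> d1 \<Longrightarrow> (\<forall>i\<in>{1..k}. laplace_at 2 f B (a i) (c i) (b i) \<delta>)"
  proof -
    have ex: "\<exists>d>0. \<forall>\<delta>. 0 < \<delta> \<and> \<delta> \<le> d \<longrightarrow> laplace_at 2 f B (a i) (c i) (b i) \<delta>" if i: "i \<in> {1..k}" for i
      unfolding f_def B_def c_def b_def
    proof (rule laplace_at_maximizer)
      fix m :: nat assume "0 < m" "m < 2"
      then have "m = 1" by simp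
      then show "energy_deriv p \<beta> h m (a i) = 0" using maximizer_deriv_eq_0[of "a i" p \<beta> h] ai[OF i] by simp
    qed (use ai[OF i] neg[OF i] in auto)
    have "\<exists>d>0. \<forall>\<delta>. 0 < \<delta> \<and> \<delta> \<le> d \<longrightarrow> (\<forall>i\<in>{1..k}. laplace_at 2 f B (a i) (c i) (b i) \<delta>)"
      by (rule finite_index_radius[OF finite_atLeastAtMost]) (rule ex)
    then obtain d where d: "0 < d" "\<forall>\<delta>. 0 < \<delta> \<and> \<delta> \<le> d \<longrightarrow> (\<forall>i\<in>{1..k}. laplace_at 2 f B (a i) (c i) (b i) \<delta>)"
      by (elim exE conjE) (rule that)
    show ?thesis
    proof (rule that[OF d(1)])
      fix \<delta> assume "0 < \<delta>" "\<delta> \<le> d"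
      with d(2) show "\<forall>i\<in>{1..k}. laplace_at 2 f B (a i) (c i) (b i) \<delta>" by blast
    qed
  qed
  obtain d2 where d2: "0 < d2" "\<And>i j. i \<in> {1..k} \<Longrightarrow> j \<in> {1..k} \<Longrightarrow> i \<noteq> j \<Longrightarrow> 2 * d2 < \<bar>a i - a j\<bar>"
  proof -
    have ex: "\<exists>d>0. \<forall>\<delta>. 0 < \<delta> \<and> \<delta> \<le> d \<longrightarrow> (\<forall>j\<in>{1..k}. i \<noteq> j \<longrightarrow> 2 * \<delta> < \<bar>a i - a j\<bar>)" if i: "i \<in> {1..k}" for i
    proof (rule finite_index_radius)
      fix j assume j: "j \<in> {1..k}"
      show "\<exists>d>0. \<forall>\<delta>. 0 < \<delta> \<and> \<delta> \<le> d \<longrightarrow> i \<noteq> j \<longrightarrow> 2 * \<delta> < \<bar>a i - a j\<bar>"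
      proof (cases "i = j")
        case False
        then have "a i \<noteq> a j" using inj_onD[OF inj _ i j] by blast
        then have "0 < \<bar>a i - a j\<bar>" by simp
        moreover have "\<exists>d>0. \<forall>\<delta>. 0 < \<delta> \<and> \<delta> \<le> d \<longrightarrow> i \<noteq> j \<longrightarrow> 2 * \<delta> < m" if "0 < m" for m :: real
          using that by (intro exI[of _ "m / 3"]) auto
        ultimately show ?thesis by blast
      qed (auto intro!: exI[of _ 1])
    qed simp
    have "\<exists>d>0. \<forall>\<delta>. 0 < \<delta> \<and> \<delta> \<le> d \<longrightarrow> (\<forall>i\<in>{1..k}. \<forall>j\<in>{1..k}. i \<noteq> j \<longrightarrow> 2 * \<delta> < \<bar>a i - a j\<bar>)"
      by (rule finite_index_radius[OF finite_atLeastAtMost]) (rule ex)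
    then obtain d where "0 < d"
      "\<forall>\<delta>. 0 < \<delta> \<and> \<delta> \<le> d \<longrightarrow> (\<forall>i\<in>{1..k}. \<forall>j\<in>{1..k}. i \<noteq> j \<longrightarrow> 2 * \<delta> < \<bar>a i - a j\<bar>)"
      by (elim exE conjE) (rule that)
    then show ?thesis using that[of d] by auto
  qed
  show "\<exists>\<delta>0>0. \<forall>\<delta>. 0 < \<delta> \<and> \<delta> < \<delta>0 \<longrightarrow> (\<forall>i\<in>top_indices B k a.
    (\<lambda>n. (\<Sum>j\<in>window (a i) \<delta> n. bweight f B (t n) n j) / (\<Sum>j\<le>n. bweight f B (t n) n j))
      \<longlonglongrightarrow> mode_prob (free_energy p \<beta> h) B k a i)"
  proof (rule exI[of _ "min d1 d2"], intro conjI allI impI)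
    fix \<delta> assume "0 < \<delta> \<and> \<delta> < min d1 d2"
    then have \<delta>: "0 < \<delta>" "\<delta> \<le> d1" "\<delta> < d2" by auto
    have L: "laplace_at 2 f B (a i) (c i) (b i) \<delta>" if "i \<in> {1..k}" for i using d1(2)[OF \<delta>(1,2)] that by blast
    define P where "P i n = (\<Sum>j\<in>window (a i) \<delta> n. bweight f B (t n) n j)" for i n
    define Z where "Z n = (\<Sum>j\<le>n. bweight f B (t n) n j)" for n
    define Am where "Am = free_energy p \<beta> h (a 1)"
    have Am: "f (a i) + binary_entropy (a i) = Am" if "i \<in> {1..k}" for i
    proof -
      have "free_energy p \<beta> h (a i) = free_energy p \<beta> h (a 1)"
        using ai[OF that] ai[of 1] k by (intro antisym maximizers_le) auto
      then show ?thesis unfolding Am_def f_def free_energy_def by simp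
    qed
    \<comment> \<open>The inverse Laplace scale with \<open>B (a i)\<close> replaced by the maximum
      \<open>Bm\<close> and without the factor \<open>a i (1 - a i)\<close>; the free energy needs
      no index because all maximizers share its value.\<close>
    define R where "R n = t n / (real n * (exp (real n * Am + t n * Bm - stirling_const) / sqrt (real n)))" for n
    have Rpos: "0 < R n" if "0 < n" for n unfolding R_def t_def using that by simp
    have tlim: "filterlim t at_top sequentially" unfolding t_def by real_asymp
    have scale: "R n = t n / (real n * laplace_scale f B (a i) (t n) n) * (exp (t n * (B (a i) - Bm)) * (a i * (1 - a i)) powr (- 1 / 2))"
      if i: "i \<in> {1..k}" and n: "0 < n" for i n
    proof -
      have pos: "0 < a i * (1 - a i)" using ai[OF i] by simp
      have pw: "(a i * (1 - a i)) powr (- 1 / 2) = 1 / sqrt (a i * (1 - a i))"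
        using pos by (simp add: powr_minus_divide powr_half_sqrt)
      have e: "exp (real n * Am + t n * B (a i) - stirling_const)
          = exp (real n * Am + t n * Bm - stirling_const) * exp (t n * (B (a i) - Bm))"
        unfolding exp_add[symmetric] by (simp add: algebra_simps)
      have s: "sqrt (real n * a i * (1 - a i)) = sqrt (real n) * sqrt (a i * (1 - a i))"
        by (simp add: real_sqrt_mult mult.assoc)
      have gen: "T / (N * (E / Q)) = T / (N * (E * x / (Q * S))) * (x * (1 / S))" if "0 < S" "0 < x" for T N E Q x S :: real
        using that by simp
      have "0 < sqrt (a i * (1 - a i))" using pos by simp
      from gen[OF this exp_gt_zero] show ?thesis unfolding R_def laplace_scale_def Am[OF i] pw e s .
    qed
    have lim1: "(\<lambda>n. R n * P i n) \<longlonglongrightarrow> (if i \<in> J then mw i else 0)" if i: "i \<in> {1..k}" for i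
    proof -
      obtain C where C: "0 < C" "\<And>n \<phi>. 0 < n \<Longrightarrow> test_fun \<phi> \<Longrightarrow>
        \<bar>rescaled_sum f B (a i) (t n) n (window (a i) \<delta> n) \<phi> - (LBINT x. \<phi> x * tilt 2 (c i) (b i) x)\<bar> \<le> C / t n"
        using L[OF i] unfolding laplace_at_def t_def by blast
      define N where "N n = t n / (real n * laplace_scale f B (a i) (t n) n) * P i n" for n
      have N: "N \<longlonglongrightarrow> I1 i"
      proof (rule LIM_zero_cancel, rule Lim_null_comparison)
        show "\<forall>\<^sub>F n in sequentially. norm (N n - I1 i) \<le> C / t n"
          using eventually_gt_at_top[of 0]
        proof eventually_elim
          case (elim n)
          then show ?case using C(2)[OF elim test_fun_one] unfolding rescaled_sum_def N_def P_def I1_def by simp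
        qed
        show "(\<lambda>n. C / t n) \<longlonglongrightarrow> 0" by (rule real_tendsto_divide_at_top[OF tendsto_const tlim])
      qed
      have E: "(\<lambda>n. exp (t n * (B (a i) - Bm))) \<longlonglongrightarrow> (if i \<in> J then 1 else 0)"
      proof (cases "i \<in> J")
        case True
        then show ?thesis unfolding Jeq by simp
      next
        case False
        then have "B (a i) - Bm < 0" using Bm[OF i] i unfolding Jeq by auto
        then show ?thesis using False unfolding t_def by simp real_asymp
      qed
      have "(\<lambda>n. N n * (exp (t n * (B (a i) - Bm)) * (a i * (1 - a i)) powr (- 1 / 2)))
          \<longlonglongrightarrow> I1 i * ((if i \<in> J then 1 else 0) * (a i * (1 - a i)) powr (- 1 / 2))"
        by (intro tendsto_intros N E)
      moreover have "\<forall>\<^sub>F n in sequentially. N n * (exp (t n * (B (a i) - Bm)) * (a i * (1 - a i)) powr (- 1 / 2)) = R n * P i n"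
        using eventually_gt_at_top[of 0] by eventually_elim (simp add: N_def scale[OF i])
      ultimately have "(\<lambda>n. R n * P i n) \<longlonglongrightarrow> I1 i * ((if i \<in> J then 1 else 0) * (a i * (1 - a i)) powr (- 1 / 2))"
        by (rule Lim_transform_eventually)
      then show ?thesis using mw[OF i] by (cases "i \<in> J") auto
    qed
    define S where "S = (\<Sum>l\<in>J. mw l)"
    have Spos: "0 < S" unfolding S_def using Jne Jeq mw_pos by (intro sum_pos) auto
    have limS: "(\<lambda>n. R n * (\<Sum>i\<in>{1..k}. P i n)) \<longlonglongrightarrow> S"
    proof -
      have "(\<lambda>n. \<Sum>i\<in>{1..k}. R n * P i n) \<longlonglongrightarrow> (\<Sum>i\<in>{1..k}. if i \<in> J then mw i else 0)"
        by (intro tendsto_sum lim1)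
      moreover have "(\<Sum>i\<in>{1..k}. if i \<in> J then mw i else 0) = S"
        unfolding S_def by (rule sum.mono_neutral_cong_right) (auto simp: Jeq)
      ultimately show ?thesis by (simp add: sum_distrib_left)
    qed
    \<comment> \<open>Windows and complement partition \<open>{..n}\<close>, and the complement is
      an exponentially small fraction of the partition function.\<close>
    have limQ: "(\<lambda>n. (\<Sum>i\<in>{1..k}. P i n) / Z n) \<longlonglongrightarrow> 1"
    proof -
      have i1: "1 \<in> {1..k}" using k by simp
      have "\<exists>c'>0. \<forall>\<^sub>F n in sequentially.
        (\<Sum>j | j \<le> n \<and> (\<forall>x\<in>maximizers p \<beta> h. \<delta> < \<bar>real j / real n - x\<bar>). bweight f B (t n) n j) \<le> exp (- c' * real n) * Z n"
        unfolding f_def B_def t_def Z_def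
        using outside_exponentially_small[OF ai(3,1,2)[OF i1] c[OF i1] even_numeral order_refl
          L[OF i1, unfolded f_def B_def] \<delta>(1)] .
      then obtain c' where c': "0 < c'" and out: "\<forall>\<^sub>F n in sequentially.
        (\<Sum>j | j \<le> n \<and> (\<forall>x\<in>maximizers p \<beta> h. \<delta> < \<bar>real j / real n - x\<bar>). bweight f B (t n) n j) \<le> exp (- c' * real n) * Z n"
        by (elim exE conjE) (rule that)
      have "\<forall>\<^sub>F n in sequentially. 1 - exp (- c' * real n) \<le> (\<Sum>i\<in>{1..k}. P i n) / Z n \<and> (\<Sum>i\<in>{1..k}. P i n) / Z n \<le> 1"
        using out
      proof eventually_elim
        case (elim n)
        define U where "U = (\<Union>i\<in>{1..k}. window (a i) \<delta> n)"
        have disj: "window (a i) \<delta> n \<inter> window (a j) \<delta> n = {}" if "i \<in> {1..k}" "j \<in> {1..k}" "i \<noteq> j" for i j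
          using d2(2)[OF that] \<delta>(3) by (fastforce simp: window_def)
        have U: "sum F U = (\<Sum>i\<in>{1..k}. sum F (window (a i) \<delta> n))" for F :: "nat \<Rightarrow> real"
          unfolding U_def using disj by (intro sum.UNION_disjoint) auto
        have Un: "U \<subseteq> {..n}" by (auto simp: U_def window_def)
        have co: "{..n} - U = {j. j \<le> n \<and> (\<forall>x\<in>maximizers p \<beta> h. \<delta> < \<bar>real j / real n - x\<bar>)}"
          unfolding a(1)[symmetric] U_def by (auto simp: window_def not_le)
        have Zs: "Z n = (\<Sum>i\<in>{1..k}. P i n) + sum (bweight f B (t n) n) ({..n} - U)"
          unfolding Z_def P_def U[symmetric] using Un by (simp add: sum.subset_diff)
        have Zp: "0 < Z n" unfolding Z_def by (intro sum_pos bweight_pos) auto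
        have o0: "0 \<le> sum (bweight f B (t n) n) ({..n} - U)" by (intro sum_nonneg bweight_nonneg)
        have "sum (bweight f B (t n) n) ({..n} - U) \<le> exp (- c' * real n) * Z n" unfolding co by (rule elim)
        then have "(1 - exp (- c' * real n)) * Z n \<le> (\<Sum>i\<in>{1..k}. P i n)" unfolding left_diff_distrib using Zs by linarith
        moreover have "(\<Sum>i\<in>{1..k}. P i n) \<le> 1 * Z n" using Zs o0 by simp
        ultimately show ?case using Zp by (simp only: pos_le_divide_eq pos_divide_le_eq)
      qed
      then have l: "\<forall>\<^sub>F n in sequentially. 1 - exp (- c' * real n) \<le> (\<Sum>i\<in>{1..k}. P i n) / Z n"
        and u: "\<forall>\<^sub>F n in sequentially. (\<Sum>i\<in>{1..k}. P i n) / Z n \<le> 1"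
        by (auto elim: eventually_mono)
      have "(\<lambda>n. 1 - exp (- c' * real n)) \<longlonglongrightarrow> 1" using c' by real_asymp
      from tendsto_sandwich[OF l u this tendsto_const] show ?thesis .
    qed
    show "\<forall>i\<in>top_indices B k a.
      (\<lambda>n. (\<Sum>j\<in>window (a i) \<delta> n. bweight f B (t n) n j) / (\<Sum>j\<le>n. bweight f B (t n) n j))
        \<longlonglongrightarrow> mode_prob (free_energy p \<beta> h) B k a i"
    proof
      fix i assume "i \<in> top_indices B k a"
      then have iJ: "i \<in> J" and i: "i \<in> {1..k}" unfolding J_def[symmetric] Jeq by auto
      \<comment> \<open>The fraction is routed through the sum over all windows, where the common
        scale cancels and no asymptotics of the partition function itself are required.\<close>
      have "(\<lambda>n. R n * P i n / (R n * (\<Sum>i\<in>{1..k}. P i n)) * ((\<Sum>i\<in>{1..k}. P i n) / Z n)) \<longlonglongrightarrow> mw i / S * 1"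
        using lim1[OF i] iJ limS limQ Spos by (intro tendsto_mult tendsto_divide) auto
      moreover have "\<forall>\<^sub>F n in sequentially. R n * P i n / (R n * (\<Sum>i\<in>{1..k}. P i n)) * ((\<Sum>i\<in>{1..k}. P i n) / Z n) = P i n / Z n"
        using eventually_gt_at_top[of 0] order_tendstoD(1)[OF limS Spos]
      proof eventually_elim
        case (elim n)
        then have "R n \<noteq> 0" "(\<Sum>i\<in>{1..k}. P i n) \<noteq> 0" by auto
        then show ?case by simp
      qed
      ultimately have "(\<lambda>n. P i n / Z n) \<longlonglongrightarrow> mw i / S * 1" by (rule Lim_transform_eventually)
      then show "(\<lambda>n. (\<Sum>j\<in>window (a i) \<delta> n. bweight f B (t n) n j) / (\<Sum>j\<le>n. bweight f B (t n) n j))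
        \<longlonglongrightarrow> mode_prob (free_energy p \<beta> h) B k a i"
        unfolding P_def Z_def mode_prob_def mw_def S_def J_def by simp
    qed
  qed (use d1 d2 in auto)
qed

section \<open>The limit theorems\<close>

lemma rate_at_top: "0 < q \<Longrightarrow> filterlim (\<lambda>n. real n powr (1 / real q)) at_top sequentially"
proof -
  assume "0 < q"
  then have "0 < 1 / real q" by simp
  then show ?thesis by real_asymp
qed

lemma mu_r_gibbs: "mu_r p \<beta> h \<beta>' h' n =
  gibbs n (\<lambda>y. real n * pspin p \<beta> h y + real n powr (1 / real 2) * pspin p \<beta>' h' y)"
  by (simp add: mu_r_def powr_half_sqrt)

lemma mu_s_gibbs: "mu_s p \<beta> h \<beta>' h' n =
  gibbs n (\<lambda>y. real n * pspin p \<beta> h y + real n powr (1 / real 4) * pspin p \<beta>' h' y)"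
  by (simp add: mu_s_def)

lemma wasserstein_full:
  fixes \<beta> h \<beta>' h' :: real and p q :: nat
  defines "f \<equiv> pspin p \<beta> h" and "B \<equiv> pspin p \<beta>' h'" and "t \<equiv> \<lambda>n. real n powr (1 / real q)"
  assumes a: "maximizers p \<beta> h = {a}" "0 < a" "a < 1" and c: "c < 0" and q: "even q" "2 \<le> q"
    and L: "laplace_at q f B a c b \<delta>" and d: "0 < \<delta>"
    and \<nu>: "\<And>g. 1-lipschitz_on UNIV g \<Longrightarrow> integral\<^sup>L \<nu> g =
       (LBINT x. g (2 * x) * tilt q c b x) / (LBINT x. tilt q c b x)"
  shows "\<exists>C. \<forall>\<^sub>F n in sequentially. wasserstein (distr (gibbs n (\<lambda>y. real n * f y + t n * B y)) borel
    (\<lambda>\<omega>. (magnetization n \<omega> - real n * (2 * a - 1)) / (real n / t n))) \<nu> \<le> ennreal (C / t n)"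
proof -
  obtain C where C: "0 < C" "\<forall>\<^sub>F n in sequentially. \<forall>\<phi>. test_fun \<phi> \<longrightarrow>
    \<bar>rescaled_sum f B a (t n) n {..n} \<phi> - (LBINT x. \<phi> x * tilt q c b x)\<bar> \<le> C / t n"
    using full_sum_approx[OF a c q, of \<beta>' h' b \<delta>] L d unfolding f_def B_def t_def by blast
  show ?thesis
  proof (rule wasserstein_from_ratio[OF c q C(1) _ C(2)[unfolded rescaled_sum_def] _ \<nu>])
    show "filterlim t at_top sequentially" unfolding t_def using q by (intro rate_at_top) auto
    show "\<forall>\<^sub>F n in sequentially. \<forall>g. 1-lipschitz_on UNIV g \<longrightarrow>
      integral\<^sup>L (distr (gibbs n (\<lambda>y. real n * f y + t n * B y)) borel
        (\<lambda>\<omega>. (magnetization n \<omega> - real n * (2 * a - 1)) / (real n / t n))) g =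
      (\<Sum>k\<in>{..n}. g (2 * (t n * (real k / real n - a))) * bweight f B (t n) n k) / (\<Sum>k\<in>{..n}. bweight f B (t n) n k)"
      using eventually_gt_at_top[of 0]
    proof eventually_elim
      case (elim n)
      then have tn: "0 < t n" unfolding t_def by simp
      show ?case by (intro allI impI integral_distr_magnetization[OF elim tn refl] lipschitz_measurable)
    qed
  qed
qed

lemma wasserstein_conditional:
  fixes \<beta> h \<beta>' h' :: real and p q :: nat
  defines "f \<equiv> pspin p \<beta> h" and "B \<equiv> pspin p \<beta>' h'" and "t \<equiv> \<lambda>n. real n powr (1 / real q)"
  defines "\<mu> \<equiv> \<lambda>n. gibbs n (\<lambda>y. real n * f y + t n * B y)"
  assumes a: "0 < a" "a < 1" and c: "c < 0" and q: "even q" "2 \<le> q"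
    and L: "laplace_at q f B a c b (\<delta> / 2)" and d: "0 < \<delta>"
    and \<nu>: "\<And>g. 1-lipschitz_on UNIV g \<Longrightarrow> integral\<^sup>L \<nu> g =
       (LBINT x. g (2 * x) * tilt q c b x) / (LBINT x. tilt q c b x)"
  shows "\<exists>C. \<forall>\<^sub>F n in sequentially. wasserstein (distr
      (uniform_measure (\<mu> n) {\<omega> \<in> space (\<mu> n). \<bar>magnetization n \<omega> / real n - (2 * a - 1)\<bar> \<le> \<delta>}) borel
      (\<lambda>\<omega>. (magnetization n \<omega> - real n * (2 * a - 1)) / (real n / t n))) \<nu> \<le> ennreal (C / t n)"
proof -
  have q0: "0 < q" using q by simp
  obtain C where C: "0 < C" "\<And>n \<phi>. 0 < n \<Longrightarrow> test_fun \<phi> \<Longrightarrow>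
    \<bar>rescaled_sum f B a (t n) n (window a (\<delta> / 2) n) \<phi> - (LBINT x. \<phi> x * tilt q c b x)\<bar> \<le> C / t n"
    using L unfolding laplace_at_def t_def by blast
  have C2: "\<forall>\<^sub>F n in sequentially. \<forall>\<phi>. test_fun \<phi> \<longrightarrow>
    \<bar>rescaled_sum f B a (t n) n (window a (\<delta> / 2) n) \<phi> - (LBINT x. \<phi> x * tilt q c b x)\<bar> \<le> C / t n"
    using eventually_gt_at_top[of 0] by eventually_elim (blast intro: C(2))
  have small: "\<forall>\<^sub>F n in sequentially. 1 / real n \<le> \<delta> / 2" using d by real_asymp
  show ?thesis
  proof (rule wasserstein_from_ratio[OF c q C(1) _ C2[unfolded rescaled_sum_def] _ \<nu>])
    show "filterlim t at_top sequentially" unfolding t_def by (rule rate_at_top[OF q0])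
    show "\<forall>\<^sub>F n in sequentially. \<forall>g. 1-lipschitz_on UNIV g \<longrightarrow>
      integral\<^sup>L (distr (uniform_measure (\<mu> n) {\<omega> \<in> space (\<mu> n). \<bar>magnetization n \<omega> / real n - (2 * a - 1)\<bar> \<le> \<delta>}) borel
        (\<lambda>\<omega>. (magnetization n \<omega> - real n * (2 * a - 1)) / (real n / t n))) g =
      (\<Sum>k\<in>window a (\<delta> / 2) n. g (2 * (t n * (real k / real n - a))) * bweight f B (t n) n k)
        / (\<Sum>k\<in>window a (\<delta> / 2) n. bweight f B (t n) n k)"
      using eventually_gt_at_top[of 0] small unfolding \<mu>_def
    proof eventually_elim
      case (elim n)
      then have tn: "0 < t n" unfolding t_def by simp
      have ne: "window a (\<delta> / 2) n \<noteq> {}" using a elim by (intro window_nonempty) auto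
      show ?case
        by (intro allI impI integral_distr_magnetization_conditional[OF elim(1) tn refl _ ne] lipschitz_measurable)
    qed
  qed
qed

lemma regular_at_1:
  assumes "0 < a" "a < 1" "regular_at 1 (free_energy p \<beta> h) a"
  shows "energy_deriv p \<beta> h 2 a < 0"
  using assms higher_deriv_free_energy[OF assms(1,2), of 2 p \<beta> h] by (simp add: regular_at_def)

lemma laplace_at_regular:
  assumes a: "a \<in> maximizers p \<beta> h" "0 < a" "a < 1" and neg: "energy_deriv p \<beta> h 2 a < 0"
  shows "\<exists>\<delta>1>0. \<forall>\<delta>. 0 < \<delta> \<and> \<delta> \<le> \<delta>1 \<longrightarrow> laplace_at 2 (pspin p \<beta> h) (pspin p \<beta>' h') a
    ((deriv ^^ 2) (free_energy p \<beta> h) a / 2) (deriv (pspin p \<beta>' h') a) \<delta>"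
proof -
  have "energy_deriv p \<beta> h m a = 0" if "0 < m" "m < 2" for m
  proof -
    have "m = 1" using that by simp
    then show ?thesis using maximizer_deriv_eq_0[OF a] by simp
  qed
  from laplace_at_maximizer[OF a(2,3) _ _ this neg, of \<beta>' h'] show ?thesis
    unfolding higher_deriv_free_energy[OF a(2,3)] by simp
qed

text \<open>The outside estimate with \<open>a\<close> as its reference maximizer, transported to
  the magnetization: there the radius doubles, hence the \<open>\<delta> / 2\<close> in the
  sums.\<close>

lemma gibbs_tail:
  fixes \<beta> h \<beta>' h' :: real and p :: nat
  assumes a: "a \<in> maximizers p \<beta> h" "0 < a" "a < 1" and neg: "energy_deriv p \<beta> h 2 a < 0"
  shows "\<exists>\<delta>0>0. \<forall>\<delta>. 0 < \<delta> \<and> \<delta> < \<delta>0 \<longrightarrow> (\<exists>c>0. \<forall>\<^sub>F n in sequentially.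
    \<P>(\<omega> in mu_r p \<beta> h \<beta>' h' n. \<forall>x\<in>maximizers p \<beta> h. \<delta> < \<bar>magnetization n \<omega> / real n - (2 * x - 1)\<bar>)
      \<le> exp (- c * real n))"
proof (rule exI[of _ 1], intro conjI allI impI)
  fix \<delta> :: real assume "0 < \<delta> \<and> \<delta> < 1"
  then have d: "0 < \<delta>" by simp
  have c: "(deriv ^^ 2) (free_energy p \<beta> h) a / 2 < 0" using neg higher_deriv_free_energy[OF a(2,3), of 2 p \<beta> h] by simp
  obtain \<delta>0 where L: "laplace_at 2 (pspin p \<beta> h) (pspin p \<beta>' h') a
    ((deriv ^^ 2) (free_energy p \<beta> h) a / 2) (deriv (pspin p \<beta>' h') a) \<delta>0"
    using laplace_at_regular[OF a neg] by blast
  let ?w = "\<lambda>n k. bweight (pspin p \<beta> h) (pspin p \<beta>' h') (real n powr (1 / real 2)) n k"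
  obtain c' where c': "0 < c'" and out: "\<forall>\<^sub>F n in sequentially.
    (\<Sum>k | k \<le> n \<and> (\<forall>x\<in>maximizers p \<beta> h. \<delta> / 2 < \<bar>real k / real n - x\<bar>). ?w n k)
      \<le> exp (- c' * real n) * (\<Sum>k\<le>n. ?w n k)"
    using outside_exponentially_small[OF a c _ _ L, of "\<delta> / 2"] d by auto
  have "\<forall>\<^sub>F n in sequentially.
    \<P>(\<omega> in mu_r p \<beta> h \<beta>' h' n. \<forall>x\<in>maximizers p \<beta> h. \<delta> < \<bar>magnetization n \<omega> / real n - (2 * x - 1)\<bar>)
      \<le> exp (- c' * real n)"
    using out eventually_gt_at_top[of 0]
  proof eventually_elim
    case (elim n)
    let ?S = "{k. \<forall>x\<in>maximizers p \<beta> h. \<delta> / 2 < \<bar>real k / real n - x\<bar>}"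
    have S: "{k. k \<le> n \<and> (\<forall>x\<in>maximizers p \<beta> h. \<delta> / 2 < \<bar>real k / real n - x\<bar>)} = {..n} \<inter> ?S" by auto
    have "\<P>(\<omega> in mu_r p \<beta> h \<beta>' h' n. \<forall>x\<in>maximizers p \<beta> h. \<delta> < \<bar>magnetization n \<omega> / real n - (2 * x - 1)\<bar>)
        = (\<Sum>k\<in>{..n} \<inter> ?S. ?w n k) / (\<Sum>k\<le>n. ?w n k)"
      unfolding mu_r_gibbs bweight_def
    proof (rule measure_gibbs)
      fix \<omega> assume w: "\<omega> \<in> configs n"
      have e: "\<delta> < \<bar>2 * y - 1 - (2 * x - 1)\<bar> \<longleftrightarrow> \<delta> / 2 < \<bar>y - x\<bar>" for x y :: real by linarith
      show "(\<forall>x\<in>maximizers p \<beta> h. \<delta> < \<bar>magnetization n \<omega> / real n - (2 * x - 1)\<bar>)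
          \<longleftrightarrow> card {i\<in>{1..n}. \<omega> i = 1} \<in> ?S"
        unfolding magnetization_density[OF w elim(2)] mem_Collect_eq e by (rule refl)
    qed
    moreover have "0 < (\<Sum>k\<le>n. ?w n k)" by (intro sum_pos bweight_pos) auto
    ultimately show ?case using elim(1) unfolding S by (simp only: pos_divide_le_eq)
  qed
  then show "\<exists>c>0. \<forall>\<^sub>F n in sequentially.
    \<P>(\<omega> in mu_r p \<beta> h \<beta>' h' n. \<forall>x\<in>maximizers p \<beta> h. \<delta> < \<bar>magnetization n \<omega> / real n - (2 * x - 1)\<bar>)
      \<le> exp (- c * real n)"
    using c' by (intro exI[of _ c']) simp
qed simp

lemma mode_prob_sum:
  assumes "J = top_indices B k a" "J \<noteq> {}" "\<And>i. i \<in> {1..k} \<Longrightarrow> 0 < mode_weight A B (a i)"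
  shows "(\<Sum>i\<in>J. mode_prob A B k a i) = 1" "\<And>i. i \<in> J \<Longrightarrow> 0 < mode_prob A B k a i"
proof -
  have fin: "finite J" and sub: "J \<subseteq> {1..k}" using assms(1) by (auto simp: top_indices_def)
  have pos: "0 < (\<Sum>l\<in>J. mode_weight A B (a l))" using fin assms(2,3) sub by (intro sum_pos) auto
  show "(\<Sum>i\<in>J. mode_prob A B k a i) = 1"
    unfolding mode_prob_def assms(1)[symmetric] sum_divide_distrib[symmetric] using pos by simp
  show "0 < mode_prob A B k a i" if "i \<in> J" for i
    unfolding mode_prob_def assms(1)[symmetric] using pos that sub assms(3) by (intro divide_pos_pos) auto
qed

lemma top_indices_nonempty: "1 \<le> k \<Longrightarrow> top_indices B k a \<noteq> {}"
proof -
  assume "1 \<le> k"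
  then have "Max ((\<lambda>l. B (a l)) ` {1..k}) \<in> (\<lambda>l. B (a l)) ` {1..k}" by (intro Max_in) auto
  then show ?thesis unfolding top_indices_def by auto
qed

text \<open>The limit law enters only through its integrals, so one argument serves a point mass and
  a mixture of several.\<close>

lemma weak_conv_modes:
  fixes \<beta> h \<beta>' h' :: real and p k :: nat and a :: "nat \<Rightarrow> real"
  assumes k: "1 \<le> k" and inj: "inj_on a {1..k}" and a: "a ` {1..k} = maximizers p \<beta> h" "maximizers p \<beta> h \<subseteq> {0<..<1}"
    and neg: "\<And>i. i \<in> {1..k} \<Longrightarrow> energy_deriv p \<beta> h 2 (a i) < 0"
    and M: "real_distribution M"
    and intM: "\<And>g. g \<in> borel_measurable borel \<Longrightarrow> integral\<^sup>L M g = (\<Sum>i\<in>top_indices (pspin p \<beta>' h') k a.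
        mode_prob (free_energy p \<beta> h) (pspin p \<beta>' h') k a i * g (2 * a i - 1))"
  shows "weak_conv_m (\<lambda>n. distr (mu_r p \<beta> h \<beta>' h' n) borel (\<lambda>\<omega>. magnetization n \<omega> / real n)) M"
proof -
  define w where "w n j = bweight (pspin p \<beta> h) (pspin p \<beta>' h') (real n powr (1 / real 2)) n j" for n j
  define Z where "Z n = (\<Sum>j\<le>n. w n j)" for n
  have Zp: "0 < Z n" for n unfolding Z_def w_def by (intro sum_pos bweight_pos) auto
  obtain \<delta>0 where \<delta>0: "0 < \<delta>0" "\<And>\<delta> i. 0 < \<delta> \<Longrightarrow> \<delta> < \<delta>0 \<Longrightarrow> i \<in> top_indices (pspin p \<beta>' h') k a \<Longrightarrow>
    (\<lambda>n. (\<Sum>j\<in>window (a i) \<delta> n. w n j) / Z n) \<longlonglongrightarrow> mode_prob (free_energy p \<beta> h) (pspin p \<beta>' h') k a i"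
    using mode_limits(1)[OF k inj a neg, of \<beta>' h'] unfolding w_def Z_def by blast
  have mw: "0 < mode_weight (free_energy p \<beta> h) (pspin p \<beta>' h') (a i)" if "i \<in> {1..k}" for i
    using mode_limits(2)[OF k inj a neg, of \<beta>' h' i] that by blast
  have sub: "top_indices (pspin p \<beta>' h') k a \<subseteq> {1..k}" by (auto simp: top_indices_def)
  note mp = mode_prob_sum[OF refl top_indices_nonempty[OF k] mw]
  show ?thesis
  proof (rule weak_conv_from_windows[OF M _ _ _ _ _ _ _ \<delta>0(1) _ _ intM, where w = "\<lambda>n j. w n j / Z n"])
    show "real_distribution (distr (mu_r p \<beta> h \<beta>' h' n) borel (\<lambda>\<omega>. magnetization n \<omega> / real n))" for n
      unfolding mu_r_gibbs
      by (intro prob_space.real_distribution_distr prob_space_gibbs measurable_gibbs)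
    show "finite (top_indices (pspin p \<beta>' h') k a)" using sub finite_subset by blast
    show "inj_on a (top_indices (pspin p \<beta>' h') k a)" using inj sub by (rule inj_on_subset)
    show "0 \<le> w n j / Z n" for n j using Zp[of n] by (simp add: w_def bweight_nonneg)
    show "(\<Sum>j\<le>n. w n j / Z n) = 1" for n using Zp[of n] by (simp add: sum_divide_distrib[symmetric] Z_def)
    show "(\<lambda>n. \<Sum>j\<in>window (a i) \<delta> n. w n j / Z n) \<longlonglongrightarrow> mode_prob (free_energy p \<beta> h) (pspin p \<beta>' h') k a i"
      if "0 < \<delta>" "\<delta> < \<delta>0" "i \<in> top_indices (pspin p \<beta>' h') k a" for \<delta> i
      using \<delta>0(2)[OF that] by (simp add: sum_divide_distrib)
    fix n :: nat and g :: "real \<Rightarrow> real" assume n: "0 < n" and g: "g \<in> borel_measurable borel"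
    have "integral\<^sup>L (distr (mu_r p \<beta> h \<beta>' h' n) borel (\<lambda>\<omega>. magnetization n \<omega> / real n)) g
        = integral\<^sup>L (mu_r p \<beta> h \<beta>' h' n) (\<lambda>\<omega>. g (magnetization n \<omega> / real n))"
      unfolding mu_r_gibbs by (rule integral_distr[OF measurable_gibbs g])
    also have "\<dots> = (\<Sum>j\<le>n. g (2 * (real j / real n) - 1) * w n j) / Z n"
      unfolding mu_r_gibbs Z_def w_def bweight_def
      by (rule integral_gibbs[where g = "\<lambda>j. g (2 * (real j / real n) - 1)"]) (simp add: magnetization_density[OF _ n])
    finally show "integral\<^sup>L (distr (mu_r p \<beta> h \<beta>' h' n) borel (\<lambda>\<omega>. magnetization n \<omega> / real n)) g
        = (\<Sum>j\<le>n. g (2 * (real j / real n) - 1) * (w n j / Z n))"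
      by (simp add: sum_divide_distrib)
  qed (use mp in \<open>auto intro: less_imp_le\<close>)
qed

lemma discrete_law:
  assumes J: "finite J" and w: "(\<Sum>i\<in>J. w i) = 1" "\<And>i. i \<in> J \<Longrightarrow> 0 \<le> w i"
  shows "real_distribution (discrete_law J w x)"
    and "g \<in> borel_measurable borel \<Longrightarrow> integral\<^sup>L (discrete_law J w x) g = (\<Sum>i\<in>J. w i * g (x i))"
proof -
  have m: "x \<in> measurable (point_measure J (\<lambda>i. ennreal (w i))) borel"
    by (auto simp: measurable_def space_point_measure sets_point_measure)
  have "prob_space (point_measure J (\<lambda>i. ennreal (w i)))"
    by (rule prob_spaceI) (simp add: space_point_measure emeasure_point_measure_finite J w sum_ennreal)
  then show "real_distribution (discrete_law J w x)"
    unfolding discrete_law_def by (rule prob_space.real_distribution_distr[OF _ m])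
  show "integral\<^sup>L (discrete_law J w x) g = (\<Sum>i\<in>J. w i * g (x i))" if g: "g \<in> borel_measurable borel"
    unfolding discrete_law_def integral_distr[OF m g]
    by (subst lebesgue_integral_point_measure_finite) (auto simp: J w)
qed

section \<open>Rates and the limit theorem for each regime\<close>

lemma rate_half:
  fixes C :: real and n :: nat
  shows "real n / real n powr (1 / real 2) = sqrt (real n)" "C / real n powr (1 / real 2) = C * real n powr (- 1 / 2)"
  by (simp_all add: powr_half_sqrt real_div_sqrt powr_minus_divide)

lemma rate_quarter:
  fixes C :: real and n :: nat
  shows "real n / real n powr (1 / real 4) = real n powr (3 / 4)" "C / real n powr (1 / real 4) = C * real n powr (- 1 / 4)"
proof -
  show "real n / real n powr (1 / real 4) = real n powr (3 / 4)"
  proof (cases "n = 0")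
    case False
    then have "real n powr 1 / real n powr (1 / 4) = real n powr (1 - 1 / 4)" by (simp only: powr_diff)
    then show ?thesis using False by simp
  qed simp
qed (simp add: powr_minus_divide)

lemma normal_clt:
  assumes mx: "maximizers p \<beta> h = {a}" and a01: "0 < a" "a < 1" and neg: "energy_deriv p \<beta> h 2 a < 0"
  shows "\<exists>C. \<forall>\<^sub>F n in sequentially.
    wasserstein
      (distr (mu_r p \<beta> h \<beta>' h' n) borel (\<lambda>\<omega>. (magnetization n \<omega> - real n * (2 * a - 1)) / sqrt (real n)))
      (normal_law
        (2 * deriv (pspin p \<beta>' h') a / \<bar>(deriv ^^ 2) (free_energy p \<beta> h) a\<bar>)
        (4 / \<bar>(deriv ^^ 2) (free_energy p \<beta> h) a\<bar>))
    \<le> ennreal (C * real n powr (- 1 / 2))"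
proof -
  obtain \<delta>1 where \<delta>1: "0 < \<delta>1" "laplace_at 2 (pspin p \<beta> h) (pspin p \<beta>' h') a
    ((deriv ^^ 2) (free_energy p \<beta> h) a / 2) (deriv (pspin p \<beta>' h') a) \<delta>1"
    using laplace_at_regular[OF _ a01 neg] mx by blast
  have A: "(deriv ^^ 2) (free_energy p \<beta> h) a < 0" using neg higher_deriv_free_energy[OF a01, of 2 p \<beta> h] by simp
  then have A2: "(deriv ^^ 2) (free_energy p \<beta> h) a / 2 < 0" by simp
  show ?thesis
    using wasserstein_full[OF mx a01 A2 even_numeral order_refl \<delta>1(2,1) integral_normal_law[OF A]]
    unfolding mu_r_gibbs rate_half(1) unfolding rate_half(2) .
qed

lemma normal_clt_conditional:
  assumes am: "a \<in> maximizers p \<beta> h" and a01: "0 < a" "a < 1" and neg: "energy_deriv p \<beta> h 2 a < 0"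
  shows "\<exists>\<delta>0>0. \<forall>\<delta>. 0 < \<delta> \<and> \<delta> < \<delta>0 \<longrightarrow> (\<exists>C. \<forall>\<^sub>F n in sequentially.
    wasserstein
      (distr
        (uniform_measure (mu_r p \<beta> h \<beta>' h' n)
          {\<omega> \<in> space (mu_r p \<beta> h \<beta>' h' n). \<bar>magnetization n \<omega> / real n - (2 * a - 1)\<bar> \<le> \<delta>})
        borel (\<lambda>\<omega>. (magnetization n \<omega> - real n * (2 * a - 1)) / sqrt (real n)))
      (normal_law
        (2 * deriv (pspin p \<beta>' h') a / \<bar>(deriv ^^ 2) (free_energy p \<beta> h) a\<bar>)
        (4 / \<bar>(deriv ^^ 2) (free_energy p \<beta> h) a\<bar>))
    \<le> ennreal (C * real n powr (- 1 / 2)))"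
proof -
  obtain \<delta>1 where \<delta>1: "0 < \<delta>1" "\<And>\<delta>. 0 < \<delta> \<Longrightarrow> \<delta> \<le> \<delta>1 \<Longrightarrow> laplace_at 2 (pspin p \<beta> h) (pspin p \<beta>' h') a
    ((deriv ^^ 2) (free_energy p \<beta> h) a / 2) (deriv (pspin p \<beta>' h') a) \<delta>"
    using laplace_at_regular[OF am a01 neg] by blast
  have A: "(deriv ^^ 2) (free_energy p \<beta> h) a < 0" using neg higher_deriv_free_energy[OF a01, of 2 p \<beta> h] by simp
  then have A2: "(deriv ^^ 2) (free_energy p \<beta> h) a / 2 < 0" by simp
  show ?thesis
  proof (rule exI[of _ \<delta>1], intro conjI allI impI, goal_cases)
    case (2 \<delta>)
    then have d: "0 < \<delta>" and "0 < \<delta> / 2" "\<delta> / 2 \<le> \<delta>1" by auto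
    note L = \<delta>1(2)[OF this(2,3)]
    show ?case
      using wasserstein_conditional[OF a01 A2 even_numeral order_refl L d integral_normal_law[OF A]]
      unfolding mu_r_gibbs rate_half(1) unfolding rate_half(2) .
  qed (rule \<delta>1(1))
qed

text \<open>Here \<open>q = 4\<close>: maximality supplies the vanishing of the first and third
  derivatives and the energy structure the negative fourth one. The normalisation
  \<open>n^(3/4)\<close> is \<open>n / t\<close>.\<close>

lemma quartic_clt:
  assumes p: "2 \<le> p" and mx: "maximizers p \<beta> h = {a}" and a01: "0 < a" "a < 1"
    and d2: "(deriv ^^ 2) (free_energy p \<beta> h) a = 0"
  shows "\<exists>C. \<forall>\<^sub>F n in sequentially.
    wasserstein
      (distr (mu_s p \<beta> h \<beta>' h' n) borel (\<lambda>\<omega>. (magnetization n \<omega> - real n * (2 * a - 1)) / real n powr (3 / 4)))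
      (quartic_law ((deriv ^^ 4) (free_energy p \<beta> h) a / 24) (deriv (pspin p \<beta>' h') a))
    \<le> ennreal (C * real n powr (- 1 / 4))"
proof -
  have am: "a \<in> maximizers p \<beta> h" using mx by simp
  have e2: "energy_deriv p \<beta> h 2 a = 0" using d2 higher_deriv_free_energy[OF a01, of 2 p \<beta> h] by simp
  note e3 = maximizer_third_deriv_eq_0[OF am a01 e2]
  note e4 = fourth_deriv_neg[OF p a01 e2 e3]
  have z: "energy_deriv p \<beta> h m a = 0" if "0 < m" "m < 4" for m
  proof -
    have "m = 1 \<or> m = 2 \<or> m = 3" using that by auto
    then show ?thesis using maximizer_deriv_eq_0[OF am a01] e2 e3 by auto
  qed
  have c4: "energy_deriv p \<beta> h 4 a / fact 4 = (deriv ^^ 4) (free_energy p \<beta> h) a / 24"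
    unfolding higher_deriv_free_energy[OF a01] by (simp add: fact_numeral)
  obtain \<delta>1 where \<delta>1: "0 < \<delta>1" "laplace_at 4 (pspin p \<beta> h) (pspin p \<beta>' h') a
    ((deriv ^^ 4) (free_energy p \<beta> h) a / 24) (deriv (pspin p \<beta>' h') a) \<delta>1"
    using laplace_at_maximizer[OF a01 _ _ z e4, of \<beta>' h'] unfolding c4 by auto
  have neg: "(deriv ^^ 4) (free_energy p \<beta> h) a / 24 < 0"
    using e4 unfolding higher_deriv_free_energy[OF a01] by simp
  show ?thesis
    using wasserstein_full[OF mx a01 neg _ _ \<delta>1(2,1) integral_quartic_law[OF neg]]
    unfolding mu_s_gibbs rate_quarter(1) unfolding rate_quarter(2) by simp
qed

lemma R1_facts:
  assumes "(\<beta>, h) \<in> R1 p \<and> maximizers p \<beta> h = {a}"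
  shows "maximizers p \<beta> h = {a}" "0 < a" "a < 1" "energy_deriv p \<beta> h 2 a < 0"
  using assms regular_at_1 unfolding R1_def by auto

lemma R2_facts:
  fixes k :: nat and a :: "nat \<Rightarrow> real"
  assumes "(\<beta>, h) \<in> R2 p \<and> strict_mono_on {1..k} a \<and> a ` {1..k} = maximizers p \<beta> h"
  shows "1 \<le> k" "inj_on a {1..k}" "a ` {1..k} = maximizers p \<beta> h" "maximizers p \<beta> h \<subseteq> {0<..<1}"
    and "i \<in> {1..k} \<Longrightarrow> a i \<in> maximizers p \<beta> h" "i \<in> {1..k} \<Longrightarrow> 0 < a i" "i \<in> {1..k} \<Longrightarrow> a i < 1"
      "i \<in> {1..k} \<Longrightarrow> energy_deriv p \<beta> h 2 (a i) < 0"
proof -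
  show im: "a ` {1..k} = maximizers p \<beta> h" and sub: "maximizers p \<beta> h \<subseteq> {0<..<1}" and "inj_on a {1..k}"
    using assms unfolding R2_def by (auto intro: strict_mono_on_imp_inj_on)
  have "2 \<le> card (maximizers p \<beta> h)" using assms unfolding R2_def by auto
  then show "1 \<le> k" using im by (cases k) auto
  assume i: "i \<in> {1..k}"
  then show mx: "a i \<in> maximizers p \<beta> h" using im by blast
  then show a01: "0 < a i" "a i < 1" using sub by auto
  have "regular_at 1 (free_energy p \<beta> h) (a i)" using assms mx unfolding R2_def by blast
  then show "energy_deriv p \<beta> h 2 (a i) < 0" by (rule regular_at_1[OF a01])
qed

text \<open>The multi-mode result with one index and a constant family: the only mode probability is
  a weight divided by itself, and positivity of that weight makes it one.\<close>

lemma weak_conv_unique_mode: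
  assumes mx: "maximizers p \<beta> h = {a}" and a01: "0 < a" "a < 1" and neg: "energy_deriv p \<beta> h 2 a < 0"
  shows "weak_conv_m (\<lambda>n. distr (mu_r p \<beta> h \<beta>' h' n) borel (\<lambda>\<omega>. magnetization n \<omega> / real n)) (return borel (2 * a - 1))"
proof (rule weak_conv_modes[where k = 1 and a = "\<lambda>_. a"])
  have ti: "top_indices (pspin p \<beta>' h') 1 (\<lambda>_. a) = {1}" unfolding top_indices_def by simp
  have "0 < mode_weight (free_energy p \<beta> h) (pspin p \<beta>' h') a"
    using mode_limits(2)[of 1 "\<lambda>_. a" p \<beta> h \<beta>' h' 1] mx a01 neg by auto
  then have mp: "mode_prob (free_energy p \<beta> h) (pspin p \<beta>' h') 1 (\<lambda>_. a) 1 = 1"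
    unfolding mode_prob_def ti by simp
  show "integral\<^sup>L (return borel (2 * a - 1)) g = (\<Sum>i\<in>top_indices (pspin p \<beta>' h') 1 (\<lambda>_. a).
      mode_prob (free_energy p \<beta> h) (pspin p \<beta>' h') 1 (\<lambda>_. a) i * g (2 * a - 1))" if "g \<in> borel_measurable borel" for g
    unfolding ti using that mp by (simp add: integral_return)
  show "real_distribution (return borel (2 * a - 1))"
    unfolding real_distribution_def real_distribution_axioms_def by (simp add: prob_space_return)
qed (use mx a01 neg in auto)

theorem theorem5p1:
  fixes p :: nat and \<beta> h \<beta>' h' :: real
  assumes "2 \<le> p" and "0 < \<beta>"
  shows
    "(\<forall>a. (\<beta>, h) \<in> R1 p \<and> maximizers p \<beta> h = {a} \<longrightarrow>
        weak_conv_m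
          (\<lambda>n. distr (mu_r p \<beta> h \<beta>' h' n) borel (\<lambda>\<omega>. magnetization n \<omega> / real n))
          (return borel (2 * a - 1))
      \<and> (\<exists>\<delta>0>0. \<forall>\<delta>. 0 < \<delta> \<and> \<delta> < \<delta>0 \<longrightarrow>
          (\<exists>c>0. \<forall>\<^sub>F n in sequentially.
             \<P>(\<omega> in mu_r p \<beta> h \<beta>' h' n. \<bar>magnetization n \<omega> / real n - (2 * a - 1)\<bar> > \<delta>)
               \<le> exp (- c * real n)))
      \<and> (\<exists>C. \<forall>\<^sub>F n in sequentially.
          wasserstein
            (distr (mu_r p \<beta> h \<beta>' h' n) borel
               (\<lambda>\<omega>. (magnetization n \<omega> - real n * (2 * a - 1)) / sqrt (real n)))
            (normal_law
               (2 * deriv (pspin p \<beta>' h') a / \<bar>(deriv ^^ 2) (free_energy p \<beta> h) a\<bar>)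
               (4 / \<bar>(deriv ^^ 2) (free_energy p \<beta> h) a\<bar>))
          \<le> ennreal (C * real n powr (- 1 / 2))))
   \<and> (\<forall>k a. (\<beta>, h) \<in> R2 p \<and> strict_mono_on {1..k} a \<and> a ` {1..k} = maximizers p \<beta> h \<longrightarrow>
        (\<exists>\<delta>0>0. \<forall>\<delta>. 0 < \<delta> \<and> \<delta> < \<delta>0 \<longrightarrow>
          (\<exists>c>0. \<forall>\<^sub>F n in sequentially.
             \<P>(\<omega> in mu_r p \<beta> h \<beta>' h' n.
                 \<forall>i\<in>{1..k}. \<bar>magnetization n \<omega> / real n - (2 * a i - 1)\<bar> > \<delta>)
               \<le> exp (- c * real n)))
      \<and> weak_conv_m
          (\<lambda>n. distr (mu_r p \<beta> h \<beta>' h' n) borel (\<lambda>\<omega>. magnetization n \<omega> / real n))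
          (discrete_law (top_indices (pspin p \<beta>' h') k a)
             (mode_prob (free_energy p \<beta> h) (pspin p \<beta>' h') k a) (\<lambda>i. 2 * a i - 1))
      \<and> (\<forall>i\<in>{1..k}. \<exists>\<delta>0>0. \<forall>\<delta>. 0 < \<delta> \<and> \<delta> < \<delta>0 \<longrightarrow>
          (\<exists>C. \<forall>\<^sub>F n in sequentially.
             wasserstein
               (distr
                 (uniform_measure (mu_r p \<beta> h \<beta>' h' n)
                   {\<omega> \<in> space (mu_r p \<beta> h \<beta>' h' n).
                      \<bar>magnetization n \<omega> / real n - (2 * a i - 1)\<bar> \<le> \<delta>})
                 borel
                 (\<lambda>\<omega>. (magnetization n \<omega> - real n * (2 * a i - 1)) / sqrt (real n)))
               (normal_law
                 (2 * deriv (pspin p \<beta>' h') (a i) / \<bar>(deriv ^^ 2) (free_energy p \<beta> h) (a i)\<bar>)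
                 (4 / \<bar>(deriv ^^ 2) (free_energy p \<beta> h) (a i)\<bar>))
             \<le> ennreal (C * real n powr (- 1 / 2)))))
   \<and> (\<forall>a. (\<beta>, h) \<in> R3 p \<and> maximizers p \<beta> h = {a} \<longrightarrow>
        (\<exists>C. \<forall>\<^sub>F n in sequentially.
          wasserstein
            (distr (mu_s p \<beta> h \<beta>' h' n) borel
               (\<lambda>\<omega>. (magnetization n \<omega> - real n * (2 * a - 1)) / real n powr (3 / 4)))
            (quartic_law
               ((deriv ^^ 4) (free_energy p \<beta> h) a / 24)
               (deriv (pspin p \<beta>' h') a))
          \<le> ennreal (C * real n powr (- 1 / 4))))"
proof (intro conjI allI impI ballI, goal_cases)
  case (1 a)
  then show ?case by (intro weak_conv_unique_mode R1_facts)
next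
  case (2 a)
  note R = R1_facts[OF this]
  show ?case using gibbs_tail[OF _ R(2-4), of \<beta>' h'] unfolding R(1) by simp
next
  case (3 a)
  then show ?case by (intro normal_clt R1_facts)
next
  case (4 k a)
  note R = R2_facts[OF this]
  \<comment> \<open>The tail bound asks for one reference maximizer; the first index provides it,
    while the event already refers to all of them.\<close>
  have "1 \<in> {1..k}" using R(1) by simp
  from gibbs_tail[OF R(5-8)[OF this], of \<beta>' h'] show ?case unfolding R(3)[symmetric] by simp
next
  case (5 k a)
  note R = R2_facts[OF this]
  have fin: "finite (top_indices (pspin p \<beta>' h') k a)" by (simp add: top_indices_def)
  have "0 < mode_weight (free_energy p \<beta> h) (pspin p \<beta>' h') (a i)" if "i \<in> {1..k}" for i
    using mode_limits(2)[OF R(1-4,8), of \<beta>' h' i] that by blast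
  note mp = mode_prob_sum[OF refl top_indices_nonempty[OF R(1)] this]
  show ?case using mp by (intro weak_conv_modes[OF R(1-4,8)] discrete_law fin) (auto intro: less_imp_le)
next
  case (6 k a i)
  note R = R2_facts[OF this(1)]
  show ?case by (rule normal_clt_conditional[OF R(5-8)[OF 6(2)]])
next
  case (7 a)
  then have "maximizers p \<beta> h = {a}" "0 < a" "a < 1" "(deriv ^^ 2) (free_energy p \<beta> h) a = 0"
    unfolding R3_def by auto
  then show ?case by (rule quartic_clt[OF assms(1)])
qed

end
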